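(* For any $\lambda$-ring $\Lambda$ with a good modifier $S$, and for any well-behaved $\mathbf A,\mathbf B\in\Lambda\otimes\mathrm{Sym}[[X]]$, one has $$\left(\mathrm{Exp}\left[\frac{\mathbf A[X]}{S}\right],\ \mathrm{Exp}\left[\frac{\mathbf B[X]}{S}\right]\right)_X^S=\mathrm{Exp}\left[\frac{L^S(\mathbf A,\mathbf B)}{S}\right]\qquad\text{with }L^S(\mathbf A,\mathbf B)\in\Lambda.$$
   Context: A $\lambda$-ring is a (commutative) $\mathbb Q$-algebra $\Lambda$ with an action $F[G]$ ($F$ a symmetric function over $\mathbb Q$, $G\in\Lambda$) in which the power sums $p_n$ act by ring endomorphisms, $p_1[G]=G$, $p_m[p_n[G]]=p_{mn}[G]$. $\Lambda$ is assumed complete with respect to a decreasing filtration $\Lambda=J^0\supset J^1\supset\cdots$ with $J^iJ^{i'}\subset J^{i+i'}$ (with the $p_n$ continuous); tensor products are completed. $\mathrm{Sym}[[X]]$ is the degree completion of the ring of symmetric functions over $\mathbb Q$ in $X$, so $\mathbf A[X]=\sum_\lambda A_\lambda p_\lambda[X]$ with $A_\lambda\in\Lambda$, summed over all partitions. A sequence $A_1,A_2,\ldots\in\Lambda$ is well-behaved if for each $k$ there is $i_0$ such that $p_\lambda[A_i]\in J^k$ whenever $i>i_0$ or $|\lambda|>i_0$; a series is well-behaved if the sequence of its coefficients is. The plethystic exponential is $\mathrm{Exp}[G]=\exp\left(\sum_{k\ge1}p_k[G]/k\right)$. $S\in\Lambda$ is a good modifier if: (i) for each $n\ge1$, $p_n[S]$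 is not a zero divisor; (ii) for each $n\ge1$, $S\mid p_n[S]$; (iii) for each relatively prime pair $m,n\ge1$, $p_m[S]\,p_n[S]\mid S\,p_{mn}[S]$. Put $\Lambda_S=\Lambda[S^{-1},p_2[S]^{-1},p_3[S]^{-1},\ldots]$; the displayed identity holds in $\Lambda_S$ (completed with respect to the induced filtration). The $S$-modified Hall inner product is $(F[X],G[X])_X^S=(F[SX],G[X])_X$, where $(\cdot,\cdot)_X$ is the usual Hall inner product extended linearly over the coefficients and $p_k[SX]=p_k[S]\,p_k[X]$. *)

theory Defs
  imports "HOL-Analysis.Analysis"
begin

section \<open>Lambda-rings over the rationals\<close>

text \<open>The classes below deliberately do not include \<open>0 \<noteq> 1\<close>: the completed localization
  constructed later can be the zero ring (for instance when the modifier lies in \<open>filt 1\<close>).\<close>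

class rat_algebra = comm_ring + comm_monoid_mult +
  fixes scaleQ :: "rat \<Rightarrow> 'a \<Rightarrow> 'a"
  assumes scaleQ_add_right: "scaleQ a (x + y) = scaleQ a x + scaleQ a y"
    and scaleQ_add_left: "scaleQ (a + b) x = scaleQ a x + scaleQ b x"
    and scaleQ_scaleQ: "scaleQ a (scaleQ b x) = scaleQ (a * b) x"
    and scaleQ_one: "scaleQ 1 x = x"
    and scaleQ_mult_left: "scaleQ a x * y = scaleQ a (x * y)"

text \<open>\<open>psum n G\<close> is \<open>p\<^sub>n[G]\<close>; the value at \<open>n = 0\<close> is irrelevant.\<close>

class lambda_ring = rat_algebra +
  fixes psum :: "nat \<Rightarrow> 'a \<Rightarrow> 'a"
  assumes psum_add: "n \<ge> 1 \<Longrightarrow> psum n (x + y) = psum n x + psum n y"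
    and psum_mult: "n \<ge> 1 \<Longrightarrow> psum n (x * y) = psum n x * psum n y"
    and psum_one: "n \<ge> 1 \<Longrightarrow> psum n 1 = 1"
    and psum_1_left: "psum 1 x = x"
    and psum_psum: "m \<ge> 1 \<Longrightarrow> n \<ge> 1 \<Longrightarrow> psum m (psum n x) = psum (m * n) x"

class filtered_ring = rat_algebra + topological_space +
  fixes filt :: "nat \<Rightarrow> 'a set"
  assumes filt_0: "filt 0 = UNIV"
    and filt_Suc: "filt (Suc k) \<subseteq> filt k"
    and zero_in_filt: "0 \<in> filt k"
    and filt_diff: "x \<in> filt k \<Longrightarrow> y \<in> filt k \<Longrightarrow> x - y \<in> filt k"
    and filt_mult: "x \<in> filt i \<Longrightarrow> y \<in> filt j \<Longrightarrow> x * y \<in> filt (i + j)"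
    and open_filt: "open U \<longleftrightarrow> (\<forall>x\<in>U. \<exists>k. \<forall>y. y - x \<in> filt k \<longrightarrow> y \<in> U)"

class filtered_lambda_ring = filtered_ring + lambda_ring +
  assumes open_vimage_psum: "n \<ge> 1 \<Longrightarrow> open U \<Longrightarrow> open (psum n -` U)"

class complete_lambda_ring = filtered_lambda_ring + t2_space +
  assumes filt_complete:
    "(\<And>k. \<exists>N. \<forall>m\<ge>N. \<forall>n\<ge>N. X m - X n \<in> filt k) \<Longrightarrow> convergent X"

text \<open>A partition is the finite multiset of its (positive) parts.\<close>

definition partitions :: "nat multiset set" where
  "partitions = {\<mu>. 0 \<notin># \<mu>}"

text \<open>\<open>psum_part \<lambda> G\<close> is \<open>p\<^sub>\<lambda>[G]\<close>.\<close>

definition psum_part :: "nat multiset \<Rightarrow> 'a::lambda_ring \<Rightarrow> 'a" where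
  "psum_part \<mu> G = (\<Prod>k\<in>#\<mu>. psum k G)"

definition Exp_arg :: "'a::complete_lambda_ring \<Rightarrow> 'a" where
  "Exp_arg G = (\<Sum>\<^sub>\<infinity>k\<in>{1..}. scaleQ (1 / of_nat k) (psum k G))"

definition Exp :: "'a::complete_lambda_ring \<Rightarrow> 'a" where
  "Exp G = (\<Sum>\<^sub>\<infinity>n. scaleQ (1 / fact n) (Exp_arg G ^ n))"

definition Exp_converges :: "'a::complete_lambda_ring \<Rightarrow> bool" where
  "Exp_converges G \<longleftrightarrow>
     (\<lambda>k. scaleQ (1 / of_nat k) (psum k G)) summable_on {1..} \<and>
     (\<lambda>n. scaleQ (1 / fact n) (Exp_arg G ^ n)) summable_on UNIV"


subsection \<open>Basic facts\<close>

context rat_algebra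
begin

lemma scaleQ_zero_right: "scaleQ a 0 = 0"
  using scaleQ_add_right[of a 0 0] by simp

lemma scaleQ_minus_right: "scaleQ a (- x) = - scaleQ a x"
  using scaleQ_add_right[of a x "- x"] scaleQ_zero_right[of a]
  by (simp add: eq_neg_iff_add_eq_0 add.commute)

lemma scaleQ_diff_right: "scaleQ a (x - y) = scaleQ a x - scaleQ a y"
  using scaleQ_add_right[of a x "- y"] scaleQ_minus_right[of a y] by simp

lemma scaleQ_conv_mult: "scaleQ a x = scaleQ a 1 * x"
  by (simp add: scaleQ_mult_left)

lemma scaleQ_sum_right: "scaleQ a (sum f A) = (\<Sum>i\<in>A. scaleQ a (f i))"
  by (induction A rule: infinite_finite_induct) (auto simp: scaleQ_zero_right scaleQ_add_right)

end

context lambda_ring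
begin

lemma psum_zero: "n \<ge> 1 \<Longrightarrow> psum n 0 = 0"
  using psum_add[of n 0 0] by simp

lemma psum_minus: "n \<ge> 1 \<Longrightarrow> psum n (- x) = - psum n x"
  using psum_add[of n x "- x"] psum_zero[of n]
  by (simp add: eq_neg_iff_add_eq_0 add.commute)

lemma psum_diff: "n \<ge> 1 \<Longrightarrow> psum n (x - y) = psum n x - psum n y"
  using psum_add[of n x "- y"] psum_minus[of n y] by simp

lemma psum_sum: "n \<ge> 1 \<Longrightarrow> psum n (sum f A) = (\<Sum>i\<in>A. psum n (f i))"
  by (induction A rule: infinite_finite_induct) (auto simp: psum_zero psum_add)

end

context filtered_ring
begin

lemma filt_minus: "x \<in> filt k \<Longrightarrow> - x \<in> filt k"
  using filt_diff[of 0 k x] zero_in_filt[of k] by simp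

lemma filt_add: "x \<in> filt k \<Longrightarrow> y \<in> filt k \<Longrightarrow> x + y \<in> filt k"
  using filt_diff[of x k "- y"] filt_minus[of y k] by simp

lemma filt_antimono: "i \<le> j \<Longrightarrow> filt j \<subseteq> filt i"
  by (rule lift_Suc_antimono_le[of filt]) (auto intro: filt_Suc[THEN subsetD])

lemma filt_mult_left: "y \<in> filt k \<Longrightarrow> x * y \<in> filt k"
  using filt_mult[of x 0 y k] by (simp add: filt_0)

lemma filt_mult_right: "x \<in> filt k \<Longrightarrow> x * y \<in> filt k"
  using filt_mult[of x k y 0] by (simp add: filt_0)

lemma filt_scaleQ: "x \<in> filt k \<Longrightarrow> scaleQ a x \<in> filt k"
  by (subst scaleQ_conv_mult) (rule filt_mult_left)

lemma filt_sum: "(\<And>i. i \<in> A \<Longrightarrow> f i \<in> filt k) \<Longrightarrow> sum f A \<in> filt k"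
  by (induction A rule: infinite_finite_induct) (auto simp: zero_in_filt filt_add)

lemma filt_diff_commute: "x - y \<in> filt k \<longleftrightarrow> y - x \<in> filt k"
  using filt_minus[of "x - y" k] filt_minus[of "y - x" k] by auto

lemma filt_diff_trans: "x - y \<in> filt k \<Longrightarrow> y - z \<in> filt k \<Longrightarrow> x - z \<in> filt k"
  using filt_add[of "x - y" k "y - z"] by (simp add: algebra_simps)

lemma open_coset: "open {y. y - x \<in> filt k}"
  unfolding open_filt
proof
  fix z assume "z \<in> {y. y - x \<in> filt k}"
  then have "\<forall>y. y - z \<in> filt k \<longrightarrow> y \<in> {y. y - x \<in> filt k}"
    using filt_diff_trans[of _ z k x] by simp
  then show "\<exists>k'. \<forall>y. y - z \<in> filt k' \<longrightarrow> y \<in> {y. y - x \<in> filt k}" ..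
qed

end

lemma tendsto_filt_iff:
  fixes f :: "'b \<Rightarrow> 'a::filtered_ring"
  shows "(f \<longlongrightarrow> l) F \<longleftrightarrow> (\<forall>k. eventually (\<lambda>i. f i - l \<in> filt k) F)"
proof
  assume L: "(f \<longlongrightarrow> l) F"
  show "\<forall>k. eventually (\<lambda>i. f i - l \<in> filt k) F"
  proof
    fix k
    show "eventually (\<lambda>i. f i - l \<in> filt k) F"
      using topological_tendstoD[OF L open_coset[of l k]] zero_in_filt[of k] by simp
  qed
next
  assume R: "\<forall>k. eventually (\<lambda>i. f i - l \<in> filt k) F"
  show "(f \<longlongrightarrow> l) F"
  proof (rule topological_tendstoI)
    fix U :: "'a set" assume "open U" "l \<in> U"
    then obtain k where k: "\<forall>y. y - l \<in> filt k \<longrightarrow> y \<in> U"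
      unfolding open_filt by blast
    from R have "eventually (\<lambda>i. f i - l \<in> filt k) F" by blast
    then show "eventually (\<lambda>i. f i \<in> U) F"
      by (rule eventually_mono) (use k in blast)
  qed
qed

lemma LIMSEQ_filt_iff:
  fixes X :: "nat \<Rightarrow> 'a::filtered_ring"
  shows "X \<longlonglongrightarrow> l \<longleftrightarrow> (\<forall>k. \<exists>N. \<forall>n\<ge>N. X n - l \<in> filt k)"
  by (simp add: tendsto_filt_iff eventually_sequentially)

lemma eventually_nhds_filt:
  fixes x :: "'a::filtered_ring"
  shows "eventually (\<lambda>y. y - x \<in> filt k) (nhds x)"
  using eventually_nhds_in_open[OF open_coset[of x k], of x] zero_in_filt[of k] by simp

instance filtered_ring \<subseteq> topological_ab_group_add
proof
  fix a b :: 'a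
  show "((\<lambda>x. fst x + snd x) \<longlongrightarrow> a + b) (nhds a \<times>\<^sub>F nhds b)"
    unfolding tendsto_filt_iff
  proof
    fix k
    show "\<forall>\<^sub>F x in nhds a \<times>\<^sub>F nhds b. fst x + snd x - (a + b) \<in> filt k"
      unfolding eventually_prod_filter
    proof (intro exI conjI allI impI)
      show "eventually (\<lambda>y. y - a \<in> filt k) (nhds a)" by (rule eventually_nhds_filt)
      show "eventually (\<lambda>y. y - b \<in> filt k) (nhds b)" by (rule eventually_nhds_filt)
      fix x y assume "x - a \<in> filt k" "y - b \<in> filt k"
      then show "fst (x, y) + snd (x, y) - (a + b) \<in> filt k"
        using filt_add[of "x - a" k "y - b"] by (simp add: algebra_simps)
    qed
  qed
  show "(uminus \<longlongrightarrow> - a) (nhds a)"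
    unfolding tendsto_filt_iff
  proof
    fix k
    show "\<forall>\<^sub>F x in nhds a. - x - - a \<in> filt k"
      using eventually_nhds_filt[of a k]
    proof (rule eventually_mono)
      fix x assume "x - a \<in> filt k"
      from filt_minus[OF this] show "- x - - a \<in> filt k" by simp
    qed
  qed
qed

lemma continuous_on_filt_iff:
  fixes f :: "'a::filtered_ring \<Rightarrow> 'b::filtered_ring"
  assumes diff: "\<And>x y. f (x - y) = f x - f y"
  shows "continuous_on UNIV f \<longleftrightarrow> (\<forall>k. \<exists>j. \<forall>x\<in>filt j. f x \<in> filt k)"
proof
  assume C: "continuous_on UNIV f"
  show "\<forall>k. \<exists>j. \<forall>x\<in>filt j. f x \<in> filt k"
  proof
    fix k
    have f0: "f 0 = 0" using diff[of 0 0] by simp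
    have "open (f -` {y. y - 0 \<in> filt k})"
      by (rule open_vimage[OF open_coset C])
    moreover have "0 \<in> f -` {y. y - 0 \<in> filt k}" by (simp add: f0 zero_in_filt)
    ultimately obtain j where "\<forall>y. y - 0 \<in> filt j \<longrightarrow> y \<in> f -` {y. y - 0 \<in> filt k}"
      unfolding open_filt by blast
    then show "\<exists>j. \<forall>x\<in>filt j. f x \<in> filt k" by auto
  qed
next
  assume R: "\<forall>k. \<exists>j. \<forall>x\<in>filt j. f x \<in> filt k"
  have "(f \<longlongrightarrow> f x) (nhds x)" for x
    unfolding tendsto_filt_iff
  proof
    fix k
    from R obtain j where j: "\<forall>x\<in>filt j. f x \<in> filt k" by blast
    show "\<forall>\<^sub>F y in nhds x. f y - f x \<in> filt k"
      using eventually_nhds_filt[of x j]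
    proof (rule eventually_mono)
      fix y assume "y - x \<in> filt j"
      then show "f y - f x \<in> filt k" using j diff[of y x] by auto
    qed
  qed
  then have "(f \<longlongrightarrow> f x) (at x)" for x
    by (rule tendsto_mono[rotated]) (simp add: at_within_def)
  then show "continuous_on UNIV f"
    by (simp add: continuous_on_def)
qed

lemma continuous_psum:
  "n \<ge> 1 \<Longrightarrow> continuous_on UNIV (psum n :: 'a::filtered_lambda_ring \<Rightarrow> 'a)"
  by (simp add: continuous_on_open_vimage open_vimage_psum)

lemma psum_filt:
  assumes "n \<ge> 1"
  shows "\<exists>j. \<forall>x\<in>filt j. psum n (x::'a::filtered_lambda_ring) \<in> filt k"
  using continuous_psum[OF assms, where 'a = 'a]
    continuous_on_filt_iff[of "psum n :: 'a \<Rightarrow> 'a", OF psum_diff[OF assms]] by simp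

lemma open_vimage_psumI:
  fixes f :: "'a::filtered_ring \<Rightarrow> 'a"
  assumes "\<And>x y. f (x - y) = f x - f y" "\<And>k. \<exists>j. \<forall>x\<in>filt j. f x \<in> filt k" "open U"
  shows "open (f -` U)"
proof -
  have "continuous_on UNIV f"
    using continuous_on_filt_iff[of f, OF assms(1)] assms(2) by simp
  then show ?thesis by (rule open_vimage[OF assms(3)])
qed

text \<open>Topology generated by a filtration, for use in instance proofs.\<close>

lemma filt_topology:
  fixes F :: "nat \<Rightarrow> 'a::ab_group_add set"
  assumes "\<And>k. F (Suc k) \<subseteq> F k"
  defines "opn \<equiv> (\<lambda>U. \<forall>x\<in>U. \<exists>k. \<forall>y. y - x \<in> F k \<longrightarrow> y \<in> U)"
  shows "opn UNIV" and "opn S \<Longrightarrow> opn T \<Longrightarrow> opn (S \<inter> T)"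
    and "(\<forall>U\<in>K. opn U) \<Longrightarrow> opn (\<Union>K)"
proof -
  have mono: "F j \<subseteq> F i" if "i \<le> j" for i j
    by (rule lift_Suc_antimono_le[of F]) (use assms(1) that in auto)
  show "opn UNIV" by (simp add: opn_def)
  show "opn (S \<inter> T)" if "opn S" "opn T"
    unfolding opn_def
  proof
    fix x assume "x \<in> S \<inter> T"
    then have "x \<in> S" "x \<in> T" by auto
    from that(1)[unfolded opn_def, rule_format, OF this(1)]
    obtain i where i: "\<forall>y. y - x \<in> F i \<longrightarrow> y \<in> S" by auto
    from that(2)[unfolded opn_def, rule_format, OF \<open>x \<in> T\<close>]
    obtain j where "\<forall>y. y - x \<in> F j \<longrightarrow> y \<in> T" by auto
    with i have "\<forall>y. y - x \<in> F (max i j) \<longrightarrow> y \<in> S \<inter> T"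
      using mono[of i "max i j"] mono[of j "max i j"] by auto
    then show "\<exists>k. \<forall>y. y - x \<in> F k \<longrightarrow> y \<in> S \<inter> T" by blast
  qed
  show "opn (\<Union>K)" if "\<forall>U\<in>K. opn U"
    unfolding opn_def
  proof
    fix x assume "x \<in> \<Union>K"
    then obtain U where U: "U \<in> K" "x \<in> U" by auto
    with that have "opn U" by simp
    from this[unfolded opn_def, rule_format, OF U(2)] U(1)
    show "\<exists>k. \<forall>y. y - x \<in> F k \<longrightarrow> y \<in> \<Union>K" by auto
  qed
qed

lemma filt_separated_imp_t2:
  fixes x y :: "'a::filtered_ring"
  assumes sep: "\<And>z::'a. (\<And>k. z \<in> filt k) \<Longrightarrow> z = 0" and "x \<noteq> y"
  shows "\<exists>U V. open U \<and> open V \<and> x \<in> U \<and> y \<in> V \<and> U \<inter> V = {}"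
proof -
  from assms obtain k where k: "x - y \<notin> filt k"
    by (metis right_minus_eq)
  have "{z. z - x \<in> filt k} \<inter> {z. z - y \<in> filt k} = {}"
    using k filt_diff_trans[of x _ k y] filt_diff_commute[of x _ k] by auto
  moreover have "x - x \<in> filt k" "y - y \<in> filt k" by (simp_all add: zero_in_filt)
  ultimately show ?thesis
    using open_coset[of x k] open_coset[of y k] by blast
qed

lemma filt_separated:
  fixes z :: "'a::{filtered_ring,t2_space}"
  assumes "\<And>k. z \<in> filt k"
  shows "z = 0"
proof -
  have "(\<lambda>n::nat. z) \<longlonglongrightarrow> 0" using assms by (simp add: LIMSEQ_filt_iff)
  then show ?thesis using LIMSEQ_const_iff by blast
qed

section \<open>Symmetric series\<close>

text \<open>An element of the completed tensor product of \<open>'a\<close> with \<open>Sym[[X]]\<close> is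
  \<open>\<Sum>\<^sub>\<lambda> A\<^sub>\<lambda> p\<^sub>\<lambda>[X]\<close> with arbitrary coefficients; it is represented by the family of its coefficients.\<close>

typedef (overloaded) 'a sym_series =
  "{f :: nat multiset \<Rightarrow> 'a::zero. \<forall>\<mu>. \<mu> \<notin> partitions \<longrightarrow> f \<mu> = 0}"
  morphisms sym_coeff Abs_sym_series
  by (rule exI[of _ "\<lambda>_. 0"]) simp

setup_lifting type_definition_sym_series

lemma sym_coeff_outside: "\<mu> \<notin> partitions \<Longrightarrow> sym_coeff f \<mu> = 0"
  using sym_coeff[of f] by simp

lemma sym_series_eqI: "(\<And>\<mu>. sym_coeff f \<mu> = sym_coeff g \<mu>) \<Longrightarrow> f = g"
  by (simp add: sym_coeff_inject[symmetric] fun_eq_iff)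

lemma sym_series_eqI': "(\<And>\<mu>. \<mu> \<in> partitions \<Longrightarrow> sym_coeff f \<mu> = sym_coeff g \<mu>) \<Longrightarrow> f = g"
  by (rule sym_series_eqI) (metis sym_coeff_outside)

lemma empty_in_partitions: "{#} \<in> partitions"
  by (simp add: partitions_def)

lemma plus_in_partitions_iff: "\<mu> + \<nu> \<in> partitions \<longleftrightarrow> \<mu> \<in> partitions \<and> \<nu> \<in> partitions"
  by (simp add: partitions_def)

definition mset_splits :: "'b multiset \<Rightarrow> ('b multiset \<times> 'b multiset) set" where
  "mset_splits \<mu> = {(\<alpha>, \<beta>). \<alpha> + \<beta> = \<mu>}"

lemma finite_mset_splits: "finite (mset_splits \<mu>)"
proof (induction \<mu>)
  case empty
  have "mset_splits {#} \<subseteq> {({#}, {#} :: 'b multiset)}" by (auto simp: mset_splits_def)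
  then show ?case by (rule finite_subset) simp
next
  case (add x \<mu>)
  let ?f = "\<lambda>(\<alpha>, \<beta>). (add_mset x \<alpha>, \<beta>)" and ?g = "\<lambda>(\<alpha>, \<beta>). (\<alpha>, add_mset x \<beta>)"
  have "mset_splits (add_mset x \<mu>) \<subseteq> ?f ` mset_splits \<mu> \<union> ?g ` mset_splits \<mu>"
  proof
    fix p assume "p \<in> mset_splits (add_mset x \<mu>)"
    then obtain \<alpha> \<beta> where p: "p = (\<alpha>, \<beta>)" "\<alpha> + \<beta> = add_mset x \<mu>"
      by (auto simp: mset_splits_def)
    then have "x \<in># \<alpha> + \<beta>" by simp
    then consider "x \<in># \<alpha>" | "x \<in># \<beta>" by auto
    then show "p \<in> ?f ` mset_splits \<mu> \<union> ?g ` mset_splits \<mu>"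
    proof cases
      case 1
      then obtain \<alpha>' where "\<alpha> = add_mset x \<alpha>'" by (blast dest: multi_member_split)
      with p show ?thesis by (auto simp: mset_splits_def intro!: image_eqI[of _ _ "(\<alpha>', \<beta>)"])
    next
      case 2
      then obtain \<beta>' where "\<beta> = add_mset x \<beta>'" by (blast dest: multi_member_split)
      with p show ?thesis by (auto simp: mset_splits_def intro!: image_eqI[of _ _ "(\<alpha>, \<beta>')"])
    qed
  qed
  then show ?case by (rule finite_subset) (simp add: add)
qed

lemma sum_splits_outside:
  fixes f g :: "nat multiset \<Rightarrow> 'a::comm_ring"
  assumes f: "\<And>\<mu>. \<mu> \<notin> partitions \<Longrightarrow> f \<mu> = 0" and g: "\<And>\<mu>. \<mu> \<notin> partitions \<Longrightarrow> g \<mu> = 0"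
    and \<mu>: "\<mu> \<notin> partitions"
  shows "(\<Sum>(\<alpha>, \<beta>)\<in>mset_splits \<mu>. f \<alpha> * g \<beta>) = 0"
proof (rule sum.neutral, clarify)
  fix \<alpha> \<beta> assume "(\<alpha>, \<beta>) \<in> mset_splits \<mu>"
  with \<mu> have "\<alpha> \<notin> partitions \<or> \<beta> \<notin> partitions"
    by (auto simp: mset_splits_def plus_in_partitions_iff)
  with f g show "f \<alpha> * g \<beta> = 0" by auto
qed

instantiation sym_series :: (comm_ring) comm_ring
begin

lift_definition zero_sym_series :: "'a sym_series" is "\<lambda>_. 0" by simp

lift_definition plus_sym_series :: "'a sym_series \<Rightarrow> 'a sym_series \<Rightarrow> 'a sym_series"
  is "\<lambda>f g \<mu>. f \<mu> + g \<mu>" by simp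

lift_definition minus_sym_series :: "'a sym_series \<Rightarrow> 'a sym_series \<Rightarrow> 'a sym_series"
  is "\<lambda>f g \<mu>. f \<mu> - g \<mu>" by simp

lift_definition uminus_sym_series :: "'a sym_series \<Rightarrow> 'a sym_series"
  is "\<lambda>f \<mu>. - f \<mu>" by simp

lift_definition times_sym_series :: "'a sym_series \<Rightarrow> 'a sym_series \<Rightarrow> 'a sym_series"
  is "\<lambda>f g \<mu>. \<Sum>(\<alpha>, \<beta>)\<in>mset_splits \<mu>. f \<alpha> * g \<beta>"
  by (auto intro: sum_splits_outside)

instance
proof
  fix f g h :: "'a sym_series"
  show "f + g + h = f + (g + h)" by transfer (simp add: fun_eq_iff add.assoc)
  show "f + g = g + f" by transfer (simp add: fun_eq_iff add.commute)
  show "0 + f = f" by transfer simp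
  show "- f + f = 0" by transfer simp
  show "f - g = f + - g" by transfer simp
  show "(f + g) * h = f * h + g * h"
    by transfer (simp add: fun_eq_iff distrib_right sum.distrib case_prod_unfold)
  show "f * g = g * f"
  proof (transfer, rule ext)
    fix f g :: "nat multiset \<Rightarrow> 'a" and \<mu>
    show "(\<Sum>(\<alpha>, \<beta>)\<in>mset_splits \<mu>. f \<alpha> * g \<beta>) = (\<Sum>(\<alpha>, \<beta>)\<in>mset_splits \<mu>. g \<alpha> * f \<beta>)"
      by (rule sum.reindex_bij_witness[of _ prod.swap prod.swap])
        (auto simp: mset_splits_def mult.commute add.commute)
  qed
  show "f * g * h = f * (g * h)"
  proof (transfer, rule ext)
    fix f g h :: "nat multiset \<Rightarrow> 'a" and \<mu>
    have "(\<Sum>(\<alpha>, \<beta>)\<in>mset_splits \<mu>. (\<Sum>(\<gamma>, \<delta>)\<in>mset_splits \<alpha>. f \<gamma> * g \<delta>) * h \<beta>)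
      = (\<Sum>((\<alpha>, \<beta>), (\<gamma>, \<delta>))\<in>Sigma (mset_splits \<mu>) (\<lambda>(\<alpha>, \<beta>). mset_splits \<alpha>). f \<gamma> * g \<delta> * h \<beta>)"
      by (subst sum.Sigma[symmetric])
        (auto simp: finite_mset_splits sum_distrib_right case_prod_unfold)
    also have "\<dots> = (\<Sum>((\<alpha>, \<beta>), (\<gamma>, \<delta>))\<in>Sigma (mset_splits \<mu>) (\<lambda>(\<alpha>, \<beta>). mset_splits \<beta>). f \<alpha> * (g \<gamma> * h \<delta>))"
      by (rule sum.reindex_bij_witness[of _
            "\<lambda>((\<alpha>, \<beta>), (\<gamma>, \<delta>)). ((\<alpha> + \<gamma>, \<delta>), (\<alpha>, \<gamma>))"
            "\<lambda>((\<alpha>, \<beta>), (\<gamma>, \<delta>)). ((\<gamma>, \<delta> + \<beta>), (\<delta>, \<beta>))"])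
        (auto simp: mset_splits_def ac_simps)
    also have "\<dots> = (\<Sum>(\<alpha>, \<beta>)\<in>mset_splits \<mu>. f \<alpha> * (\<Sum>(\<gamma>, \<delta>)\<in>mset_splits \<beta>. g \<gamma> * h \<delta>))"
      by (subst sum.Sigma[symmetric])
        (auto simp: finite_mset_splits sum_distrib_left case_prod_unfold)
    finally show "(\<Sum>(\<alpha>, \<beta>)\<in>mset_splits \<mu>. (\<Sum>(\<gamma>, \<delta>)\<in>mset_splits \<alpha>. f \<gamma> * g \<delta>) * h \<beta>)
      = (\<Sum>(\<alpha>, \<beta>)\<in>mset_splits \<mu>. f \<alpha> * (\<Sum>(\<gamma>, \<delta>)\<in>mset_splits \<beta>. g \<gamma> * h \<delta>))" .
  qed
qed

end

instantiation sym_series :: (rat_algebra) rat_algebra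
begin

lift_definition one_sym_series :: "'a sym_series" is "\<lambda>\<mu>. if \<mu> = {#} then 1 else 0"
  by (auto simp: empty_in_partitions)

lift_definition scaleQ_sym_series :: "rat \<Rightarrow> 'a sym_series \<Rightarrow> 'a sym_series"
  is "\<lambda>a f \<mu>. scaleQ a (f \<mu>)" by (simp add: scaleQ_zero_right)

instance
proof
  fix f g :: "'a sym_series" and a b :: rat
  show "1 * f = f"
  proof (transfer, rule ext)
    fix f :: "nat multiset \<Rightarrow> 'a" and \<mu>
    have "(\<Sum>(\<alpha>, \<beta>)\<in>mset_splits \<mu>. (if \<alpha> = {#} then 1 else 0) * f \<beta>)
      = (\<Sum>(\<alpha>, \<beta>)\<in>{({#} :: nat multiset, \<mu>)}. (if \<alpha> = {#} then 1 else 0) * f \<beta>)"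
      by (rule sum.mono_neutral_right[OF finite_mset_splits])
        (auto simp: mset_splits_def split: if_splits)
    then show "(\<Sum>(\<alpha>, \<beta>)\<in>mset_splits \<mu>. (if \<alpha> = {#} then 1 else 0) * f \<beta>) = f \<mu>" by simp
  qed
  show "scaleQ a (f + g) = scaleQ a f + scaleQ a g"
    by transfer (simp add: scaleQ_add_right)
  show "scaleQ (a + b) f = scaleQ a f + scaleQ b f"
    by transfer (simp add: scaleQ_add_left)
  show "scaleQ a (scaleQ b f) = scaleQ (a * b) f"
    by transfer (simp add: scaleQ_scaleQ)
  show "scaleQ 1 f = f"
    by transfer (simp add: scaleQ_one)
  show "scaleQ a f * g = scaleQ a (f * g)"
    by transfer (simp add: scaleQ_mult_left scaleQ_sum_right case_prod_unfold)
qed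

end

lemma sym_coeff_zero [simp]: "sym_coeff 0 \<mu> = 0" by transfer simp
lemma sym_coeff_add [simp]: "sym_coeff (f + g) \<mu> = sym_coeff f \<mu> + sym_coeff g \<mu>" by transfer simp
lemma sym_coeff_diff [simp]: "sym_coeff (f - g) \<mu> = sym_coeff f \<mu> - sym_coeff g \<mu>" by transfer simp
lemma sym_coeff_scaleQ [simp]: "sym_coeff (scaleQ a f) \<mu> = scaleQ a (sym_coeff f \<mu>)" by transfer simp
lemma sym_coeff_one: "sym_coeff 1 \<mu> = (if \<mu> = {#} then 1 else 0)" by transfer simp
lemma sym_coeff_mult:
  "sym_coeff (f * g) \<mu> = (\<Sum>(\<alpha>, \<beta>)\<in>mset_splits \<mu>. sym_coeff f \<alpha> * sym_coeff g \<beta>)"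
  by transfer simp

definition mset_divisible :: "nat \<Rightarrow> nat multiset \<Rightarrow> bool" where
  "mset_divisible n \<mu> \<longleftrightarrow> (\<forall>i\<in>#\<mu>. n dvd i)"

abbreviation mset_div :: "nat \<Rightarrow> nat multiset \<Rightarrow> nat multiset" where
  "mset_div n \<equiv> image_mset (\<lambda>i. i div n)"

abbreviation mset_dilate :: "nat \<Rightarrow> nat multiset \<Rightarrow> nat multiset" where
  "mset_dilate n \<equiv> image_mset (\<lambda>i. n * i)"

lemma mset_divisible_plus: "mset_divisible n (\<alpha> + \<beta>) \<longleftrightarrow> mset_divisible n \<alpha> \<and> mset_divisible n \<beta>"
  by (auto simp: mset_divisible_def)

lemma mset_dilate_div: "mset_divisible n \<mu> \<Longrightarrow> mset_dilate n (mset_div n \<mu>) = \<mu>"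
  by (auto simp: mset_divisible_def multiset.map_comp o_def
      intro!: multiset.map_ident_strong)

lemma mset_div_dilate: "n \<ge> 1 \<Longrightarrow> mset_div n (mset_dilate n \<mu>) = \<mu>"
  by (simp add: multiset.map_comp o_def)

lemma mset_divisible_dilate: "mset_divisible n (mset_dilate n \<mu>)"
  by (auto simp: mset_divisible_def)

lemma mset_dilate_in_partitions: "n \<ge> 1 \<Longrightarrow> mset_dilate n \<mu> \<in> partitions \<longleftrightarrow> \<mu> \<in> partitions"
  by (auto simp: partitions_def)

lemma mset_div_in_partitions:
  "n \<ge> 1 \<Longrightarrow> mset_divisible n \<mu> \<Longrightarrow> mset_div n \<mu> \<in> partitions \<longleftrightarrow> \<mu> \<in> partitions"
  by (metis mset_dilate_div mset_dilate_in_partitions)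

lemma mset_divisible_mult:
  assumes "m \<ge> 1"
  shows "mset_divisible (m * n) \<mu> \<longleftrightarrow> mset_divisible m \<mu> \<and> mset_divisible n (mset_div m \<mu>)"
  using assms by (auto simp: mset_divisible_def dvd_div_iff_mult mult.commute dest: dvd_mult_left)
    (metis assms dvd_mult_div_cancel dvd_mult_left nat_mult_dvd_cancel_disj not_one_le_zero)+

lemma sum_mset_dilate: "sum_mset (mset_dilate n \<mu>) = n * sum_mset \<mu>"
  by (induction \<mu>) (auto simp: algebra_simps)

text \<open>Here \<open>p\<^sub>n\<close> sends \<open>\<Sum>\<^sub>\<mu> f\<^sub>\<mu> p\<^sub>\<mu>[X]\<close> to \<open>\<Sum>\<^sub>\<mu> p\<^sub>n[f\<^sub>\<mu>] p\<^sub>n\<^sub>\<mu>[X]\<close>.\<close>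

instantiation sym_series :: (lambda_ring) lambda_ring
begin

lift_definition psum_sym_series :: "nat \<Rightarrow> 'a sym_series \<Rightarrow> 'a sym_series"
  is "\<lambda>n f \<mu>. if \<mu> \<in> partitions \<and> mset_divisible n \<mu> then psum n (f (mset_div n \<mu>)) else 0"
  by simp

lemma sym_coeff_psum:
  "n \<ge> 1 \<Longrightarrow> sym_coeff (psum n f) \<mu> =
     (if mset_divisible n \<mu> then psum n (sym_coeff f (mset_div n \<mu>)) else 0)"
  by (transfer, auto simp: psum_zero mset_div_in_partitions)

instance
proof
  fix f g :: "'a sym_series" and m n :: nat
  show "psum n (f + g) = psum n f + psum n g" if "n \<ge> 1"
    by (rule sym_series_eqI) (simp add: sym_coeff_psum[OF that] psum_add[OF that])
  show "psum n (1 :: 'a sym_series) = 1" if "n \<ge> 1"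
    by (rule sym_series_eqI)
      (auto simp: sym_coeff_psum[OF that] psum_one[OF that] psum_zero[OF that] sym_coeff_one mset_divisible_def)
  show "psum 1 f = f"
    by (rule sym_series_eqI)
      (simp add: sym_coeff_psum psum_1_left[simplified] mset_divisible_def)
  show "psum n (f * g) = psum n f * psum n g" if "n \<ge> 1"
  proof (rule sym_series_eqI)
    fix \<mu>
    show "sym_coeff (psum n (f * g)) \<mu> = sym_coeff (psum n f * psum n g) \<mu>"
    proof (cases "mset_divisible n \<mu>")
      case False
      have "sym_coeff (psum n f * psum n g) \<mu> = 0"
        unfolding sym_coeff_mult
        by (rule sum.neutral)
          (use False that in \<open>auto simp: mset_splits_def sym_coeff_psum mset_divisible_plus\<close>)
      with False that show ?thesis by (simp add: sym_coeff_psum)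
    next
      case True
      have "sym_coeff (psum n (f * g)) \<mu>
        = (\<Sum>(\<alpha>, \<beta>)\<in>mset_splits (mset_div n \<mu>). psum n (sym_coeff f \<alpha>) * psum n (sym_coeff g \<beta>))"
        using True that
        by (simp add: sym_coeff_psum sym_coeff_mult psum_sum psum_mult case_prod_unfold)
      also have "\<dots> = sym_coeff (psum n f * psum n g) \<mu>"
        unfolding sym_coeff_mult
        by (rule sum.reindex_bij_witness[of _
              "\<lambda>(\<alpha>, \<beta>). (mset_div n \<alpha>, mset_div n \<beta>)"
              "\<lambda>(\<alpha>, \<beta>). (mset_dilate n \<alpha>, mset_dilate n \<beta>)"])
          (use True that in \<open>auto simp: mset_splits_def mset_divisible_plus mset_dilate_div
             mset_div_dilate mset_divisible_dilate sym_coeff_psum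
             simp flip: image_mset_union\<close>)
      finally show ?thesis .
    qed
  qed
  show "psum m (psum n f) = psum (m * n) f" if "m \<ge> 1" "n \<ge> 1"
  proof -
    from that have "m * n \<ge> 1" by simp
    with that show ?thesis
      by (intro sym_series_eqI)
        (auto simp: sym_coeff_psum psum_psum psum_zero mset_divisible_mult multiset.map_comp o_def
            div_mult2_eq)
  qed
qed

end

text \<open>The filtration of the tensor product, \<open>Sym[[X]]\<close> being filtered by degree.\<close>

instantiation sym_series :: (filtered_ring) filtered_ring
begin

definition filt_sym_series :: "nat \<Rightarrow> 'a sym_series set" where
  "filt_sym_series k = {f. \<forall>\<mu>\<in>partitions. sym_coeff f \<mu> \<in> filt (k - sum_mset \<mu>)}"

definition open_sym_series :: "'a sym_series set \<Rightarrow> bool" where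
  "open_sym_series U \<longleftrightarrow> (\<forall>x\<in>U. \<exists>k. \<forall>y. y - x \<in> filt k \<longrightarrow> y \<in> U)"

instance
proof
  fix f g :: "'a sym_series" and i j k :: nat and U V :: "'a sym_series set" and K
  show "filt 0 = (UNIV :: 'a sym_series set)"
    by (auto simp: filt_sym_series_def filt_0)
  show S: "filt (Suc k) \<subseteq> (filt k :: 'a sym_series set)" for k
  proof
    fix f :: "'a sym_series" assume "f \<in> filt (Suc k)"
    moreover have "filt (Suc k - d) \<subseteq> (filt (k - d) :: 'a set)" for d
      by (rule filt_antimono) simp
    ultimately show "f \<in> filt k" unfolding filt_sym_series_def by blast
  qed
  show "0 \<in> (filt k :: 'a sym_series set)"
    by (simp add: filt_sym_series_def zero_in_filt)
  show "f - g \<in> filt k" if "f \<in> filt k" "g \<in> filt k"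
    using that by (simp add: filt_sym_series_def filt_diff)
  show "f * g \<in> filt (i + j)" if "f \<in> filt i" "g \<in> filt j"
  proof -
    have "sym_coeff (f * g) \<mu> \<in> filt (i + j - sum_mset \<mu>)" if "\<mu> \<in> partitions" for \<mu>
      unfolding sym_coeff_mult
    proof (rule filt_sum, clarify)
      fix \<alpha> \<beta> assume "(\<alpha>, \<beta>) \<in> mset_splits \<mu>"
      then have \<mu>: "\<mu> = \<alpha> + \<beta>" by (simp add: mset_splits_def)
      with that have "\<alpha> \<in> partitions" "\<beta> \<in> partitions" by (simp_all add: plus_in_partitions_iff)
      with \<open>f \<in> filt i\<close> \<open>g \<in> filt j\<close>
      have "sym_coeff f \<alpha> * sym_coeff g \<beta> \<in> filt ((i - sum_mset \<alpha>) + (j - sum_mset \<beta>))"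
        by (intro filt_mult) (auto simp: filt_sym_series_def)
      then show "sym_coeff f \<alpha> * sym_coeff g \<beta> \<in> filt (i + j - sum_mset \<mu>)"
        by (rule subsetD[OF filt_antimono, rotated]) (simp add: \<mu>)
    qed
    then show ?thesis by (simp add: filt_sym_series_def)
  qed
  show "open U \<longleftrightarrow> (\<forall>x\<in>U. \<exists>k. \<forall>y. y - x \<in> filt k \<longrightarrow> y \<in> U)"
    by (rule open_sym_series_def)
  note top = filt_topology[of "filt :: nat \<Rightarrow> 'a sym_series set", OF S, folded open_sym_series_def]
  show "open (UNIV :: 'a sym_series set)" by (rule top)
  show "open (U \<inter> V)" if "open U" "open V" by (rule top) (fact that)+
  show "open (\<Union>K)" if "\<forall>U\<in>K. open U" for K :: "'a sym_series set set" by (rule top) (fact that)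
qed

end

instance sym_series :: (filtered_lambda_ring) filtered_lambda_ring
proof
  fix n :: nat and U :: "'a sym_series set"
  assume n: "n \<ge> 1" and U: "open U"
  show "open (psum n -` U)"
  proof (rule open_vimage_psumI[OF _ _ U])
    show "psum n (f - g) = psum n f - psum n g" for f g :: "'a sym_series"
      by (rule psum_diff[OF n])
    show "\<exists>j. \<forall>f\<in>filt j. psum n (f :: 'a sym_series) \<in> filt k" for k
    proof -
      from psum_filt[OF n] obtain j where j: "\<forall>x\<in>filt j. psum n (x::'a) \<in> filt k" by blast
      have "psum n f \<in> filt k" if f: "f \<in> filt (j + k)" for f :: "'a sym_series"
        unfolding filt_sym_series_def
      proof (clarify)
        fix \<mu> assume \<mu>: "\<mu> \<in> partitions"
        show "sym_coeff (psum n f) \<mu> \<in> filt (k - sum_mset \<mu>)"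
        proof (cases "mset_divisible n \<mu> \<and> sum_mset \<mu> \<le> k")
          case True
          define \<nu> where "\<nu> = mset_div n \<mu>"
          have \<nu>: "\<nu> \<in> partitions" "\<mu> = mset_dilate n \<nu>"
            using True n \<mu> by (simp_all add: \<nu>_def mset_div_in_partitions mset_dilate_div)
          then have "sum_mset \<nu> \<le> sum_mset \<mu>" using n by (simp add: sum_mset_dilate)
          with True have le: "j \<le> j + k - sum_mset \<nu>" by auto
          from f \<nu> have "sym_coeff f \<nu> \<in> filt (j + k - sum_mset \<nu>)"
            by (simp add: filt_sym_series_def)
          with filt_antimono[OF le] j have "psum n (sym_coeff f \<nu>) \<in> filt k" by blast
          moreover have "(filt k :: 'a set) \<subseteq> filt (k - sum_mset \<mu>)" by (rule filt_antimono) simp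
          ultimately show ?thesis using True n by (auto simp: sym_coeff_psum \<nu>_def)
        next
          case False
          then consider "\<not> mset_divisible n \<mu>" | "k - sum_mset \<mu> = 0" by linarith
          then show ?thesis
            by cases (use n in \<open>auto simp: sym_coeff_psum zero_in_filt filt_0\<close>)
        qed
      qed
      then show ?thesis by blast
    qed
  qed
qed

instance sym_series :: (complete_lambda_ring) complete_lambda_ring
proof
  fix f g :: "'a sym_series" assume "f \<noteq> g"
  show "\<exists>U V. open U \<and> open V \<and> f \<in> U \<and> g \<in> V \<and> U \<inter> V = {}"
  proof (rule filt_separated_imp_t2[OF _ \<open>f \<noteq> g\<close>])
    fix h :: "'a sym_series" assume h: "\<And>k. h \<in> filt k"
    show "h = 0"
    proof (rule sym_series_eqI')
      fix \<mu> assume "\<mu> \<in> partitions"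
      with h have "sym_coeff h \<mu> \<in> filt (k + sum_mset \<mu> - sum_mset \<mu>)" for k
        unfolding filt_sym_series_def by blast
      then show "sym_coeff h \<mu> = sym_coeff 0 \<mu>" by (simp add: filt_separated)
    qed
  qed
next
  fix X :: "nat \<Rightarrow> 'a sym_series"
  assume X: "\<And>k. \<exists>N. \<forall>m\<ge>N. \<forall>n\<ge>N. X m - X n \<in> filt k"
  have "\<exists>l. (\<lambda>n. sym_coeff (X n) \<mu>) \<longlonglongrightarrow> l" if \<mu>: "\<mu> \<in> partitions" for \<mu>
  proof -
    have "convergent (\<lambda>n. sym_coeff (X n) \<mu>)"
    proof (rule filt_complete)
      fix k
      from X[of "k + sum_mset \<mu>"] obtain N
        where N: "\<forall>m\<ge>N. \<forall>n\<ge>N. X m - X n \<in> filt (k + sum_mset \<mu>)" by blast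
      have "sym_coeff (X m) \<mu> - sym_coeff (X n) \<mu> \<in> filt k" if "m \<ge> N" "n \<ge> N" for m n
      proof -
        from N that have "X m - X n \<in> filt (k + sum_mset \<mu>)" by blast
        with \<mu> show ?thesis by (auto simp: filt_sym_series_def dest!: bspec[of _ _ \<mu>])
      qed
      then show "\<exists>N. \<forall>m\<ge>N. \<forall>n\<ge>N. sym_coeff (X m) \<mu> - sym_coeff (X n) \<mu> \<in> filt k" by blast
    qed
    then show ?thesis by (simp add: convergent_def)
  qed
  then obtain l where l: "\<And>\<mu>. \<mu> \<in> partitions \<Longrightarrow> (\<lambda>n. sym_coeff (X n) \<mu>) \<longlonglongrightarrow> l \<mu>" by metis
  define L where "L = Abs_sym_series (\<lambda>\<mu>. if \<mu> \<in> partitions then l \<mu> else 0)"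
  have L: "sym_coeff L \<mu> = l \<mu>" if "\<mu> \<in> partitions" for \<mu>
    unfolding L_def by (subst Abs_sym_series_inverse) (simp_all add: that)
  have "X \<longlonglongrightarrow> L"
    unfolding LIMSEQ_filt_iff
  proof
    fix k
    from X[of k] obtain N where N: "\<forall>m\<ge>N. \<forall>n\<ge>N. X m - X n \<in> filt k" by blast
    have "X m - L \<in> filt k" if m: "m \<ge> N" for m
      unfolding filt_sym_series_def
    proof (clarify)
      fix \<mu> assume \<mu>: "\<mu> \<in> partitions"
      from l[OF \<mu>] obtain M
        where M: "\<forall>n\<ge>M. sym_coeff (X n) \<mu> - l \<mu> \<in> filt (k - sum_mset \<mu>)"
        unfolding LIMSEQ_filt_iff by blast
      from N m have "X m - X (max M N) \<in> filt k" by simp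
      with \<mu> have "sym_coeff (X m) \<mu> - sym_coeff (X (max M N)) \<mu> \<in> filt (k - sum_mset \<mu>)"
        by (simp add: filt_sym_series_def)
      moreover from M have "sym_coeff (X (max M N)) \<mu> - l \<mu> \<in> filt (k - sum_mset \<mu>)" by simp
      ultimately show "sym_coeff (X m - L) \<mu> \<in> filt (k - sum_mset \<mu>)"
        using filt_diff_trans by (simp add: L \<mu>)
    qed
    then show "\<exists>N. \<forall>n\<ge>N. X n - L \<in> filt k" by blast
  qed
  then show "convergent X" by (auto simp: convergent_def)
qed

section \<open>Completion of a filtered lambda-ring\<close>

definition filt_Cauchy :: "(nat \<Rightarrow> 'a::filtered_ring) \<Rightarrow> bool" where
  "filt_Cauchy X \<longleftrightarrow> (\<forall>k. \<exists>N. \<forall>m\<ge>N. \<forall>n\<ge>N. X m - X n \<in> filt k)"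

definition filt_Cauchy_rel :: "(nat \<Rightarrow> 'a::filtered_ring) \<Rightarrow> (nat \<Rightarrow> 'a) \<Rightarrow> bool" where
  "filt_Cauchy_rel X Y \<longleftrightarrow> filt_Cauchy X \<and> filt_Cauchy Y \<and> (\<lambda>n. X n - Y n) \<longlonglongrightarrow> 0"

lemma filt_Cauchy_const: "filt_Cauchy (\<lambda>_. x)"
  by (simp add: filt_Cauchy_def zero_in_filt)

lemma filt_CauchyI:
  assumes "\<And>k. \<exists>N. \<forall>m\<ge>N. \<forall>n\<ge>N. X m - X n \<in> filt k"
  shows "filt_Cauchy X"
  using assms by (simp add: filt_Cauchy_def)

lemma filt_CauchyD: "filt_Cauchy X \<Longrightarrow> \<exists>N. \<forall>m\<ge>N. \<forall>n\<ge>N. X m - X n \<in> filt k"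
  by (simp add: filt_Cauchy_def)

lemma filt_Cauchy_add:
  assumes "filt_Cauchy X" "filt_Cauchy Y"
  shows "filt_Cauchy (\<lambda>n. X n + Y n)"
proof (rule filt_CauchyI)
  fix k
  obtain M where M: "\<forall>m\<ge>M. \<forall>n\<ge>M. X m - X n \<in> filt k"
    using filt_CauchyD[OF assms(1)] by blast
  obtain N where N: "\<forall>m\<ge>N. \<forall>n\<ge>N. Y m - Y n \<in> filt k"
    using filt_CauchyD[OF assms(2)] by blast
  have "X m + Y m - (X n + Y n) \<in> filt k" if "m \<ge> max M N" "n \<ge> max M N" for m n
    using filt_add[OF M[rule_format, of m n] N[rule_format, of m n]] that by (simp add: algebra_simps)
  then show "\<exists>L. \<forall>m\<ge>L. \<forall>n\<ge>L. X m + Y m - (X n + Y n) \<in> filt k" by blast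
qed

lemma filt_Cauchy_mult:
  assumes "filt_Cauchy X" "filt_Cauchy Y"
  shows "filt_Cauchy (\<lambda>n. X n * Y n)"
proof (rule filt_CauchyI)
  fix k
  obtain M where M: "\<forall>m\<ge>M. \<forall>n\<ge>M. X m - X n \<in> filt k"
    using filt_CauchyD[OF assms(1)] by blast
  obtain N where N: "\<forall>m\<ge>N. \<forall>n\<ge>N. Y m - Y n \<in> filt k"
    using filt_CauchyD[OF assms(2)] by blast
  have "X m * Y m - X n * Y n \<in> filt k" if "m \<ge> max M N" "n \<ge> max M N" for m n
  proof -
    have "X m * (Y m - Y n) + (X m - X n) * Y n \<in> filt k"
      using that by (intro filt_add filt_mult_left filt_mult_right M[rule_format] N[rule_format]) auto
    then show ?thesis by (simp add: algebra_simps)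
  qed
  then show "\<exists>L. \<forall>m\<ge>L. \<forall>n\<ge>L. X m * Y m - X n * Y n \<in> filt k" by blast
qed

lemma filt_Cauchy_map:
  fixes f :: "'a::filtered_ring \<Rightarrow> 'a"
  assumes "filt_Cauchy X" and diff: "\<And>x y. f (x - y) = f x - f y"
    and cont: "\<And>k. \<exists>j. \<forall>x\<in>filt j. f x \<in> filt k"
  shows "filt_Cauchy (\<lambda>n. f (X n))"
proof (rule filt_CauchyI)
  fix k
  from cont obtain j where j: "\<forall>x\<in>filt j. f x \<in> filt k" by blast
  obtain M where M: "\<forall>m\<ge>M. \<forall>n\<ge>M. X m - X n \<in> filt j"
    using filt_CauchyD[OF assms(1)] by blast
  have "f (X m) - f (X n) \<in> filt k" if "m \<ge> M" "n \<ge> M" for m n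
    using M[rule_format, OF that] j diff[of "X m" "X n"] by auto
  then show "\<exists>L. \<forall>m\<ge>L. \<forall>n\<ge>L. f (X m) - f (X n) \<in> filt k" by blast
qed

lemma filt_null_map:
  fixes f :: "'a::filtered_ring \<Rightarrow> 'a"
  assumes X: "(\<lambda>n. X n - Y n) \<longlonglongrightarrow> 0" and diff: "\<And>x y. f (x - y) = f x - f y"
    and cont: "\<And>k. \<exists>j. \<forall>x\<in>filt j. f x \<in> filt k"
  shows "(\<lambda>n. f (X n) - f (Y n)) \<longlonglongrightarrow> 0"
  unfolding LIMSEQ_filt_iff
proof
  fix k
  from cont obtain j where j: "\<forall>x\<in>filt j. f x \<in> filt k" by blast
  from X obtain N where N: "\<forall>n\<ge>N. X n - Y n - 0 \<in> filt j"
    unfolding LIMSEQ_filt_iff by blast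
  have "f (X n) - f (Y n) - 0 \<in> filt k" if "n \<ge> N" for n
  proof -
    from N that have "X n - Y n \<in> filt j" by simp
    with j have "f (X n - Y n) \<in> filt k" by blast
    then show ?thesis by (simp add: diff)
  qed
  then show "\<exists>N. \<forall>n\<ge>N. f (X n) - f (Y n) - 0 \<in> filt k" by blast
qed

lemma filt_null_mult:
  fixes X :: "nat \<Rightarrow> 'a::filtered_ring"
  assumes "X \<longlonglongrightarrow> 0"
  shows "(\<lambda>n. X n * Y n) \<longlonglongrightarrow> 0"
  unfolding LIMSEQ_filt_iff
proof
  fix k
  from assms obtain N where N: "\<forall>n\<ge>N. X n - 0 \<in> filt k"
    unfolding LIMSEQ_filt_iff by blast
  have "X n * Y n - 0 \<in> filt k" if "n \<ge> N" for n
    using N that filt_mult_right[of "X n" k "Y n"] by simp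
  then show "\<exists>N. \<forall>n\<ge>N. X n * Y n - 0 \<in> filt k" by blast
qed

lemma scaleQ_filt_cont: "\<exists>j. \<forall>x\<in>filt j. scaleQ a (x::'a::filtered_ring) \<in> filt k"
  using filt_scaleQ by blast

lemma filt_Cauchy_rel_sym: "filt_Cauchy_rel X Y \<Longrightarrow> filt_Cauchy_rel Y X"
  using tendsto_minus[of "\<lambda>n. X n - Y n" 0] by (auto simp: filt_Cauchy_rel_def)

quotient_type (overloaded) 'a completion = "nat \<Rightarrow> 'a::filtered_ring" / partial: filt_Cauchy_rel
proof (rule part_equivpI)
  show "\<exists>X :: nat \<Rightarrow> 'a. filt_Cauchy_rel X X"
    by (rule exI[of _ "\<lambda>_. 0"]) (simp add: filt_Cauchy_rel_def filt_Cauchy_const)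
  show "symp (filt_Cauchy_rel :: (nat \<Rightarrow> 'a) \<Rightarrow> _)"
    by (rule sympI) (rule filt_Cauchy_rel_sym)
  show "transp (filt_Cauchy_rel :: (nat \<Rightarrow> 'a) \<Rightarrow> _)"
  proof (rule transpI)
    fix X Y Z :: "nat \<Rightarrow> 'a" assume "filt_Cauchy_rel X Y" "filt_Cauchy_rel Y Z"
    then show "filt_Cauchy_rel X Z"
      using tendsto_add[of "\<lambda>n. X n - Y n" 0 _ "\<lambda>n. Y n - Z n" 0]
      by (auto simp: filt_Cauchy_rel_def)
  qed
qed

lemma filt_Cauchy_rel_refl: "filt_Cauchy_rel X X \<longleftrightarrow> filt_Cauchy X"
  by (simp add: filt_Cauchy_rel_def)

lemma filt_Cauchy_relI: "filt_Cauchy X \<Longrightarrow> Y = X \<Longrightarrow> filt_Cauchy_rel X Y"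
  by (simp add: filt_Cauchy_rel_refl)

lemma filt_Cauchy_rel_map:
  fixes f :: "'a::filtered_ring \<Rightarrow> 'a"
  assumes "filt_Cauchy_rel X Y" and diff: "\<And>x y. f (x - y) = f x - f y"
    and cont: "\<And>k. \<exists>j. \<forall>x\<in>filt j. f x \<in> filt k"
  shows "filt_Cauchy_rel (\<lambda>n. f (X n)) (\<lambda>n. f (Y n))"
  using assms filt_Cauchy_map[OF _ diff cont] filt_null_map[OF _ diff cont]
  by (auto simp: filt_Cauchy_rel_def)

lemma filt_Cauchy_rel_add:
  assumes "filt_Cauchy_rel X X'" "filt_Cauchy_rel Y Y'"
  shows "filt_Cauchy_rel (\<lambda>n. X n + Y n) (\<lambda>n. X' n + Y' n)"
  using assms tendsto_add[of "\<lambda>n. X n - X' n" 0 _ "\<lambda>n. Y n - Y' n" 0]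
  by (auto simp: filt_Cauchy_rel_def filt_Cauchy_add algebra_simps)

lemma filt_Cauchy_rel_minus:
  fixes X :: "nat \<Rightarrow> 'a::filtered_ring"
  assumes "filt_Cauchy_rel X X'"
  shows "filt_Cauchy_rel (\<lambda>n. - X n) (\<lambda>n. - X' n)"
  by (rule filt_Cauchy_rel_map[OF assms, of uminus]) (auto intro: filt_minus)

lemma filt_Cauchy_rel_mult:
  assumes "filt_Cauchy_rel X X'" "filt_Cauchy_rel Y Y'"
  shows "filt_Cauchy_rel (\<lambda>n. X n * Y n) (\<lambda>n. X' n * Y' n)"
proof -
  have "(\<lambda>n. (X n - X' n) * Y n + (Y n - Y' n) * X' n) \<longlonglongrightarrow> 0 + 0"
    using assms by (intro tendsto_add filt_null_mult) (auto simp: filt_Cauchy_rel_def)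
  also have "(\<lambda>n. (X n - X' n) * Y n + (Y n - Y' n) * X' n) = (\<lambda>n. X n * Y n - X' n * Y' n)"
    by (simp add: algebra_simps)
  finally show ?thesis
    using assms by (simp add: filt_Cauchy_rel_def filt_Cauchy_mult)
qed

instantiation completion :: (filtered_ring) rat_algebra
begin

lift_definition zero_completion :: "'a completion" is "\<lambda>_. 0"
  by (simp add: filt_Cauchy_rel_refl filt_Cauchy_const)

lift_definition one_completion :: "'a completion" is "\<lambda>_. 1"
  by (simp add: filt_Cauchy_rel_refl filt_Cauchy_const)

lift_definition plus_completion :: "'a completion \<Rightarrow> 'a completion \<Rightarrow> 'a completion"
  is "\<lambda>X Y n. X n + Y n" by (rule filt_Cauchy_rel_add)

lift_definition uminus_completion :: "'a completion \<Rightarrow> 'a completion"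
  is "\<lambda>X n. - X n" by (rule filt_Cauchy_rel_minus)

definition minus_completion :: "'a completion \<Rightarrow> 'a completion \<Rightarrow> 'a completion" where
  "minus_completion x y = x + - y"

lift_definition times_completion :: "'a completion \<Rightarrow> 'a completion \<Rightarrow> 'a completion"
  is "\<lambda>X Y n. X n * Y n" by (rule filt_Cauchy_rel_mult)

lift_definition scaleQ_completion :: "rat \<Rightarrow> 'a completion \<Rightarrow> 'a completion"
  is "\<lambda>a X n. scaleQ a (X n)"
  by (rule filt_Cauchy_rel_map) (auto simp: scaleQ_diff_right scaleQ_filt_cont)

instance
proof
  fix x y z :: "'a completion" and a b :: rat
  note [simp] = filt_Cauchy_rel_refl filt_Cauchy_add filt_Cauchy_mult filt_Cauchy_const
  have m: "filt_Cauchy (\<lambda>n. - X n)" if "filt_Cauchy X" for X :: "nat \<Rightarrow> 'a"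
    using that filt_Cauchy_rel_minus[of X X] by simp
  have s: "filt_Cauchy (\<lambda>n. scaleQ a (X n))" if "filt_Cauchy X" for X :: "nat \<Rightarrow> 'a" and a
    by (rule filt_Cauchy_map[OF that]) (auto simp: scaleQ_diff_right scaleQ_filt_cont)
  show "x + y + z = x + (y + z)"
    by transfer (rule filt_Cauchy_relI, auto simp: add.assoc)
  show "x + y = y + x"
    by transfer (rule filt_Cauchy_relI, auto simp: add.commute)
  show "0 + x = x"
    by transfer (rule filt_Cauchy_relI, auto)
  show "- x + x = 0"
    by transfer (rule filt_Cauchy_relI, auto)
  show "x - y = x + - y" by (rule minus_completion_def)
  show "x * y * z = x * (y * z)"
    by transfer (rule filt_Cauchy_relI, auto simp: mult.assoc)
  show "x * y = y * x"
    by transfer (rule filt_Cauchy_relI, auto simp: mult.commute)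
  show "1 * x = x"
    by transfer (rule filt_Cauchy_relI, auto)
  show "(x + y) * z = x * z + y * z"
    by transfer (rule filt_Cauchy_relI, auto simp: distrib_right)
  show "scaleQ a (x + y) = scaleQ a x + scaleQ a y"
    by transfer (rule filt_Cauchy_relI, auto simp: scaleQ_add_right s)
  show "scaleQ (a + b) x = scaleQ a x + scaleQ b x"
    by transfer (rule filt_Cauchy_relI, auto simp: scaleQ_add_left s)
  show "scaleQ a (scaleQ b x) = scaleQ (a * b) x"
    by transfer (rule filt_Cauchy_relI, auto simp: scaleQ_scaleQ s)
  show "scaleQ 1 x = x"
    by transfer (rule filt_Cauchy_relI, auto simp: scaleQ_one)
  show "scaleQ a x * y = scaleQ a (x * y)"
    by transfer (rule filt_Cauchy_relI, auto simp: scaleQ_mult_left s)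
qed

end

instantiation completion :: (filtered_lambda_ring) lambda_ring
begin

lift_definition psum_completion :: "nat \<Rightarrow> 'a completion \<Rightarrow> 'a completion"
  is "\<lambda>k X n. if k = 0 then X n else psum k (X n)"
  subgoal for k X Y
    using filt_Cauchy_rel_map[of X Y "psum k"] psum_filt[of k, where 'a = 'a]
    by (cases "k = 0") (simp_all add: psum_diff)
  done

instance
proof
  fix x y :: "'a completion" and m n :: nat
  have p: "filt_Cauchy (\<lambda>i. psum n (X i))" if "filt_Cauchy X" "n \<ge> 1" for X :: "nat \<Rightarrow> 'a" and n
    using filt_Cauchy_map[OF that(1), of "psum n"] psum_filt[OF that(2), where 'a = 'a] that(2)
    by (simp add: psum_diff)
  note [simp] = filt_Cauchy_rel_refl filt_Cauchy_add filt_Cauchy_mult filt_Cauchy_const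
  show "psum n (x + y) = psum n x + psum n y" if "n \<ge> 1"
    using that by transfer (rule filt_Cauchy_relI, auto intro!: p filt_Cauchy_add filt_Cauchy_mult simp: psum_add)
  show "psum n (x * y) = psum n x * psum n y" if "n \<ge> 1"
    using that by transfer (rule filt_Cauchy_relI, auto intro!: p filt_Cauchy_add filt_Cauchy_mult simp: psum_mult)
  show "psum n (1 :: 'a completion) = 1" if "n \<ge> 1"
    using that by transfer (rule filt_Cauchy_relI, auto intro!: p simp: psum_one)
  show "psum 1 x = x"
    by transfer (rule filt_Cauchy_relI, auto intro!: p simp: psum_1_left[simplified])
  show "psum m (psum n x) = psum (m * n) x" if "m \<ge> 1" "n \<ge> 1"
    using that by transfer (rule filt_Cauchy_relI, auto intro!: p simp: psum_psum)
qed

end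

text \<open>\<open>completion_in_filt k x\<close>: the class \<open>x\<close> lies in the closure of the image of \<open>filt k\<close>.\<close>

lift_definition completion_in_filt :: "nat \<Rightarrow> 'a::filtered_ring completion \<Rightarrow> bool"
  is "\<lambda>k X. \<exists>N. \<forall>n\<ge>N. X n \<in> filt k"
proof -
  have imp: "\<exists>N. \<forall>n\<ge>N. Y n \<in> filt k"
    if "filt_Cauchy_rel X Y" "\<exists>N. \<forall>n\<ge>N. X n \<in> filt k" for X Y :: "nat \<Rightarrow> 'a" and k
  proof -
    from that(1) have "(\<lambda>n. X n - Y n) \<longlonglongrightarrow> 0" by (simp add: filt_Cauchy_rel_def)
    then obtain M where M: "\<forall>n\<ge>M. X n - Y n - 0 \<in> filt k"
      unfolding LIMSEQ_filt_iff by blast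
    from that(2) obtain N where N: "\<forall>n\<ge>N. X n \<in> filt k" by blast
    have "Y n \<in> filt k" if "n \<ge> max M N" for n
    proof -
      from M N that have "X n \<in> filt k" "X n - Y n \<in> filt k" by auto
      from filt_diff[OF this] show ?thesis by simp
    qed
    then show ?thesis by blast
  qed
  fix k and X Y :: "nat \<Rightarrow> 'a"
  assume R: "filt_Cauchy_rel X Y"
  show "(\<exists>N. \<forall>n\<ge>N. X n \<in> filt k) = (\<exists>N. \<forall>n\<ge>N. Y n \<in> filt k)"
    by (rule iffI) (erule imp[OF R] imp[OF filt_Cauchy_rel_sym[OF R]])+
qed

instantiation completion :: (filtered_ring) filtered_ring
begin

definition filt_completion :: "nat \<Rightarrow> 'a completion set" where
  "filt_completion k = {x. completion_in_filt k x}"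

definition open_completion :: "'a completion set \<Rightarrow> bool" where
  "open_completion U \<longleftrightarrow> (\<forall>x\<in>U. \<exists>k. \<forall>y. y - x \<in> filt k \<longrightarrow> y \<in> U)"

instance
proof
  fix x y :: "'a completion" and i j k :: nat and U V :: "'a completion set"
  show "filt 0 = (UNIV :: 'a completion set)"
  proof -
    have "completion_in_filt 0 x" for x :: "'a completion" by transfer (simp add: filt_0)
    then show ?thesis by (simp add: filt_completion_def)
  qed
  have "completion_in_filt (Suc k) x \<Longrightarrow> completion_in_filt k x" for k and x :: "'a completion"
  proof transfer
    fix k :: nat and X :: "nat \<Rightarrow> 'a"
    assume "\<exists>N. \<forall>n\<ge>N. X n \<in> filt (Suc k)"
    then obtain N where "\<forall>n\<ge>N. X n \<in> filt (Suc k)" ..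
    then have "\<forall>n\<ge>N. X n \<in> filt k" using filt_Suc[of k] by auto
    then show "\<exists>N. \<forall>n\<ge>N. X n \<in> filt k" ..
  qed
  then show S: "filt (Suc k) \<subseteq> (filt k :: 'a completion set)" for k
    by (auto simp: filt_completion_def)
  have "completion_in_filt k (0 :: 'a completion)" by transfer (simp add: zero_in_filt)
  then show "0 \<in> (filt k :: 'a completion set)" by (simp add: filt_completion_def)
  have "completion_in_filt k (x + - y)" if "completion_in_filt k x" "completion_in_filt k y"
    using that
  proof transfer
    fix k :: nat and X Y :: "nat \<Rightarrow> 'a"
    assume "\<exists>N. \<forall>n\<ge>N. X n \<in> filt k" "\<exists>N. \<forall>n\<ge>N. Y n \<in> filt k"
    then obtain M N where "\<forall>n\<ge>M. X n \<in> filt k" "\<forall>n\<ge>N. Y n \<in> filt k" by blast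
    then have "\<forall>n\<ge>max M N. X n + - Y n \<in> filt k" by (simp add: filt_diff)
    then show "\<exists>N. \<forall>n\<ge>N. X n + - Y n \<in> filt k" by blast
  qed
  then show "x - y \<in> filt k" if "x \<in> filt k" "y \<in> filt k"
    using that by (simp add: filt_completion_def minus_completion_def del: add_uminus_conv_diff)
  have "completion_in_filt (i + j) (x * y)" if "completion_in_filt i x" "completion_in_filt j y"
    using that
  proof transfer
    fix i j :: nat and X Y :: "nat \<Rightarrow> 'a"
    assume "\<exists>N. \<forall>n\<ge>N. X n \<in> filt i" "\<exists>N. \<forall>n\<ge>N. Y n \<in> filt j"
    then obtain M N where "\<forall>n\<ge>M. X n \<in> filt i" "\<forall>n\<ge>N. Y n \<in> filt j" by blast
    then have "\<forall>n\<ge>max M N. X n * Y n \<in> filt (i + j)" by (simp add: filt_mult)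
    then show "\<exists>N. \<forall>n\<ge>N. X n * Y n \<in> filt (i + j)" by blast
  qed
  then show "x * y \<in> filt (i + j)" if "x \<in> filt i" "y \<in> filt j"
    using that by (simp add: filt_completion_def)
  show "open U \<longleftrightarrow> (\<forall>x\<in>U. \<exists>k. \<forall>y. y - x \<in> filt k \<longrightarrow> y \<in> U)"
    by (rule open_completion_def)
  note top = filt_topology[of "filt :: nat \<Rightarrow> 'a completion set", OF S, folded open_completion_def]
  show "open (UNIV :: 'a completion set)" by (rule top)
  show "open (U \<inter> V)" if "open U" "open V" by (rule top) (fact that)+
  show "open (\<Union>K)" if "\<forall>U\<in>K. open U" for K :: "'a completion set set" by (rule top) (fact that)
qed

end

lemma completion_in_filt_psum:
  fixes x :: "'a::filtered_lambda_ring completion"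
  shows "completion_in_filt j x \<Longrightarrow> n \<ge> 1 \<Longrightarrow> \<forall>x\<in>filt j. psum n (x::'a) \<in> filt k \<Longrightarrow>
    completion_in_filt k (psum n x)"
proof transfer
  fix n j k :: nat and X :: "nat \<Rightarrow> 'a"
  assume "\<exists>N. \<forall>i\<ge>N. X i \<in> filt j" and *: "n \<ge> 1" "\<forall>x\<in>filt j. psum n (x::'a) \<in> filt k"
  then obtain N where "\<forall>i\<ge>N. X i \<in> filt j" by blast
  with * have "\<forall>i\<ge>N. (if n = 0 then X i else psum n (X i)) \<in> filt k" by simp
  then show "\<exists>N. \<forall>i\<ge>N. (if n = 0 then X i else psum n (X i)) \<in> filt k" ..
qed

instance completion :: (filtered_lambda_ring) filtered_lambda_ring
proof
  fix n :: nat and U :: "'a completion set"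
  assume n: "n \<ge> 1" and U: "open U"
  show "open (psum n -` U)"
  proof (rule open_vimage_psumI[OF _ _ U])
    show "psum n (f - g) = psum n f - psum n g" for f g :: "'a completion"
      by (rule psum_diff[OF n])
    show "\<exists>j. \<forall>x\<in>filt j. psum n (x :: 'a completion) \<in> filt k" for k
    proof -
      from psum_filt[OF n] obtain j where j: "\<forall>x\<in>filt j. psum n (x::'a) \<in> filt k" by blast
      have "completion_in_filt k (psum n x)" if "completion_in_filt j x" for x :: "'a completion"
        using that n j by (rule completion_in_filt_psum)
      then show ?thesis by (auto simp: filt_completion_def)
    qed
  qed
qed

lift_definition to_completion :: "'a::filtered_ring \<Rightarrow> 'a completion" is "\<lambda>x _. x"
  by (simp add: filt_Cauchy_rel_refl filt_Cauchy_const)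

lemma to_completion_diff: "to_completion (x - y) = to_completion x - to_completion y"
  unfolding minus_completion_def
  by transfer (simp add: filt_Cauchy_rel_refl filt_Cauchy_const)

lemma to_completion_mult: "to_completion (x * y) = to_completion x * to_completion y"
  by transfer (simp add: filt_Cauchy_rel_refl filt_Cauchy_const)

lemma to_completion_in_filt_iff: "to_completion x \<in> filt k \<longleftrightarrow> x \<in> filt k"
  unfolding filt_completion_def mem_Collect_eq by transfer auto

lemma to_completion_dense: "\<exists>y. x - to_completion y \<in> filt k"
proof -
  have "\<exists>y. completion_in_filt k (x + - to_completion y)"
  proof transfer
    fix k :: nat and X :: "nat \<Rightarrow> 'a"
    assume "filt_Cauchy_rel X X"
    then have "filt_Cauchy X" by (simp add: filt_Cauchy_rel_refl)
    then obtain N where "\<forall>m\<ge>N. \<forall>n\<ge>N. X m - X n \<in> filt k"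
      using filt_CauchyD by blast
    then have "\<forall>n\<ge>N. X n + - X N \<in> filt k" by simp
    then show "\<exists>y. \<exists>N. \<forall>n\<ge>N. X n + - y \<in> filt k" by blast
  qed
  then show ?thesis by (simp add: filt_completion_def minus_completion_def del: add_uminus_conv_diff)
qed

lemma to_completion_converges:
  assumes "filt_Cauchy (X :: nat \<Rightarrow> 'a::filtered_ring)"
  shows "\<exists>x. (\<lambda>n. to_completion (X n)) \<longlonglongrightarrow> x"
proof -
  define x where "x = abs_completion X"
  have "(\<lambda>n. to_completion (X n)) \<longlonglongrightarrow> x"
    unfolding LIMSEQ_filt_iff
  proof
    fix k
    obtain N where N: "\<forall>m\<ge>N. \<forall>n\<ge>N. X m - X n \<in> filt k"
      using filt_CauchyD[OF assms] by blast
    have "to_completion (X m) - x \<in> filt k" if m: "m \<ge> N" for m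
    proof -
      have C: "filt_Cauchy (\<lambda>n. X m - X n)"
        using filt_Cauchy_add[OF filt_Cauchy_const[of "X m"], of "\<lambda>n. - X n"] assms
          filt_Cauchy_rel_minus[of X X] by (simp add: filt_Cauchy_rel_refl)
      have "\<forall>n\<ge>N. X m + - X n \<in> filt k" using N m by simp
      then have "completion_in_filt k (to_completion (X m) + - x)"
        unfolding x_def using assms
        by (auto simp: to_completion.abs_eq uminus_completion.abs_eq plus_completion.abs_eq
            completion_in_filt.abs_eq eq_onp_def C filt_Cauchy_rel_refl filt_Cauchy_const
            filt_Cauchy_add filt_Cauchy_rel_minus[of X X, simplified filt_Cauchy_rel_refl])
      then show ?thesis by (simp add: filt_completion_def minus_completion_def del: add_uminus_conv_diff)
    qed
    then show "\<exists>N. \<forall>n\<ge>N. to_completion (X n) - x \<in> filt k" by blast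
  qed
  then show ?thesis by blast
qed

instance completion :: (filtered_lambda_ring) complete_lambda_ring
proof
  fix x y :: "'a completion" assume "x \<noteq> y"
  show "\<exists>U V. open U \<and> open V \<and> x \<in> U \<and> y \<in> V \<and> U \<inter> V = {}"
  proof (rule filt_separated_imp_t2[OF _ \<open>x \<noteq> y\<close>])
    fix z :: "'a completion" assume z: "\<And>k. z \<in> filt k"
    then have "\<forall>k. completion_in_filt k z" by (simp add: filt_completion_def)
    then show "z = 0"
    proof transfer
      fix Z :: "nat \<Rightarrow> 'a"
      assume "filt_Cauchy_rel Z Z" "\<forall>k. \<exists>N. \<forall>n\<ge>N. Z n \<in> filt k"
      then show "filt_Cauchy_rel Z (\<lambda>_. 0)"
        by (simp add: filt_Cauchy_rel_def filt_Cauchy_const LIMSEQ_filt_iff)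
    qed
  qed
next
  fix X :: "nat \<Rightarrow> 'a completion"
  assume X: "\<And>k. \<exists>N. \<forall>m\<ge>N. \<forall>n\<ge>N. X m - X n \<in> filt k"
  have "\<exists>y. X n - to_completion y \<in> filt n" for n by (rule to_completion_dense)
  then obtain Z where Z: "\<And>n. X n - to_completion (Z n) \<in> filt n" by metis
  have Zk: "X n - to_completion (Z n) \<in> filt k" if "n \<ge> k" for n k
    using Z[of n] filt_antimono[OF that] by blast
  have "filt_Cauchy Z"
  proof (rule filt_CauchyI)
    fix k
    from X[of k] obtain N where N: "\<forall>m\<ge>N. \<forall>n\<ge>N. X m - X n \<in> filt k" by blast
    have "Z m - Z n \<in> filt k" if "m \<ge> max k N" "n \<ge> max k N" for m n
    proof -
      have "to_completion (Z m) - X m \<in> filt k" "X n - to_completion (Z n) \<in> filt k"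
        using Zk[of k m] Zk[of k n] that filt_diff_commute by auto
      moreover have "X m - X n \<in> filt k" using N that by auto
      ultimately have "to_completion (Z m) - to_completion (Z n) \<in> filt k"
        by (meson filt_diff_trans)
      then show ?thesis by (simp flip: to_completion_diff add: to_completion_in_filt_iff)
    qed
    then show "\<exists>N. \<forall>m\<ge>N. \<forall>n\<ge>N. Z m - Z n \<in> filt k" by blast
  qed
  then obtain x where x: "(\<lambda>n. to_completion (Z n)) \<longlonglongrightarrow> x"
    using to_completion_converges by blast
  have "(\<lambda>n. X n - to_completion (Z n)) \<longlonglongrightarrow> 0"
    unfolding LIMSEQ_filt_iff using Zk by auto
  from tendsto_add[OF this x] have "X \<longlonglongrightarrow> x" by simp
  then show "convergent X" by (auto simp: convergent_def)
qed

section \<open>Good modifiers and the localization\<close>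

definition (in lambda_ring) good_modifier :: "'a \<Rightarrow> bool" where
  "good_modifier S \<longleftrightarrow>
     (\<forall>n\<ge>1. \<forall>x. psum n S * x = 0 \<longrightarrow> x = 0) \<and>
     (\<forall>n\<ge>1. S dvd psum n S) \<and>
     (\<forall>m\<ge>1. \<forall>n\<ge>1. coprime m n \<longrightarrow> psum m S * psum n S dvd S * psum (m * n) S)"

text \<open>A complete lambda-ring together with a good modifier. The modifier is a class parameter
  because the type of the localization depends on it.\<close>

class modified_lambda_ring = complete_lambda_ring +
  fixes modifier :: 'a
  assumes good_modifier: "good_modifier modifier"

text \<open>The multiplicative set generated by \<open>S, p\<^sub>2[S], p\<^sub>3[S], \<dots>\<close>.\<close>

definition denominators :: "'a::modified_lambda_ring set" where
  "denominators = (\<lambda>\<nu>. psum_part \<nu> modifier) ` partitions"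

lemma psum_part_empty: "psum_part {#} G = 1"
  by (simp add: psum_part_def)

lemma psum_part_plus: "psum_part (\<mu> + \<nu>) G = psum_part \<mu> G * psum_part \<nu> G"
  by (simp add: psum_part_def)

lemma psum_psum_part:
  assumes n: "n \<ge> 1" and "\<mu> \<in> partitions"
  shows "psum n (psum_part \<mu> G) = psum_part (mset_dilate n \<mu>) G"
  using assms(2)
proof (induction \<mu>)
  case empty
  then show ?case using psum_one[OF n] by (simp add: psum_part_empty)
next
  case (add k \<mu>)
  then have "k \<ge> 1" "\<mu> \<in> partitions" by (auto simp: partitions_def Suc_le_eq intro: gr0I)
  then show ?case
    using add.IH by (simp add: psum_part_def psum_mult[OF n] psum_psum[OF n])
qed

lemma one_in_denominators: "1 \<in> denominators"
  unfolding denominators_def using empty_in_partitions psum_part_empty by (metis imageI)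

lemma denominators_mult:
  assumes "s \<in> denominators" "t \<in> denominators"
  shows "s * t \<in> denominators"
proof -
  from assms obtain \<mu> \<nu> where "\<mu> \<in> partitions" "s = psum_part \<mu> modifier"
    "\<nu> \<in> partitions" "t = psum_part \<nu> modifier"
    unfolding denominators_def by blast
  then show ?thesis
    unfolding denominators_def
    by (intro image_eqI[of _ _ "\<mu> + \<nu>"]) (simp_all add: psum_part_plus plus_in_partitions_iff)
qed

lemma psum_in_denominators:
  assumes n: "n \<ge> 1" and "s \<in> denominators"
  shows "psum n s \<in> denominators"
proof -
  from assms obtain \<mu> where "\<mu> \<in> partitions" "s = psum_part \<mu> modifier"
    unfolding denominators_def by blast
  then show ?thesis
    unfolding denominators_def using n
    by (intro image_eqI[of _ _ "mset_dilate n \<mu>"])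
      (simp_all add: psum_psum_part mset_dilate_in_partitions)
qed

lemma psum_modifier_in_denominators: "n \<ge> 1 \<Longrightarrow> psum n modifier \<in> denominators"
  unfolding denominators_def
  by (rule image_eqI[of _ _ "{#n#}"]) (auto simp: psum_part_def partitions_def)

lemma modifier_in_denominators: "modifier \<in> denominators"
  using psum_modifier_in_denominators[of 1] by (simp add: psum_1_left[simplified])

lemma denominators_regular:
  assumes "s \<in> denominators" and "x * s = 0"
  shows "x = 0"
proof -
  from assms obtain \<mu> where "\<mu> \<in> partitions" "s = psum_part \<mu> modifier"
    unfolding denominators_def by blast
  with assms(2) have "\<mu> \<in> partitions" "x * psum_part \<mu> modifier = 0" by simp_all
  then show ?thesis
  proof (induction \<mu> arbitrary: x)
    case empty
    then show ?case by (simp add: psum_part_empty)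
  next
    case (add k \<mu>)
    from add.prems have k: "k \<ge> 1" and \<mu>: "\<mu> \<in> partitions"
      by (auto simp: partitions_def Suc_le_eq intro: gr0I)
    from add.prems have "(psum k modifier * x) * psum_part \<mu> modifier = 0"
      by (simp add: psum_part_def mult_ac)
    from add.IH[OF \<mu> this] have "psum k modifier * x = 0" .
    with good_modifier k show ?case unfolding good_modifier_def by blast
  qed
qed

lemma denominators_cancel:
  assumes "s \<in> denominators" and "x * s = y * s"
  shows "x = y"
  using denominators_regular[OF assms(1), of "x - y"] assms(2) by (simp add: left_diff_distrib)

definition fract_rel :: "'a::modified_lambda_ring \<times> 'a \<Rightarrow> 'a \<times> 'a \<Rightarrow> bool" where
  "fract_rel = (\<lambda>(a, s) (b, t). s \<in> denominators \<and> t \<in> denominators \<and> a * t = b * s)"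

text \<open>As all denominators are regular, no extra factor is needed in the relation defining
  the ring of fractions.\<close>

quotient_type (overloaded) 'a localization = "'a::modified_lambda_ring \<times> 'a" / partial: fract_rel
proof (rule part_equivpI)
  show "\<exists>x :: 'a \<times> 'a. fract_rel x x"
    by (rule exI[of _ "(0, 1)"]) (simp add: fract_rel_def one_in_denominators)
  show "symp (fract_rel :: 'a \<times> 'a \<Rightarrow> _)"
    by (rule sympI) (auto simp: fract_rel_def)
  show "transp (fract_rel :: 'a \<times> 'a \<Rightarrow> _)"
  proof (rule transpI)
    fix x y z :: "'a \<times> 'a" assume "fract_rel x y" "fract_rel y z"
    moreover obtain a s b t c u where [simp]: "x = (a, s)" "y = (b, t)" "z = (c, u)"
      by (cases x, cases y, cases z)
    ultimately have D: "s \<in> denominators" "t \<in> denominators" "u \<in> denominators"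
      and eq: "a * t = b * s" "b * u = c * t"
      by (auto simp: fract_rel_def)
    have "(a * u) * t = (a * t) * u" by (simp add: mult_ac)
    also have "\<dots> = (b * u) * s" unfolding eq(1) by (simp add: mult_ac)
    also have "\<dots> = (c * s) * t" unfolding eq(2) by (simp add: mult_ac)
    finally have "a * u = c * s" by (rule denominators_cancel[OF D(2)])
    with D show "fract_rel x z" by (simp add: fract_rel_def)
  qed
qed

instantiation localization :: (modified_lambda_ring) lambda_ring
begin

lift_definition zero_localization :: "'a localization" is "(0, 1)"
  by (simp add: fract_rel_def one_in_denominators)

lift_definition one_localization :: "'a localization" is "(1, 1)"
  by (simp add: fract_rel_def one_in_denominators)

lift_definition plus_localization :: "'a localization \<Rightarrow> 'a localization \<Rightarrow> 'a localization"
  is "\<lambda>(a, s) (b, t). (a * t + b * s, s * t)"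
proof -
  fix x x' y y' :: "'a \<times> 'a" assume R: "fract_rel x x'" "fract_rel y y'"
  obtain a s b t a' s' b' t' where [simp]: "x = (a, s)" "y = (b, t)" "x' = (a', s')" "y' = (b', t')"
    by (cases x, cases y, cases x', cases y')
  from R have eq: "a * s' = a' * s" "b * t' = b' * t"
    and D: "s \<in> denominators" "t \<in> denominators" "s' \<in> denominators" "t' \<in> denominators"
    by (auto simp: fract_rel_def)
  have "(a * t + b * s) * (s' * t') = (a * s') * (t * t') + (b * t') * (s * s')"
    by (simp add: algebra_simps)
  also have "\<dots> = (a' * t' + b' * s') * (s * t)"
    unfolding eq by (simp add: algebra_simps)
  finally show "fract_rel ((case x of (a, s) \<Rightarrow> \<lambda>(b, t). (a * t + b * s, s * t)) y)
      ((case x' of (a, s) \<Rightarrow> \<lambda>(b, t). (a * t + b * s, s * t)) y')"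
    using D
    by (simp add: fract_rel_def denominators_mult)
qed

lift_definition uminus_localization :: "'a localization \<Rightarrow> 'a localization"
  is "\<lambda>(a, s). (- a, s)"
  by (auto simp: fract_rel_def)

definition minus_localization :: "'a localization \<Rightarrow> 'a localization \<Rightarrow> 'a localization" where
  "minus_localization x y = x + - y"

lift_definition times_localization :: "'a localization \<Rightarrow> 'a localization \<Rightarrow> 'a localization"
  is "\<lambda>(a, s) (b, t). (a * b, s * t)"
proof -
  fix x x' y y' :: "'a \<times> 'a" assume R: "fract_rel x x'" "fract_rel y y'"
  obtain a s b t a' s' b' t' where [simp]: "x = (a, s)" "y = (b, t)" "x' = (a', s')" "y' = (b', t')"
    by (cases x, cases y, cases x', cases y')
  from R have eq: "a * s' = a' * s" "b * t' = b' * t"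
    and D: "s \<in> denominators" "t \<in> denominators" "s' \<in> denominators" "t' \<in> denominators"
    by (auto simp: fract_rel_def)
  have "(a * b) * (s' * t') = (a * s') * (b * t')" by (simp add: mult_ac)
  also have "\<dots> = (a' * b') * (s * t)" unfolding eq by (simp add: mult_ac)
  finally show "fract_rel ((case x of (a, s) \<Rightarrow> \<lambda>(b, t). (a * b, s * t)) y)
      ((case x' of (a, s) \<Rightarrow> \<lambda>(b, t). (a * b, s * t)) y')"
    using D by (simp add: fract_rel_def denominators_mult)
qed

lift_definition scaleQ_localization :: "rat \<Rightarrow> 'a localization \<Rightarrow> 'a localization"
  is "\<lambda>q (a, s). (scaleQ q a, s)"
  by (auto simp: fract_rel_def scaleQ_mult_left)

lift_definition psum_localization :: "nat \<Rightarrow> 'a localization \<Rightarrow> 'a localization"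
  is "\<lambda>n (a, s). if n = 0 then (a, s) else (psum n a, psum n s)"
  subgoal for n x y
    using psum_mult[of n "fst x" "snd y"] psum_mult[of n "fst y" "snd x"]
    by (cases "n = 0") (auto simp: fract_rel_def psum_in_denominators Suc_le_eq)
  done

instance
proof
  fix x y z :: "'a localization" and a b :: rat and m n :: nat
  note [simp] = fract_rel_def denominators_mult one_in_denominators psum_in_denominators
  note dist = algebra_simps
  show "x + y + z = x + (y + z)" by transfer (auto simp: dist add.assoc)
  show "x + y = y + x" by transfer (auto simp: dist add.commute)
  show "0 + x = x" by transfer auto
  show "- x + x = 0" by transfer (auto simp: dist)
  show "x - y = x + - y" by (rule minus_localization_def)
  show "x * y * z = x * (y * z)" by transfer (auto simp: dist)
  show "x * y = y * x" by transfer (auto simp: dist)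
  show "1 * x = x" by transfer auto
  show "(x + y) * z = x * z + y * z" by transfer (auto simp: dist)
  show "scaleQ a (x + y) = scaleQ a x + scaleQ a y"
    by transfer (auto simp: scaleQ_add_right scaleQ_mult_left)
  show "scaleQ (a + b) x = scaleQ a x + scaleQ b x"
    by transfer (auto simp: scaleQ_add_left dist)
  show "scaleQ a (scaleQ b x) = scaleQ (a * b) x"
    by transfer (auto simp: scaleQ_scaleQ)
  show "scaleQ 1 x = x" by transfer (auto simp: scaleQ_one)
  show "scaleQ a x * y = scaleQ a (x * y)" by transfer (auto simp: scaleQ_mult_left)
  show "psum n (x + y) = psum n x + psum n y" if "n \<ge> 1"
    using that by transfer (auto simp: psum_add psum_mult)
  show "psum n (x * y) = psum n x * psum n y" if "n \<ge> 1"
    using that by transfer (auto simp: psum_mult)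
  show "psum n (1 :: 'a localization) = 1" if "n \<ge> 1"
    using that by transfer (auto simp: psum_one)
  show "psum 1 x = x" by transfer (auto simp: psum_1_left[simplified])
  show "psum m (psum n x) = psum (m * n) x" if "m \<ge> 1" "n \<ge> 1"
    using that by transfer (auto simp: psum_psum)
qed

end

text \<open>The fraction \<open>a / s\<close>; meaningful for \<open>s \<in> denominators\<close>.\<close>

definition fract :: "'a::modified_lambda_ring \<Rightarrow> 'a \<Rightarrow> 'a localization" where
  "fract a s = abs_localization (a, s)"

lemma fract_rel_refl: "fract_rel (a, s) (a, s) \<longleftrightarrow> s \<in> denominators"
  by (simp add: fract_rel_def)

lemma fract_cases:
  obtains a s where "s \<in> denominators" "x = fract a s"
proof -
  obtain p where "fract_rel p p" "x = abs_localization p"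
    by (rule localization.abs_induct[of "\<lambda>x. \<exists>p. fract_rel p p \<and> x = abs_localization p", THEN exE]) blast+
  then show ?thesis
    using that by (cases p) (auto simp: fract_def fract_rel_def)
qed

lemma fract_eq_iff:
  "s \<in> denominators \<Longrightarrow> t \<in> denominators \<Longrightarrow> fract a s = fract b t \<longleftrightarrow> a * t = b * s"
  using Quotient3_rel[OF Quotient3_localization, of "(a, s)" "(b, t)"]
  by (auto simp: fract_def fract_rel_def)

lemma fract_zero: "0 = fract 0 1"
  by (simp add: fract_def zero_localization_def)

lemma fract_one: "1 = fract 1 1"
  by (simp add: fract_def one_localization_def)

lemma fract_add:
  "s \<in> denominators \<Longrightarrow> t \<in> denominators \<Longrightarrow> fract a s + fract b t = fract (a * t + b * s) (s * t)"
  unfolding fract_def by (subst plus_localization.abs_eq) (simp_all add: fract_rel_refl)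

lemma fract_uminus: "s \<in> denominators \<Longrightarrow> - fract a s = fract (- a) s"
  unfolding fract_def by (subst uminus_localization.abs_eq) (simp_all add: fract_rel_refl)

lemma fract_diff:
  "s \<in> denominators \<Longrightarrow> t \<in> denominators \<Longrightarrow> fract a s - fract b t = fract (a * t - b * s) (s * t)"
  unfolding minus_localization_def by (simp add: fract_uminus fract_add del: add_uminus_conv_diff)
    (simp add: fract_def)

lemma fract_mult:
  "s \<in> denominators \<Longrightarrow> t \<in> denominators \<Longrightarrow> fract a s * fract b t = fract (a * b) (s * t)"
  unfolding fract_def by (subst times_localization.abs_eq) (simp_all add: fract_rel_refl)

lemma fract_psum:
  "n \<ge> 1 \<Longrightarrow> s \<in> denominators \<Longrightarrow> psum n (fract a s) = fract (psum n a) (psum n s)"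
  unfolding fract_def by (subst psum_localization.abs_eq) (auto simp: fract_rel_refl)

text \<open>The induced filtration, by the extended ideals of the \<open>filt k\<close>.\<close>

instantiation localization :: (modified_lambda_ring) filtered_ring
begin

definition filt_localization :: "nat \<Rightarrow> 'a localization set" where
  "filt_localization k = {fract a s | a s. a \<in> filt k \<and> s \<in> denominators}"

definition open_localization :: "'a localization set \<Rightarrow> bool" where
  "open_localization U \<longleftrightarrow> (\<forall>x\<in>U. \<exists>k. \<forall>y. y - x \<in> filt k \<longrightarrow> y \<in> U)"

instance
proof
  fix x y :: "'a localization" and i j k :: nat and U V :: "'a localization set"
  show "filt 0 = (UNIV :: 'a localization set)"
    unfolding filt_localization_def filt_0 by (auto intro: fract_cases)
  show S: "filt (Suc k) \<subseteq> (filt k :: 'a localization set)" for k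
    using filt_Suc[of k, where 'a = 'a] by (auto simp: filt_localization_def)
  show "0 \<in> (filt k :: 'a localization set)"
    unfolding filt_localization_def fract_zero using zero_in_filt[of k] one_in_denominators by blast
  show "x - y \<in> filt k" if xy: "x \<in> filt k" "y \<in> filt k"
  proof -
    from xy obtain a s b t where "x = fract a s" "y = fract b t" "a \<in> filt k" "b \<in> filt k"
      and D: "s \<in> denominators" "t \<in> denominators"
      unfolding filt_localization_def by blast
    then have "x - y = fract (a * t - b * s) (s * t)" "a * t - b * s \<in> filt k"
      by (simp_all add: fract_diff filt_diff filt_mult_right)
    with denominators_mult[OF D] show ?thesis unfolding filt_localization_def by blast
  qed
  show "x * y \<in> filt (i + j)" if xy: "x \<in> filt i" "y \<in> filt j"
  proof -
    from xy obtain a s b t where "x = fract a s" "y = fract b t" "a \<in> filt i" "b \<in> filt j"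
      and D: "s \<in> denominators" "t \<in> denominators"
      unfolding filt_localization_def by blast
    then have "x * y = fract (a * b) (s * t)" "a * b \<in> filt (i + j)"
      by (simp_all add: fract_mult filt_mult)
    with denominators_mult[OF D] show ?thesis unfolding filt_localization_def by blast
  qed
  show "open U \<longleftrightarrow> (\<forall>x\<in>U. \<exists>k. \<forall>y. y - x \<in> filt k \<longrightarrow> y \<in> U)"
    by (rule open_localization_def)
  note top = filt_topology[of "filt :: nat \<Rightarrow> 'a localization set", OF S, folded open_localization_def]
  show "open (UNIV :: 'a localization set)" by (rule top)
  show "open (U \<inter> V)" if "open U" "open V" by (rule top) (fact that)+
  show "open (\<Union>K)" if "\<forall>U\<in>K. open U" for K :: "'a localization set set" by (rule top) (fact that)
qed

end

instance localization :: (modified_lambda_ring) filtered_lambda_ring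
proof
  fix n :: nat and U :: "'a localization set"
  assume n: "n \<ge> 1" and U: "open U"
  show "open (psum n -` U)"
  proof (rule open_vimage_psumI[OF _ _ U])
    show "psum n (f - g) = psum n f - psum n g" for f g :: "'a localization"
      by (rule psum_diff[OF n])
    show "\<exists>j. \<forall>x\<in>filt j. psum n (x :: 'a localization) \<in> filt k" for k
    proof -
      from psum_filt[OF n] obtain j where j: "\<forall>x\<in>filt j. psum n (x::'a) \<in> filt k" by blast
      have "psum n x \<in> filt k" if "x \<in> filt j" for x :: "'a localization"
      proof -
        from that obtain a s where "x = fract a s" "a \<in> filt j" and s: "s \<in> denominators"
          unfolding filt_localization_def by blast
        with j n have "psum n x = fract (psum n a) (psum n s)" "psum n a \<in> filt k"
          by (simp_all add: fract_psum)
        with psum_in_denominators[OF n s] show ?thesis unfolding filt_localization_def by blast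
      qed
      then show ?thesis by blast
    qed
  qed
qed

text \<open>The completed localization, and its elements \<open>a\<close> and \<open>a / S\<close> for \<open>a\<close> in the base ring.\<close>

type_synonym 'a completed_localization = "'a localization completion"

definition of_base :: "'a::modified_lambda_ring \<Rightarrow> 'a completed_localization" where
  "of_base a = to_completion (fract a 1)"

definition over_modifier :: "'a::modified_lambda_ring \<Rightarrow> 'a completed_localization" where
  "over_modifier a = to_completion (fract a modifier)"

lemma of_base_modifier_mult_over_modifier: "of_base modifier * over_modifier a = of_base a"
proof -
  have "fract modifier 1 * fract a modifier = fract (modifier * a) (1 * modifier)"
    by (rule fract_mult[OF one_in_denominators modifier_in_denominators])
  also have "\<dots> = fract a 1"
    by (simp add: fract_eq_iff one_in_denominators modifier_in_denominators mult.commute)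
  finally show ?thesis
    by (simp add: of_base_def over_modifier_def flip: to_completion_mult)
qed


section \<open>Well-behaved series and the modified Hall product\<close>

text \<open>The partition \<open>\<lambda>\<close> ranges over nonempty partitions: for the empty one \<open>p\<^sub>\<lambda>[A\<^sub>i] = 1\<close>.\<close>

definition well_behaved :: "(nat \<Rightarrow> 'a::filtered_lambda_ring) \<Rightarrow> bool" where
  "well_behaved A \<longleftrightarrow>
     (\<forall>k. \<exists>i0. \<forall>i. \<forall>\<mu>\<in>partitions. \<mu> \<noteq> {#} \<and> (i > i0 \<or> sum_mset \<mu> > i0) \<longrightarrow>
        psum_part \<mu> (A i) \<in> filt k)"

text \<open>The coefficients are arranged in a sequence by an enumeration of all partitions;
  by \<open>well_behaved_series_iff\<close> below the choice of the enumeration does not matter.\<close>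

definition well_behaved_series :: "'a::filtered_lambda_ring sym_series \<Rightarrow> bool" where
  "well_behaved_series A \<longleftrightarrow>
     (\<exists>e. bij_betw e UNIV partitions \<and> well_behaved (\<lambda>i. sym_coeff A (e i)))"

lemma finite_partitions_le: "finite {\<mu> \<in> partitions. sum_mset \<mu> \<le> n}"
proof (rule finite_subset)
  show "{\<mu> \<in> partitions. sum_mset \<mu> \<le> n} \<subseteq> mset ` {xs. set xs \<subseteq> {..n} \<and> length xs \<le> n}"
  proof clarify
    fix \<mu> assume \<mu>: "\<mu> \<in> partitions" "sum_mset \<mu> \<le> n"
    have "size \<mu> \<le> sum_mset \<mu>" if "\<mu> \<in> partitions" for \<mu>
      using that by (induction \<mu>) (auto simp: partitions_def)
    with \<mu> have "size \<mu> \<le> n" by (meson order_trans)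
    moreover have "i \<le> n" if "i \<in># \<mu>" for i
      using \<mu>(2) multi_member_split[OF that] by auto
    moreover obtain xs where "mset xs = \<mu>" using ex_mset by blast
    ultimately show "\<mu> \<in> mset ` {xs. set xs \<subseteq> {..n} \<and> length xs \<le> n}"
      by (intro image_eqI[of _ _ xs]) auto
  qed
  show "finite (mset ` {xs. set xs \<subseteq> {..n} \<and> length xs \<le> n})"
    by (intro finite_imageI finite_lists_length_le) simp
qed

lemma ex_enumeration_partitions: "\<exists>e :: nat \<Rightarrow> nat multiset. bij_betw e UNIV partitions"
proof -
  have "inj_on (\<lambda>n. {#Suc n#}) UNIV" by (simp add: inj_on_def)
  then have "infinite (range (\<lambda>n. {#Suc n#}))" by (metis finite_imageD infinite_UNIV_nat)
  moreover have "range (\<lambda>n. {#Suc n#}) \<subseteq> partitions" by (auto simp: partitions_def)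
  ultimately have "infinite partitions" using finite_subset by blast
  moreover have "partitions \<subseteq> range mset" by (metis ex_mset rangeI subsetI)
  then have "countable partitions" by (rule countable_subset) simp
  ultimately show ?thesis using bij_betw_from_nat_into by blast
qed

lemma well_behaved_series_iff:
  "well_behaved_series A \<longleftrightarrow>
     (\<forall>k. \<exists>n0. \<forall>\<nu>\<in>partitions. \<forall>\<mu>\<in>partitions. \<mu> \<noteq> {#} \<and> (sum_mset \<nu> > n0 \<or> sum_mset \<mu> > n0) \<longrightarrow>
        psum_part \<mu> (sym_coeff A \<nu>) \<in> filt k)"
  (is "_ \<longleftrightarrow> ?R")
proof
  assume "well_behaved_series A"
  then obtain e where e: "bij_betw e UNIV partitions"
    and A: "well_behaved (\<lambda>i. sym_coeff A (e i))"
    by (auto simp: well_behaved_series_def)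
  show ?R
  proof
    fix k
    from A obtain i0 where i0: "\<And>i \<mu>. \<mu> \<in> partitions \<Longrightarrow> \<mu> \<noteq> {#} \<Longrightarrow> i > i0 \<or> sum_mset \<mu> > i0 \<Longrightarrow>
        psum_part \<mu> (sym_coeff A (e i)) \<in> filt k"
      unfolding well_behaved_def by metis
    define n0 where "n0 = i0 + (\<Sum>i\<le>i0. sum_mset (e i))"
    have "psum_part \<mu> (sym_coeff A \<nu>) \<in> filt k"
      if "\<nu> \<in> partitions" "\<mu> \<in> partitions" "\<mu> \<noteq> {#}" "sum_mset \<nu> > n0 \<or> sum_mset \<mu> > n0" for \<mu> \<nu>
    proof -
      from e that(1) obtain i where i: "\<nu> = e i" unfolding bij_betw_def by blast
      have "i > i0 \<or> sum_mset \<mu> > i0"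
      proof (rule ccontr)
        assume *: "\<not> ?thesis"
        then have "sum_mset (e i) \<le> (\<Sum>i\<le>i0. sum_mset (e i))"
          by (intro member_le_sum) auto
        with * that(4) show False by (simp add: n0_def i)
      qed
      with i0 that i show ?thesis by blast
    qed
    then show "\<exists>n0. \<forall>\<nu>\<in>partitions. \<forall>\<mu>\<in>partitions. \<mu> \<noteq> {#} \<and>
        (sum_mset \<nu> > n0 \<or> sum_mset \<mu> > n0) \<longrightarrow> psum_part \<mu> (sym_coeff A \<nu>) \<in> filt k"
      by blast
  qed
next
  assume R: ?R
  obtain e :: "nat \<Rightarrow> nat multiset" where e: "bij_betw e UNIV partitions"
    using ex_enumeration_partitions by blast
  have "well_behaved (\<lambda>i. sym_coeff A (e i))"
    unfolding well_behaved_def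
  proof
    fix k
    from R obtain n0 where n0: "\<And>\<nu> \<mu>. \<nu> \<in> partitions \<Longrightarrow> \<mu> \<in> partitions \<Longrightarrow> \<mu> \<noteq> {#} \<Longrightarrow>
        sum_mset \<nu> > n0 \<or> sum_mset \<mu> > n0 \<Longrightarrow> psum_part \<mu> (sym_coeff A \<nu>) \<in> filt k"
      by metis
    have "finite (e -` {\<mu> \<in> partitions. sum_mset \<mu> \<le> n0})"
      using e by (intro finite_vimageI finite_partitions_le) (simp add: bij_betw_def)
    then obtain i1 where i1: "\<forall>i \<in> e -` {\<mu> \<in> partitions. sum_mset \<mu> \<le> n0}. i \<le> i1"
      using finite_nat_set_iff_bounded_le by blast
    have "psum_part \<mu> (sym_coeff A (e i)) \<in> filt k"
      if "\<mu> \<in> partitions" "\<mu> \<noteq> {#}" "i > max n0 i1 \<or> sum_mset \<mu> > max n0 i1" for i \<mu>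
    proof -
      have ei: "e i \<in> partitions" using e by (auto simp: bij_betw_def)
      have "sum_mset (e i) > n0 \<or> sum_mset \<mu> > n0"
        using that(3) i1 ei by (auto simp: not_less[symmetric])
      with n0 ei that show ?thesis by blast
    qed
    then show "\<exists>i0. \<forall>i. \<forall>\<mu>\<in>partitions. \<mu> \<noteq> {#} \<and> (i > i0 \<or> sum_mset \<mu> > i0) \<longrightarrow>
        psum_part \<mu> (sym_coeff A (e i)) \<in> filt k"
      by blast
  qed
  with e show "well_behaved_series A" by (auto simp: well_behaved_series_def)
qed

definition map_coeffs :: "('a::zero \<Rightarrow> 'b::zero) \<Rightarrow> 'a sym_series \<Rightarrow> 'b sym_series" where
  "map_coeffs f A = Abs_sym_series (\<lambda>\<mu>. if \<mu> \<in> partitions then f (sym_coeff A \<mu>) else 0)"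

lemma sym_coeff_map_coeffs: "\<mu> \<in> partitions \<Longrightarrow> sym_coeff (map_coeffs f A) \<mu> = f (sym_coeff A \<mu>)"
  unfolding map_coeffs_def by (subst Abs_sym_series_inverse) simp_all

text \<open>\<open>F[X] \<mapsto> F[SX]\<close>\<close>

definition plethysm_alphabet :: "'a::lambda_ring \<Rightarrow> 'a sym_series \<Rightarrow> 'a sym_series" where
  "plethysm_alphabet S F = Abs_sym_series (\<lambda>\<mu>. psum_part \<mu> S * sym_coeff F \<mu>)"

lemma sym_coeff_plethysm_alphabet:
  "sym_coeff (plethysm_alphabet S F) \<mu> = psum_part \<mu> S * sym_coeff F \<mu>"
  unfolding plethysm_alphabet_def by (subst Abs_sym_series_inverse) (simp_all add: sym_coeff_outside)

text \<open>The Hall inner product is determined by \<open>(p\<^sub>\<lambda>, p\<^sub>\<mu>) = z\<^sub>\<lambda> \<delta>\<^sub>\<lambda>\<^sub>\<mu>\<close> with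
  \<open>z\<^sub>\<lambda> = \<Prod>\<^sub>i i\<^bsup>m\<^sub>i\<^esup> m\<^sub>i!\<close>, where \<open>m\<^sub>i\<close> is the multiplicity of the part \<open>i\<close> in \<open>\<lambda>\<close>.\<close>

definition zee :: "nat multiset \<Rightarrow> nat" where
  "zee \<mu> = (\<Prod>i\<in>set_mset \<mu>. i ^ count \<mu> i * fact (count \<mu> i))"

definition hall_term :: "'a::rat_algebra sym_series \<Rightarrow> 'a sym_series \<Rightarrow> nat multiset \<Rightarrow> 'a" where
  "hall_term F G \<mu> = scaleQ (of_nat (zee \<mu>)) (sym_coeff F \<mu> * sym_coeff G \<mu>)"

definition hall :: "'a::complete_lambda_ring sym_series \<Rightarrow> 'a sym_series \<Rightarrow> 'a" where
  "hall F G = (\<Sum>\<^sub>\<infinity>\<mu>\<in>partitions. hall_term F G \<mu>)"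

definition hall_converges :: "'a::complete_lambda_ring sym_series \<Rightarrow> 'a sym_series \<Rightarrow> bool" where
  "hall_converges F G \<longleftrightarrow> hall_term F G summable_on partitions"

definition modified_hall ::
  "'a::complete_lambda_ring \<Rightarrow> 'a sym_series \<Rightarrow> 'a sym_series \<Rightarrow> 'a" where
  "modified_hall S F G = hall (plethysm_alphabet S F) G"

definition modified_hall_converges ::
  "'a::complete_lambda_ring \<Rightarrow> 'a sym_series \<Rightarrow> 'a sym_series \<Rightarrow> bool" where
  "modified_hall_converges S F G \<longleftrightarrow> hall_converges (plethysm_alphabet S F) G"

end

(* The Hall product is the value at t = 1 of the solution Z of a heat equation: in a third alphabet T,
   with Z_0 = Exp[A[X]/S] Exp[B[Y]/S], the coefficient of p_tau[T] in
   exp(sum_M M p_M[S] p_M[T] d/dp_M[X] d/dp_M[Y]) Z_0, taken at X = Y = 0, is the term of the Hall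
   product belonging to the partition tau.  Writing Z = Exp[f], the heat equation becomes a first order
   flow for f in the degree of T, with f = (A[X] + B[Y])/S at T = 0.  Its right-hand side is a sum of
     p_M[S] p_g[df] p_h[df]  with g, h coprime divisors of M,   and   p_M[S] p_n[ddf]  with n | M,
   and the two divisibility properties of a good modifier say exactly that this right-hand side stays in
   (1/S) Lambda when f is in (1/S) Lambda.  Hence so does f, and L/S is the value of f at T = 1, X = Y = 0.
   Convergence is controlled by the filtration in which p_k[A_lambda] has weight k(|lambda| + 1):
   well-behavedness says that the elements of large weight are small. *)
theory Submission
  imports Defs "HOL-Number_Theory.Totient"
begin

text \<open>Two obstacles shape the proof. First, the given filtration does not control
  \<open>Exp\<close>: \<open>p_k\<close> is only continuous, so p_k[G]/k need not tend to 0 when G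
  lies deep in it. Hence a second filtration whose degrees are multiplied by k under
  \<open>p_k\<close>; infinite sums, derivations and specializations are all handled degree by
  degree in it. Second, L has to come from \<Lambda> itself, whereas the completed localization may
  identify many elements (it can even be zero), and nothing guarantees that a limit of elements of
  (1/S) \<Lambda> is again of this form. So integrality is never obtained by a limit there: the
  recursion in the degree of T fixes each coefficient of f after finitely many steps, every
  coefficient receives an actual numerator, and the numerators are summed in \<Lambda>. In the
  equation for Z the exponent M p_M[S] p_M[T] acquires a second factor M because the Euler operator
  meets p_M[T]; hence the M^2 below. Passing to f works because the Euler operator turns p_k[f]/k
  into p_k[E f], so a sum over all divisors k of M has to be undone.\<close>

lemma scaleQ_mult_right: "x * scaleQ a y = scaleQ a (x * y :: 'a::rat_algebra)"
  by (metis mult.commute scaleQ_mult_left)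

lemma scaleQ_zero_left: "scaleQ 0 (x :: 'a::rat_algebra) = 0"
  using scaleQ_add_left[of 0 0 x] by simp

lemma scaleQ_minus_left: "scaleQ (- 1) (x :: 'a::rat_algebra) = - x"
  using scaleQ_add_left[of "-1" 1 x] by (simp add: scaleQ_zero_left scaleQ_one eq_neg_iff_add_eq_0)

lemma scaleQ_sum_left: "scaleQ (sum f A) (x :: 'a::rat_algebra) = (\<Sum>i\<in>A. scaleQ (f i) x)"
  by (induction A rule: infinite_finite_induct) (auto simp: scaleQ_zero_left scaleQ_add_left)

lemma scaleQ_cancel:
  fixes x y :: "'a::rat_algebra"
  assumes "scaleQ a x = scaleQ a y" "a \<noteq> 0"
  shows "x = y"
proof -
  have "scaleQ (inverse a) (scaleQ a x) = scaleQ (inverse a) (scaleQ a y)" by (simp add: assms)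
  then show ?thesis using assms(2) by (simp add: scaleQ_scaleQ scaleQ_one)
qed

text \<open>\<open>p_n\<close> is only assumed to be a ring endomorphism. Additivity gives natural
  multiples, cancelling a denominator gives nonnegative rationals, and \<open>psum_minus\<close>
  gives the sign.\<close>

lemma psum_scaleQ:
  fixes x :: "'a::lambda_ring"
  assumes n: "n \<ge> 1"
  shows "psum n (scaleQ q x) = scaleQ q (psum n x)"
proof -
  have nat: "psum n (scaleQ (of_nat m) y) = scaleQ (of_nat m) (psum n y)" for m and y :: 'a
    by (induction m) (simp_all add: scaleQ_zero_left scaleQ_add_left psum_zero[OF n] psum_add[OF n] scaleQ_one)
  have pos: "psum n (scaleQ q x) = scaleQ q (psum n x)" if "q \<ge> 0" for q and x :: 'a
  proof -
    obtain a b where ab: "quotient_of q = (a, b)" by force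
    from quotient_of_div[OF ab] quotient_of_denom_pos[OF ab]
    have q: "q = of_int a / of_int b" "b > 0" by auto
    with that have "a \<ge> 0" by (simp add: zero_le_divide_iff)
    define i j where "i = nat a" and "j = nat b"
    with q \<open>a \<ge> 0\<close> have *: "q = of_nat i / of_nat j" "j > 0" by auto
    have "scaleQ (of_nat j) (psum n (scaleQ q x)) = scaleQ (of_nat j) (scaleQ q (psum n x))"
      using * by (simp add: scaleQ_scaleQ flip: nat)
    then show ?thesis by (rule scaleQ_cancel) (use * in simp)
  qed
  show ?thesis
  proof (cases "q \<ge> 0")
    case False
    then have "psum n (scaleQ (-1) (scaleQ (- q) x)) = scaleQ (-1) (scaleQ (- q) (psum n x))"
      by (simp add: scaleQ_minus_left psum_minus[OF n] pos)
    then show ?thesis by (simp add: scaleQ_scaleQ)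
  qed (rule pos)
qed

section \<open>Graded filtrations\<close>

text \<open>Rational subspaces rather than ideals: the fractions with one fixed denominator, which
  express integrality below, need not form an ideal of the localization.\<close>

locale rat_filtration =
  fixes A :: "nat \<Rightarrow> 'a::rat_algebra set"
  assumes zero_mem: "0 \<in> A n"
    and add_mem: "x \<in> A n \<Longrightarrow> y \<in> A n \<Longrightarrow> x + y \<in> A n"
    and scaleQ_mem: "x \<in> A n \<Longrightarrow> scaleQ q x \<in> A n"
    and Suc_mem: "x \<in> A (Suc n) \<Longrightarrow> x \<in> A n"
begin

lemma diff_mem: "x \<in> A n \<Longrightarrow> y \<in> A n \<Longrightarrow> x - y \<in> A n"
  using add_mem[of x n "scaleQ (-1) y"] scaleQ_mem[of y n "-1"] by (simp add: scaleQ_minus_left)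

lemma antimono: "x \<in> A n \<Longrightarrow> m \<le> n \<Longrightarrow> x \<in> A m"
  using lift_Suc_antimono_le[of A m n] Suc_mem by auto

lemma sum_mem: "(\<And>i. i \<in> I \<Longrightarrow> f i \<in> A n) \<Longrightarrow> sum f I \<in> A n"
  by (induction I rule: infinite_finite_induct) (auto simp: zero_mem add_mem)

end

text \<open>By \<open>psum_mem\<close>, the k-th term of \<open>Exp_arg x\<close> lies in
  \<open>K k\<close> as soon as \<open>x\<close> lies in \<open>K 1\<close>. The axioms
  \<open>null\<close> and \<open>closed\<close> tie \<open>K\<close> to the topology: small in
  \<open>K\<close> implies small in \<open>filt\<close>, and limits keep their degree.\<close>

locale graded_filtration = rat_filtration K for K :: "nat \<Rightarrow> 'a::complete_lambda_ring set" +
  assumes one_mem: "1 \<in> K 0"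
    and mult_mem: "x \<in> K i \<Longrightarrow> y \<in> K j \<Longrightarrow> x * y \<in> K (i + j)"
    and psum_mem: "g \<ge> 1 \<Longrightarrow> x \<in> K n \<Longrightarrow> psum g x \<in> K (g * n)"
    and closed: "(\<And>k. \<exists>y\<in>K n. x - y \<in> filt k) \<Longrightarrow> x \<in> K n"
    and null: "\<exists>n. K n \<subseteq> filt k"
begin

lemma separated: "(\<And>n. x \<in> K n) \<Longrightarrow> x = 0"
  by (rule filt_separated) (use null in blast)

lemma power_mem: "x \<in> K m \<Longrightarrow> x ^ n \<in> K (n * m)"
  by (induction n) (auto simp: one_mem mult_mem)

text \<open>By \<open>null\<close>, the sums over the sublevel sets of \<open>w\<close> form a
  Cauchy sequence for \<open>filt\<close>. The second claim is sharper than convergence: the tail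
  lies in \<open>K N\<close> itself, since all finite tails do and \<open>K N\<close> is
  closed.\<close>

lemma
  assumes f: "\<And>i. i \<in> I \<Longrightarrow> f i \<in> K (w i)" and fin: "\<And>N. finite {i\<in>I. w i < N}"
  shows summable: "f summable_on I"
    and infsum_approx: "infsum f I - sum f {i\<in>I. w i < N} \<in> K N"
proof -
  define F where "F = (\<lambda>N. {i\<in>I. w i < N})"
  have tail: "sum f G - sum f (F N) \<in> K N" if "finite G" "F N \<subseteq> G" "G \<subseteq> I" for G N
  proof -
    have "sum f G - sum f (F N) = sum f (G - F N)"
      using that by (simp add: sum_diff)
    also have "\<dots> \<in> K N"
      using that(3) by (intro sum_mem antimono[OF f]) (auto simp: F_def)
    finally show ?thesis .
  qed
  have step: "sum f (F m) - sum f (F N) \<in> K N" if "m \<ge> N" for m N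
    using that fin by (intro tail) (auto simp: F_def)
  have "convergent (\<lambda>n. sum f (F n))"
  proof (rule filt_complete)
    fix k
    obtain N where N: "K N \<subseteq> filt k" using null by blast
    have "sum f (F m) - sum f (F n) \<in> filt k" if "m \<ge> N" "n \<ge> N" for m n
      using diff_mem[OF step[OF that(1)] step[OF that(2)]] N by auto
    then show "\<exists>N. \<forall>m\<ge>N. \<forall>n\<ge>N. sum f (F m) - sum f (F n) \<in> filt k" by blast
  qed
  then obtain l where l: "(\<lambda>n. sum f (F n)) \<longlonglongrightarrow> l" by (auto simp: convergent_def)
  have h: "(f has_sum l) I"
    unfolding has_sum_def tendsto_filt_iff
  proof
    fix k
    obtain N0 where N0: "K N0 \<subseteq> filt k" using null by blast
    obtain N1 where N1: "\<forall>n\<ge>N1. sum f (F n) - l \<in> filt k"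
      using l unfolding LIMSEQ_filt_iff by blast
    define N where "N = max N0 N1"
    have "sum f G - l \<in> filt k" if "finite G" "F N \<subseteq> G" "G \<subseteq> I" for G
    proof (rule filt_diff_trans)
      show "sum f (F N) - l \<in> filt k" using N1 by (simp add: N_def)
      show "sum f G - sum f (F N) \<in> filt k"
        using antimono[OF tail[OF that], of N0] N0 by (auto simp: N_def)
    qed
    then show "\<forall>\<^sub>F G in finite_subsets_at_top I. sum f G - l \<in> filt k"
      unfolding eventually_finite_subsets_at_top using fin[of N]
      by (intro exI[of _ "F N"]) (auto simp: F_def)
  qed
  then show "f summable_on I" by (auto simp: summable_on_def)
  show "infsum f I - sum f {i\<in>I. w i < N} \<in> K N"
  proof -
    have "l - sum f (F N) \<in> K N"
    proof (rule closed)
      fix k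
      obtain N1 where N1: "\<forall>n\<ge>N1. sum f (F n) - l \<in> filt k"
        using l unfolding LIMSEQ_filt_iff by blast
      define n where "n = max N N1"
      have "l - sum f (F n) \<in> filt k" using N1 by (subst filt_diff_commute) (simp add: n_def)
      moreover have "sum f (F n) - sum f (F N) \<in> K N" by (rule step) (simp add: n_def)
      ultimately show "\<exists>y\<in>K N. l - sum f (F N) - y \<in> filt k"
        by (intro bexI[of _ "sum f (F n) - sum f (F N)"]) auto
    qed
    then show ?thesis
      using infsumI[OF h] by (simp add: F_def)
  qed
qed

text \<open>Both sides have the same truncations modulo every \<open>K N\<close>, and by
  \<open>separated\<close> only 0 lies in all of these. This reduces identities between infinite
  sums to finite ones.\<close>

lemma infsum_eqI:
  assumes f: "\<And>i. i \<in> I \<Longrightarrow> f i \<in> K (w i)" and fin: "\<And>N. finite {i\<in>I. w i < N}"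
    and y: "\<And>N. y - sum f {i\<in>I. w i < N} \<in> K N"
  shows "infsum f I = y"
proof -
  have "infsum f I - y \<in> K N" for N
    using diff_mem[OF infsum_approx[OF f fin] y, of N] by simp
  then have "infsum f I - y = 0" by (rule separated)
  then show ?thesis by simp
qed

lemma infsum_mem:
  assumes f: "\<And>i. i \<in> I \<Longrightarrow> f i \<in> K (w i)" and fin: "\<And>N. finite {i\<in>I. w i < N}"
    and n: "\<And>i. i \<in> I \<Longrightarrow> f i \<in> K n"
  shows "infsum f I \<in> K n"
proof -
  have "infsum f I - sum f {i\<in>I. w i < n} + sum f {i\<in>I. w i < n} \<in> K n"
    by (intro add_mem infsum_approx[OF f fin] sum_mem n) auto
  then show ?thesis by simp
qed

text \<open>The weight factors through \<open>\<pi>\<close>, so each truncation is a finite union of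
  whole fibres and can be regrouped as a finite sum.\<close>

lemma infsum_fibers:
  assumes h: "\<And>p. p \<in> P \<Longrightarrow> h p \<in> K (w (\<pi> p))" and \<pi>: "\<And>p. p \<in> P \<Longrightarrow> \<pi> p \<in> L"
    and finP: "\<And>x. x \<in> L \<Longrightarrow> finite {p\<in>P. \<pi> p = x}" and finL: "\<And>N. finite {x\<in>L. w x < N}"
  shows "infsum h P = (\<Sum>\<^sub>\<infinity>x\<in>L. \<Sum>p | p \<in> P \<and> \<pi> p = x. h p)"
proof (rule infsum_eqI[where w = "\<lambda>p. w (\<pi> p)", OF h])
  have fin: "finite {p\<in>P. w (\<pi> p) < N}" for N
  proof -
    have "{p\<in>P. w (\<pi> p) < N} \<subseteq> (\<Union>x\<in>{x\<in>L. w x < N}. {p\<in>P. \<pi> p = x})" using \<pi> by auto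
    then show ?thesis by (rule finite_subset) (use finP finL in auto)
  qed
  then show "finite {p\<in>P. w (\<pi> p) < N}" for N .
  fix N
  have "sum h {p\<in>P. w (\<pi> p) < N} =
      (\<Sum>x | x \<in> L \<and> w x < N. \<Sum>p | p \<in> {p\<in>P. w (\<pi> p) < N} \<and> \<pi> p = x. h p)"
    using sum.group[of "{p\<in>P. w (\<pi> p) < N}" "{x\<in>L. w x < N}" \<pi> h] fin finL \<pi> by (auto simp: image_subset_iff)
  also have "\<dots> = (\<Sum>x | x \<in> L \<and> w x < N. \<Sum>p | p \<in> P \<and> \<pi> p = x. h p)"
    by (intro sum.cong refl) auto
  finally show "(\<Sum>\<^sub>\<infinity>x\<in>L. \<Sum>p | p \<in> P \<and> \<pi> p = x. h p) - sum h {p\<in>P. w (\<pi> p) < N} \<in> K N"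
    using infsum_approx[of L "\<lambda>x. \<Sum>p | p \<in> P \<and> \<pi> p = x. h p" w N] h finL
    by (auto intro!: sum_mem)
qed

text \<open>The truncation by total weight is a triangle inside the rectangle of the two separate
  truncations. The rest of the rectangle has total weight at least \<open>N\<close>, and the
  rectangle itself gives the product of two approximations.\<close>

lemma infsum_product:
  assumes f: "\<And>i. i \<in> I \<Longrightarrow> f i \<in> K (u i)" and finI: "\<And>N. finite {i\<in>I. u i < N}"
    and g: "\<And>j. j \<in> J \<Longrightarrow> g j \<in> K (v j)" and finJ: "\<And>N. finite {j\<in>J. v j < N}"
  shows "(\<Sum>\<^sub>\<infinity>(i, j)\<in>I \<times> J. f i * g j) = infsum f I * infsum g J"
proof (rule infsum_eqI[where w = "\<lambda>(i, j). u i + v j"])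
  show "\<And>p. p \<in> I \<times> J \<Longrightarrow> (case p of (i, j) \<Rightarrow> f i * g j) \<in> K (case p of (i, j) \<Rightarrow> u i + v j)"
    using f g by (auto intro: mult_mem)
  have sub: "{p \<in> I \<times> J. (case p of (i, j) \<Rightarrow> u i + v j) < N} \<subseteq> {i\<in>I. u i < N} \<times> {j\<in>J. v j < N}" for N
    by auto
  show fin: "finite {p \<in> I \<times> J. (case p of (i, j) \<Rightarrow> u i + v j) < N}" for N
    by (rule finite_subset[OF sub finite_cartesian_product[OF finI finJ]])
  fix N
  define a where "a = sum f {i\<in>I. u i < N}"
  define b where "b = sum g {j\<in>J. v j < N}"
  have f0: "f i \<in> K 0" if "i \<in> I" for i using antimono[OF f[OF that]] by simp
  have g0: "g j \<in> K 0" if "j \<in> J" for j using antimono[OF g[OF that]] by simp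
  have "a \<in> K 0" unfolding a_def by (rule sum_mem) (simp add: f0)
  moreover have "infsum g J \<in> K 0" by (rule infsum_mem[OF g finJ g0])
  moreover have "infsum f I - a \<in> K N" unfolding a_def by (rule infsum_approx[OF f finI])
  moreover have "infsum g J - b \<in> K N" unfolding b_def by (rule infsum_approx[OF g finJ])
  ultimately have "(infsum f I - a) * infsum g J + a * (infsum g J - b) \<in> K N"
    using mult_mem[of "infsum f I - a" N "infsum g J" 0] mult_mem[of a 0 "infsum g J - b" N]
    by (auto intro: add_mem)
  moreover have "a * b - (\<Sum>(i, j)\<in>{p \<in> I \<times> J. (case p of (i, j) \<Rightarrow> u i + v j) < N}. f i * g j) \<in> K N"
  proof -
    have "a * b = (\<Sum>(i, j)\<in>{i\<in>I. u i < N} \<times> {j\<in>J. v j < N}. f i * g j)"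
      by (simp add: a_def b_def sum_product sum.cartesian_product)
    then have "a * b - (\<Sum>(i, j)\<in>{p \<in> I \<times> J. (case p of (i, j) \<Rightarrow> u i + v j) < N}. f i * g j)
      = (\<Sum>(i, j)\<in>{i\<in>I. u i < N} \<times> {j\<in>J. v j < N} - {p \<in> I \<times> J. (case p of (i, j) \<Rightarrow> u i + v j) < N}. f i * g j)"
      using sub[of N] finI finJ by (simp add: sum_diff)
    also have "\<dots> \<in> K N"
      by (rule sum_mem) (auto intro!: antimono[OF mult_mem[OF f g]])
    finally show ?thesis .
  qed
  ultimately have "((infsum f I - a) * infsum g J + a * (infsum g J - b)) +
      (a * b - (\<Sum>(i, j)\<in>{p \<in> I \<times> J. (case p of (i, j) \<Rightarrow> u i + v j) < N}. f i * g j)) \<in> K N"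
    by (rule add_mem)
  then show "infsum f I * infsum g J
      - (\<Sum>(i, j)\<in>{p \<in> I \<times> J. (case p of (i, j) \<Rightarrow> u i + v j) < N}. f i * g j) \<in> K N"
    by (simp add: algebra_simps)
qed

end

section \<open>Maps of graded filtrations and infinite sums\<close>

text \<open>Linearity is required on \<open>K 0\<close> only, because \<open>specialize_one\<close>
  is defined by an infinite sum and behaves linearly where that sum converges.\<close>

locale graded_map = K: graded_filtration K + K': graded_filtration K'
  for K :: "nat \<Rightarrow> 'a::complete_lambda_ring set" and K' :: "nat \<Rightarrow> 'b::complete_lambda_ring set" +
  fixes h :: "'a \<Rightarrow> 'b"
  assumes add: "x \<in> K 0 \<Longrightarrow> y \<in> K 0 \<Longrightarrow> h (x + y) = h x + h y"
    and scaleQ: "x \<in> K 0 \<Longrightarrow> h (scaleQ q x) = scaleQ q (h x)"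
    and map_mem: "x \<in> K n \<Longrightarrow> h x \<in> K' n"
begin

lemma zero: "h 0 = 0"
  using add[OF K.zero_mem K.zero_mem] by simp

lemma sum: "(\<And>i. i \<in> I \<Longrightarrow> f i \<in> K 0) \<Longrightarrow> h (sum f I) = (\<Sum>i\<in>I. h (f i))"
  by (induction I rule: infinite_finite_induct) (auto simp: zero add K.sum_mem)

lemma infsum:
  assumes f: "\<And>i. i \<in> I \<Longrightarrow> f i \<in> K (w i)" and fin: "\<And>N. finite {i\<in>I. w i < N}"
  shows "h (infsum f I) = (\<Sum>\<^sub>\<infinity>i\<in>I. h (f i))"
proof (rule K'.infsum_eqI[symmetric, OF _ fin])
  fix N
  have f0: "f i \<in> K 0" if "i \<in> I" for i using K.antimono[OF f[OF that]] by simp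
  let ?s = "sum f {i\<in>I. w i < N}"
  have s: "?s \<in> K 0" by (rule K.sum_mem) (simp add: f0)
  have d: "infsum f I - ?s \<in> K N" by (rule K.infsum_approx[OF f fin])
  then have "h (infsum f I) = h (infsum f I - ?s) + h ?s"
    by (subst add[symmetric]) (use K.antimono[OF d] s in auto)
  then have "h (infsum f I) - (\<Sum>i | i \<in> I \<and> w i < N. h (f i)) = h (infsum f I - ?s)"
    using f0 by (subst sum[symmetric]) auto
  then show "h (infsum f I) - (\<Sum>i | i \<in> I \<and> w i < N. h (f i)) \<in> K' N"
    using map_mem[OF d] by simp
qed (simp add: map_mem f)

end

section \<open>Convergence and additivity of the plethystic exponential\<close>

context graded_filtration
begin

lemma finite_sublevel_ge_1: "finite {k\<in>{1::nat..}. k < N}" and finite_sublevel_nat: "finite {k\<in>UNIV::nat set. k < N}"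
  by auto

lemma Exp_arg_term_mem: "x \<in> K 1 \<Longrightarrow> k \<in> {1..} \<Longrightarrow> scaleQ (1 / of_nat k) (psum k x) \<in> K k"
  using psum_mem[of k x 1] by (auto intro: scaleQ_mem)

lemma Exp_arg_mem: "x \<in> K 1 \<Longrightarrow> Exp_arg x \<in> K 1"
  unfolding Exp_arg_def
  by (rule infsum_mem[OF Exp_arg_term_mem finite_sublevel_ge_1])
    (auto intro!: antimono[OF Exp_arg_term_mem, of x])

lemma Exp_term_mem: "x \<in> K 1 \<Longrightarrow> scaleQ (1 / fact n) (Exp_arg x ^ n) \<in> K n"
  using power_mem[OF Exp_arg_mem, of x n] by (auto intro: scaleQ_mem)

lemma Exp_mem: "x \<in> K 1 \<Longrightarrow> Exp x \<in> K 0"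
  unfolding Exp_def
  by (rule infsum_mem[OF Exp_term_mem finite_sublevel_nat]) (auto intro: antimono[OF Exp_term_mem])

lemma Exp_converges: "x \<in> K 1 \<Longrightarrow> Exp_converges x"
  unfolding Exp_converges_def
  by (intro conjI; rule summable[OF Exp_arg_term_mem finite_sublevel_ge_1]
      summable[OF Exp_term_mem finite_sublevel_nat]; assumption)

lemma Exp_arg_add:
  assumes x: "x \<in> K 1" and y: "y \<in> K 1"
  shows "Exp_arg (x + y) = Exp_arg x + Exp_arg y"
proof -
  have "Exp_arg (x + y) = (\<Sum>\<^sub>\<infinity>k\<in>{1..}. scaleQ (1 / of_nat k) (psum k x) + scaleQ (1 / of_nat k) (psum k y))"
    unfolding Exp_arg_def by (rule infsum_cong) (simp add: psum_add scaleQ_add_right)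
  also have "\<dots> = Exp_arg x + Exp_arg y"
    unfolding Exp_arg_def
    by (rule infsum_add; rule summable[OF Exp_arg_term_mem finite_sublevel_ge_1]) (use x y in simp_all)
  finally show ?thesis .
qed

text \<open>For e_i(z) = z^i/i! one has z e_i(z) = (i+1) e_(i+1)(z). In (x + y) e_n(x + y) the
  product e_i(x) e_(n+1-i)(y) thus gets the factor i from x and n+1-i from y, altogether n+1, which
  is cancelled.\<close>

lemma divided_power_add:
  fixes x y :: 'a
  shows "scaleQ (1 / fact n) ((x + y) ^ n) =
    (\<Sum>i\<le>n. scaleQ (1 / fact i) (x ^ i) * scaleQ (1 / fact (n - i)) (y ^ (n - i)))"
proof (induction n)
  case 0
  then show ?case by (simp add: scaleQ_one)
next
  case (Suc n)
  define e where "e = (\<lambda>i (z::'a). scaleQ (1 / fact i) (z ^ i))"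
  have e: "z * e i z = scaleQ (of_nat (Suc i)) (e (Suc i) z)" for i z
    by (simp add: e_def scaleQ_mult_right scaleQ_scaleQ add_nonneg_eq_0_iff)
  have IH: "e n (x + y) = (\<Sum>i\<le>n. e i x * e (n - i) y)" using Suc by (simp add: e_def)
  have "scaleQ (of_nat (Suc n)) (e (Suc n) (x + y)) = x * e n (x + y) + y * e n (x + y)"
    by (subst e[symmetric]) (rule distrib_right)
  also have "x * e n (x + y) = (\<Sum>i\<le>n. scaleQ (of_nat (Suc i)) (e (Suc i) x * e (Suc n - Suc i) y))"
    unfolding IH sum_distrib_left
    by (intro sum.cong refl) (simp add: e scaleQ_mult_left flip: mult.assoc)
  also have "\<dots> = (\<Sum>i\<le>Suc n. scaleQ (of_nat i) (e i x * e (Suc n - i) y))"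
    by (subst sum.atMost_Suc_shift) (simp add: scaleQ_zero_left)
  also have "y * e n (x + y) = (\<Sum>i\<le>n. scaleQ (of_nat (Suc n - i)) (e i x * e (Suc n - i) y))"
    unfolding IH sum_distrib_left
    by (intro sum.cong refl) (simp add: e scaleQ_mult_right Suc_diff_le mult.left_commute[of y])
  also have "\<dots> = (\<Sum>i\<le>Suc n. scaleQ (of_nat (Suc n - i)) (e i x * e (Suc n - i) y))"
    by (simp add: scaleQ_zero_left)
  also have "(\<Sum>i\<le>Suc n. scaleQ (of_nat i) (e i x * e (Suc n - i) y)) + \<dots>
    = scaleQ (of_nat (Suc n)) (\<Sum>i\<le>Suc n. e i x * e (Suc n - i) y)"
    unfolding sum.distrib[symmetric] scaleQ_sum_right
    by (intro sum.cong refl) (simp add: of_nat_diff flip: scaleQ_add_left)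
  finally show ?case using scaleQ_cancel[of "of_nat (Suc n)"] unfolding e_def by simp
qed

lemma Exp_add:
  assumes x: "x \<in> K 1" and y: "y \<in> K 1"
  shows "Exp (x + y) = Exp x * Exp y"
proof -
  let ?e = "\<lambda>n z. scaleQ (1 / fact n) (Exp_arg z ^ n)"
  have "Exp x * Exp y = (\<Sum>\<^sub>\<infinity>(i, j)\<in>UNIV \<times> UNIV. ?e i x * ?e j y)"
    unfolding Exp_def
    by (rule infsum_product[symmetric, OF Exp_term_mem finite_sublevel_nat Exp_term_mem finite_sublevel_nat])
      (use x y in simp_all)
  also have "\<dots> = (\<Sum>\<^sub>\<infinity>n. \<Sum>p | p \<in> UNIV \<times> UNIV \<and> fst p + snd p = n. case p of (i, j) \<Rightarrow> ?e i x * ?e j y)"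
  proof (rule infsum_fibers[where w = id])
    show "finite {p \<in> UNIV \<times> UNIV. fst p + snd p = n}" for n :: nat
      by (rule finite_subset[of _ "{..n} \<times> {..n}"]) auto
  qed (use mult_mem[OF Exp_term_mem[OF x] Exp_term_mem[OF y]] in auto)
  also have "\<dots> = (\<Sum>\<^sub>\<infinity>n. ?e n (x + y))"
  proof (rule infsum_cong)
    fix n
    show "(\<Sum>p | p \<in> UNIV \<times> UNIV \<and> fst p + snd p = n. case p of (i, j) \<Rightarrow> ?e i x * ?e j y) = ?e n (x + y)"
      unfolding Exp_arg_add[OF x y] divided_power_add
      by (rule sum.reindex_bij_witness[of _ "\<lambda>i. (i, n - i)" fst]) auto
  qed
  finally show ?thesis by (simp add: Exp_def)
qed

end

section \<open>Homomorphisms and derivations applied to \<open>Exp\<close>\<close>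

locale graded_hom = graded_map +
  assumes one: "h 1 = 1"
    and mult: "x \<in> K 0 \<Longrightarrow> y \<in> K 0 \<Longrightarrow> h (x * y) = h x * h y"
    and psum: "x \<in> K 0 \<Longrightarrow> n \<ge> 1 \<Longrightarrow> h (psum n x) = psum n (h x)"
begin

lemma power: "x \<in> K 0 \<Longrightarrow> h (x ^ n) = h x ^ n"
  by (induction n) (use K.power_mem[of x 0] in \<open>auto simp: one mult\<close>)

lemma Exp_arg:
  assumes x: "x \<in> K 1"
  shows "h (Exp_arg x) = Exp_arg (h x)"
proof -
  have x0: "x \<in> K 0" using K.antimono[OF x] by simp
  have "h (Exp_arg x) = (\<Sum>\<^sub>\<infinity>k\<in>{1..}. h (scaleQ (1 / of_nat k) (psum k x)))"
    unfolding Exp_arg_def by (rule infsum[OF K.Exp_arg_term_mem K.finite_sublevel_ge_1]) (use x in simp_all)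
  also have "\<dots> = Exp_arg (h x)"
    unfolding Exp_arg_def
    by (rule infsum_cong) (use K.psum_mem[OF _ x0] in \<open>simp add: scaleQ psum x0\<close>)
  finally show ?thesis .
qed

lemma Exp:
  assumes x: "x \<in> K 1"
  shows "h (Exp x) = Exp (h x)"
proof -
  have x0: "Exp_arg x \<in> K 0" using K.antimono[OF K.Exp_arg_mem[OF x]] by simp
  have "h (Exp x) = (\<Sum>\<^sub>\<infinity>k. h (scaleQ (1 / fact k) (Exp_arg x ^ k)))"
    unfolding Exp_def by (rule infsum[OF K.Exp_term_mem K.finite_sublevel_nat]) (use x in simp_all)
  also have "\<dots> = Exp (h x)"
    unfolding Exp_def
    by (rule infsum_cong) (use K.power_mem[OF x0] in \<open>simp add: scaleQ power x0 flip: Exp_arg[OF x]\<close>)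
  finally show ?thesis .
qed

end

locale graded_derivation = graded_map K K d for K d +
  assumes leibniz: "d (x * y) = d x * y + x * d y"
    and d_add: "d (x + y) = d x + d y"
    and d_scaleQ: "d (scaleQ q x) = scaleQ q (d x)"
begin

lemma d_one: "d 1 = 0"
  using leibniz[of 1 1] by simp

lemma power: "d (x ^ Suc n) = scaleQ (of_nat (Suc n)) (d x * x ^ n)"
proof (induction n)
  case 0
  then show ?case by (simp add: scaleQ_one)
next
  case (Suc n)
  have "d (x ^ Suc (Suc n)) = d x * x ^ Suc n + scaleQ (of_nat (Suc n)) (d x * x ^ Suc n)"
    by (subst power_Suc, subst leibniz, subst Suc) (simp add: scaleQ_mult_right mult_ac)
  also have "\<dots> = scaleQ (1 + of_nat (Suc n)) (d x * x ^ Suc n)"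
    by (simp only: scaleQ_add_left scaleQ_one)
  finally show ?case by simp
qed

lemma Exp:
  assumes x: "x \<in> K 1"
  shows "d (Exp x) = d (Exp_arg x) * Exp x"
proof -
  let ?e = "\<lambda>n. scaleQ (1 / fact n) (Exp_arg x ^ n)"
  have "d (Exp_arg x) \<in> K 0" using K.antimono[OF map_mem[OF K.Exp_arg_mem[OF x]], of 0] by simp
  \<comment> \<open>Multiplication by \<open>d (Exp_arg x)\<close> preserves degrees, so it can be
    pulled out of the exponential series at the end.\<close>
  then interpret m: graded_map K K "\<lambda>z. d (Exp_arg x) * z"
    using K.mult_mem[of "d (Exp_arg x)" 0] by unfold_locales (auto simp: distrib_left scaleQ_mult_right)
  have Suc: "d (?e (Suc n)) = d (Exp_arg x) * ?e n" for n
    by (simp add: d_scaleQ power scaleQ_scaleQ scaleQ_mult_right del: power_Suc add: add_nonneg_eq_0_iff)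
  have "d (Exp x) = (\<Sum>\<^sub>\<infinity>n. d (?e n))"
    unfolding Exp_def by (rule infsum[OF K.Exp_term_mem K.finite_sublevel_nat]) (use x in simp_all)
  also have "\<dots> = (\<Sum>\<^sub>\<infinity>n\<in>range Suc. d (?e n))"
  proof (rule infsum_cong_neutral)
    fix n :: nat assume "n \<in> UNIV - range Suc"
    then have "n = 0" by (metis DiffD2 not0_implies_Suc rangeI)
    then show "d (?e n) = 0" by (simp add: scaleQ_one d_one)
  qed auto
  also have "\<dots> = (\<Sum>\<^sub>\<infinity>n. d (Exp_arg x) * ?e n)"
    by (subst infsum_reindex) (simp_all add: o_def Suc del: power_Suc fact_Suc)
  also have "\<dots> = d (Exp_arg x) * Exp x"
    unfolding Exp_def
    by (rule m.infsum[symmetric, OF K.Exp_term_mem K.finite_sublevel_nat]) (use x in simp_all)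
  finally show ?thesis .
qed

end

section \<open>Operations on symmetric series\<close>

text \<open>Formally \<open>p_M\<close> of the new alphabet gets degree -M. Therefore setting all
  \<open>p_M\<close> equal to 1 converges, and \<open>partial_deriv M\<close> raises the degree by
  M.\<close>

definition lift_filtration :: "(nat \<Rightarrow> 'a::zero set) \<Rightarrow> nat \<Rightarrow> 'a sym_series set" where
  "lift_filtration A n = {f. \<forall>\<mu>. sym_coeff f \<mu> \<in> A (n + sum_mset \<mu>)}"

lemma lift_filtrationI: "(\<And>\<mu>. sym_coeff f \<mu> \<in> A (n + sum_mset \<mu>)) \<Longrightarrow> f \<in> lift_filtration A n"
  and lift_filtrationD: "f \<in> lift_filtration A n \<Longrightarrow> sym_coeff f \<mu> \<in> A (n + sum_mset \<mu>)"
  by (auto simp: lift_filtration_def)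

lemma rat_filtration_lift:
  assumes "rat_filtration A"
  shows "rat_filtration (lift_filtration A)"
proof -
  interpret rat_filtration A by fact
  show ?thesis
    by unfold_locales (auto simp: lift_filtration_def zero_mem add_mem scaleQ_mem Suc_mem)
qed

lemma lift_filtration_mult:
  assumes C: "rat_filtration C" and mult: "\<And>i j x y. x \<in> A i \<Longrightarrow> y \<in> B j \<Longrightarrow> x * y \<in> C (i + j)"
    and f: "f \<in> lift_filtration A i" and g: "g \<in> lift_filtration B j"
  shows "f * g \<in> lift_filtration C (i + j)"
proof (rule lift_filtrationI)
  interpret C: rat_filtration C by fact
  fix \<mu>
  show "sym_coeff (f * g) \<mu> \<in> C (i + j + sum_mset \<mu>)"
    unfolding sym_coeff_mult
  proof (rule C.sum_mem, clarify)
    fix \<alpha> \<beta> assume "(\<alpha>, \<beta>) \<in> mset_splits \<mu>"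
    then have "\<mu> = \<alpha> + \<beta>" by (simp add: mset_splits_def)
    then show "sym_coeff f \<alpha> * sym_coeff g \<beta> \<in> C (i + j + sum_mset \<mu>)"
      using mult[OF lift_filtrationD[OF f, of \<alpha>] lift_filtrationD[OF g, of \<beta>]] by (simp add: ac_simps)
  qed
qed

lemma lift_filtration_psum:
  assumes B: "rat_filtration B" and g: "g \<ge> 1" and psum: "\<And>n x. x \<in> A n \<Longrightarrow> psum g x \<in> B (g * n)"
    and f: "f \<in> lift_filtration A n"
  shows "psum g f \<in> lift_filtration B (g * n)"
proof (rule lift_filtrationI)
  fix \<mu>
  show "sym_coeff (psum g f) \<mu> \<in> B (g * n + sum_mset \<mu>)"
  proof (cases "mset_divisible g \<mu>")
    case True
    then have "sum_mset \<mu> = g * sum_mset (mset_div g \<mu>)"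
      by (metis mset_dilate_div sum_mset_dilate)
    then show ?thesis
      using psum[OF lift_filtrationD[OF f, of "mset_div g \<mu>"]] True
      by (simp add: sym_coeff_psum[OF g] distrib_left)
  next
    case False
    then show ?thesis using rat_filtration.zero_mem[OF B] by (simp add: sym_coeff_psum[OF g])
  qed
qed

text \<open>This permits iteration: series in several alphabets are series whose coefficients are
  series. For \<open>null\<close>, note that \<open>filt k\<close> on series asks less of a
  coefficient the larger its partition is.\<close>

lemma graded_filtration_lift:
  assumes "graded_filtration K"
  shows "graded_filtration (lift_filtration K)"
proof -
  interpret K: graded_filtration K by fact
  interpret L: rat_filtration "lift_filtration K" by (rule rat_filtration_lift) unfold_locales
  show ?thesis
  proof
    show "1 \<in> lift_filtration K 0"
      by (rule lift_filtrationI) (auto simp: sym_coeff_one K.one_mem K.zero_mem)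
    show "x * y \<in> lift_filtration K (i + j)" if "x \<in> lift_filtration K i" "y \<in> lift_filtration K j" for x y i j
      using lift_filtration_mult[OF K.rat_filtration_axioms K.mult_mem that] .
    show "psum g x \<in> lift_filtration K (g * n)" if "g \<ge> 1" "x \<in> lift_filtration K n" for g n x
      using lift_filtration_psum[OF K.rat_filtration_axioms that(1) K.psum_mem that(2)] that(1) .
    show "x \<in> lift_filtration K n" if x: "\<And>k. \<exists>y\<in>lift_filtration K n. x - y \<in> filt k" for x n
    proof (rule lift_filtrationI)
      fix \<mu>
      show "sym_coeff x \<mu> \<in> K (n + sum_mset \<mu>)"
      proof (cases "\<mu> \<in> partitions")
        case True
        show ?thesis
        proof (rule K.closed)
          fix k
          from x[of "k + sum_mset \<mu>"] obtain y
            where y: "y \<in> lift_filtration K n" "x - y \<in> filt (k + sum_mset \<mu>)" by blast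
          then have "sym_coeff x \<mu> - sym_coeff y \<mu> \<in> filt k"
            using True by (auto simp: filt_sym_series_def dest!: bspec[of _ _ \<mu>])
          with lift_filtrationD[OF y(1)] show "\<exists>y\<in>K (n + sum_mset \<mu>). sym_coeff x \<mu> - y \<in> filt k" by blast
        qed
      qed (simp add: sym_coeff_outside K.zero_mem)
    qed
    show "\<exists>n. lift_filtration K n \<subseteq> filt k" for k
    proof -
      obtain n where n: "K n \<subseteq> filt k" using K.null by blast
      have "f \<in> filt k" if f: "f \<in> lift_filtration K n" for f
        unfolding filt_sym_series_def
      proof clarify
        fix \<mu>
        have "sym_coeff f \<mu> \<in> K n" by (rule K.antimono[OF lift_filtrationD[OF f]]) simp
        moreover have "(filt k :: 'a set) \<subseteq> filt (k - sum_mset \<mu>)" by (rule filt_antimono) simp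
        ultimately show "sym_coeff f \<mu> \<in> filt (k - sum_mset \<mu>)" using n by blast
      qed
      then show ?thesis by blast
    qed
  qed
qed

section \<open>Constant series and constant terms\<close>

definition constant_series :: "'a::zero \<Rightarrow> 'a sym_series" where
  "constant_series x = Abs_sym_series (\<lambda>\<mu>. if \<mu> = {#} then x else 0)"

lemma sym_coeff_constant: "sym_coeff (constant_series x) \<mu> = (if \<mu> = {#} then x else 0)"
  unfolding constant_series_def by (subst Abs_sym_series_inverse) (auto simp: empty_in_partitions)

lemma sym_coeff_constant_mult:
  fixes x :: "'a::comm_ring"
  shows "sym_coeff (constant_series x * f) \<mu> = x * sym_coeff f \<mu>"
proof -
  have "sym_coeff (constant_series x * f) \<mu> = (\<Sum>(\<alpha>, \<beta>)\<in>{({#}, \<mu>)}. sym_coeff (constant_series x) \<alpha> * sym_coeff f \<beta>)"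
    unfolding sym_coeff_mult
    by (rule sum.mono_neutral_right[OF finite_mset_splits])
      (auto simp: mset_splits_def sym_coeff_constant split: if_splits)
  then show ?thesis by (simp add: sym_coeff_constant)
qed

lemma sym_coeff_empty_mult:
  "sym_coeff (f * g) {#} = sym_coeff f {#} * (sym_coeff g {#} :: 'a::comm_ring)"
proof -
  have "mset_splits {#} = {({#} :: nat multiset, {#})}" by (auto simp: mset_splits_def)
  then show ?thesis by (simp add: sym_coeff_mult)
qed

lemma psum_constant: "n \<ge> 1 \<Longrightarrow> psum n (constant_series x) = constant_series (psum n x)"
  by (rule sym_series_eqI) (auto simp: sym_coeff_psum sym_coeff_constant psum_zero mset_divisible_def)

lemma sym_coeff_map_coeffs': "h 0 = 0 \<Longrightarrow> sym_coeff (map_coeffs h f) \<mu> = h (sym_coeff f \<mu>)"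
  by (cases "\<mu> \<in> partitions") (simp_all add: sym_coeff_map_coeffs sym_coeff_outside)

lemma lift_filtration_map_coeffs:
  assumes "h 0 = 0" "\<And>n x. x \<in> A n \<Longrightarrow> h x \<in> B (n + c)" "f \<in> lift_filtration A n"
  shows "map_coeffs h f \<in> lift_filtration B (n + c)"
  by (rule lift_filtrationI)
    (use assms(2)[OF lift_filtrationD[OF assms(3)]] in \<open>simp add: sym_coeff_map_coeffs' assms(1) ac_simps\<close>)

context graded_filtration
begin

lemma lift_mem_0: "f \<in> lift_filtration K n \<Longrightarrow> sym_coeff f \<mu> \<in> K 0"
  by (rule antimono[OF lift_filtrationD]) auto

lemma graded_hom_constant: "graded_hom K (lift_filtration K) constant_series"
proof -
  interpret L: graded_filtration "lift_filtration K" by (rule graded_filtration_lift) unfold_locales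
  show ?thesis
  proof
    show "constant_series (x * y) = constant_series x * constant_series y" for x y :: 'a
      by (rule sym_series_eqI) (simp add: sym_coeff_constant_mult sym_coeff_constant)
    show "constant_series (psum n x) = psum n (constant_series x)" if "n \<ge> 1" for n and x :: 'a
      using that by (simp add: psum_constant)
    show "constant_series 1 = (1 :: 'a sym_series)"
      by (rule sym_series_eqI) (simp add: sym_coeff_one sym_coeff_constant)
  qed (auto intro!: sym_series_eqI lift_filtrationI simp: sym_coeff_constant scaleQ_zero_right zero_mem)
qed

lemma graded_hom_constant_term: "graded_hom (lift_filtration K) K (\<lambda>f. sym_coeff f {#})"
proof -
  interpret L: graded_filtration "lift_filtration K" by (rule graded_filtration_lift) unfold_locales
  show ?thesis
  proof
    show "sym_coeff x {#} \<in> K n" if "x \<in> lift_filtration K n" for x n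
      using lift_filtrationD[OF that, of "{#}"] by simp
  qed (auto simp: sym_coeff_empty_mult sym_coeff_one sym_coeff_psum mset_divisible_def)
qed

end

section \<open>Coefficientwise extension of homomorphisms and derivations\<close>

lemma (in graded_hom) graded_hom_map_coeffs:
  "graded_hom (lift_filtration K) (lift_filtration K') (map_coeffs h)"
proof -
  interpret L: graded_filtration "lift_filtration K" by (rule graded_filtration_lift) unfold_locales
  interpret L': graded_filtration "lift_filtration K'" by (rule graded_filtration_lift) unfold_locales
  note [simp] = sym_coeff_map_coeffs'[of h, OF zero] K.lift_mem_0
  show ?thesis
  proof
    fix x y :: "'a sym_series" and n
    show "map_coeffs h x \<in> lift_filtration K' n" if "x \<in> lift_filtration K n"
      using lift_filtration_map_coeffs[of h K K' 0 x n] that map_mem by (simp add: zero)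
    show "map_coeffs h 1 = 1" by (rule sym_series_eqI) (simp add: sym_coeff_one one zero)
    show "map_coeffs h (x + y) = map_coeffs h x + map_coeffs h y"
      if "x \<in> lift_filtration K 0" "y \<in> lift_filtration K 0"
      using that by (intro sym_series_eqI) (simp add: add)
    show "map_coeffs h (scaleQ q x) = scaleQ q (map_coeffs h x)" if "x \<in> lift_filtration K 0" for q
      using that by (intro sym_series_eqI) (simp add: scaleQ)
    show "map_coeffs h (psum n x) = psum n (map_coeffs h x)" if "x \<in> lift_filtration K 0" "n \<ge> 1"
      using that by (intro sym_series_eqI) (auto simp: sym_coeff_psum psum zero)
    show "map_coeffs h (x * y) = map_coeffs h x * map_coeffs h y"
      if "x \<in> lift_filtration K 0" "y \<in> lift_filtration K 0"
    proof (rule sym_series_eqI)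
      fix \<mu>
      have "sym_coeff x \<alpha> * sym_coeff y \<beta> \<in> K 0" for \<alpha> \<beta>
        using K.mult_mem[OF K.lift_mem_0[OF that(1)] K.lift_mem_0[OF that(2)]] by simp
      then show "sym_coeff (map_coeffs h (x * y)) \<mu> = sym_coeff (map_coeffs h x * map_coeffs h y) \<mu>"
        using that by (simp add: sym_coeff_mult case_prod_unfold sum mult)
    qed
  qed
qed

lemma (in graded_derivation) graded_derivation_map_coeffs:
  "graded_derivation (lift_filtration K) (map_coeffs d)"
proof -
  interpret L: graded_filtration "lift_filtration K" by (rule graded_filtration_lift) unfold_locales
  note [simp] = sym_coeff_map_coeffs'[of d, OF zero]
  have dsum: "d (sum f A) = (\<Sum>i\<in>A. d (f i))" for f :: "'i \<Rightarrow> 'a" and A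
    by (induction A rule: infinite_finite_induct) (auto simp: zero d_add)
  show ?thesis
  proof
    fix x y :: "'a sym_series" and n
    show "map_coeffs d x \<in> lift_filtration K n" if "x \<in> lift_filtration K n"
      using lift_filtration_map_coeffs[of d K K 0 x n] that map_mem by (simp add: zero)
    show "map_coeffs d (x + y) = map_coeffs d x + map_coeffs d y"
      by (intro sym_series_eqI) (simp add: d_add)
    then show "map_coeffs d (x + y) = map_coeffs d x + map_coeffs d y" .
    show "map_coeffs d (scaleQ q x) = scaleQ q (map_coeffs d x)" for q
      by (intro sym_series_eqI) (simp add: d_scaleQ)
    then show "map_coeffs d (scaleQ q x) = scaleQ q (map_coeffs d x)" for q .
    show "map_coeffs d (x * y) = map_coeffs d x * y + x * map_coeffs d y"
      by (rule sym_series_eqI)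
        (simp add: sym_coeff_mult case_prod_unfold dsum leibniz sum.distrib)
  qed
qed

section \<open>Derivatives with respect to the power sums\<close>

text \<open>The power sums are treated as independent variables; the factor is the exponent of
  \<open>p_M\<close> in the monomial of \<open>add_mset M \<mu>\<close>.\<close>

definition partial_deriv :: "nat \<Rightarrow> 'a::rat_algebra sym_series \<Rightarrow> 'a sym_series" where
  "partial_deriv M f = Abs_sym_series (\<lambda>\<mu>. scaleQ (of_nat (Suc (count \<mu> M))) (sym_coeff f (add_mset M \<mu>)))"

lemma sym_coeff_partial_deriv:
  "sym_coeff (partial_deriv M f) \<mu> = scaleQ (of_nat (Suc (count \<mu> M))) (sym_coeff f (add_mset M \<mu>))"
  unfolding partial_deriv_def
  by (subst Abs_sym_series_inverse) (auto simp: sym_coeff_outside partitions_def scaleQ_zero_right)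

lemma lift_filtration_partial_deriv:
  assumes A: "rat_filtration A" and f: "f \<in> lift_filtration A n"
  shows "partial_deriv M f \<in> lift_filtration A (n + M)"
proof (rule lift_filtrationI)
  interpret rat_filtration A by fact
  fix \<mu>
  show "sym_coeff (partial_deriv M f) \<mu> \<in> A (n + M + sum_mset \<mu>)"
    unfolding sym_coeff_partial_deriv
    using scaleQ_mem[OF lift_filtrationD[OF f, of "add_mset M \<mu>"]] by (simp add: ac_simps)
qed

text \<open>The multiplicity of M in \<open>\<alpha> + \<beta>\<close> is the sum of the two
  multiplicities. The part weighted by the multiplicity in \<open>\<alpha>\<close> differentiates
  the first factor: terms without M vanish, in the others one M is removed. The other part follows
  by exchanging the factors.\<close>

lemma partial_deriv_mult:
  "partial_deriv M (f * g) = partial_deriv M f * g + f * partial_deriv M g"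
proof (rule sym_series_eqI)
  fix \<mu>
  have half: "(\<Sum>(\<alpha>, \<beta>)\<in>mset_splits (add_mset M \<mu>). scaleQ (of_nat (count \<alpha> M)) (sym_coeff f \<alpha> * sym_coeff g \<beta>))
      = sym_coeff (partial_deriv M f * g) \<mu>" (is "?l = _") for f g :: "'a sym_series"
  proof -
    have "?l = (\<Sum>(\<alpha>, \<beta>)\<in>{(\<alpha>, \<beta>)\<in>mset_splits (add_mset M \<mu>). M \<in># \<alpha>}.
        scaleQ (of_nat (count \<alpha> M)) (sym_coeff f \<alpha> * sym_coeff g \<beta>))"
      by (rule sum.mono_neutral_right[OF finite_mset_splits])
        (auto simp: scaleQ_zero_left intro!: count_inI)
    also have "\<dots> = sym_coeff (partial_deriv M f * g) \<mu>"
      unfolding sym_coeff_mult sym_coeff_partial_deriv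
    proof (rule sum.reindex_bij_witness[of _ "\<lambda>(\<alpha>, \<beta>). (add_mset M \<alpha>, \<beta>)" "\<lambda>(\<alpha>, \<beta>). (\<alpha> - {#M#}, \<beta>)"])
      fix p assume "p \<in> {(\<alpha>, \<beta>)\<in>mset_splits (add_mset M \<mu>). M \<in># \<alpha>}"
      then obtain \<alpha> \<beta> where p: "p = (add_mset M \<alpha>, \<beta>)" "add_mset M \<alpha> + \<beta> = add_mset M \<mu>"
        by (cases p) (auto simp: mset_splits_def dest!: multi_member_split)
      then show "(case case p of (\<alpha>, \<beta>) \<Rightarrow> (\<alpha> - {#M#}, \<beta>) of (\<alpha>, \<beta>) \<Rightarrow> (add_mset M \<alpha>, \<beta>)) = p"
        and "(case p of (\<alpha>, \<beta>) \<Rightarrow> (\<alpha> - {#M#}, \<beta>)) \<in> mset_splits \<mu>"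
        and "(case case p of (\<alpha>, \<beta>) \<Rightarrow> (\<alpha> - {#M#}, \<beta>) of (\<alpha>, \<beta>) \<Rightarrow>
            scaleQ (of_nat (Suc (count \<alpha> M))) (sym_coeff f (add_mset M \<alpha>)) * sym_coeff g \<beta>) =
          (case p of (\<alpha>, \<beta>) \<Rightarrow> scaleQ (of_nat (count \<alpha> M)) (sym_coeff f \<alpha> * sym_coeff g \<beta>))"
        by (auto simp: mset_splits_def scaleQ_mult_left)
    qed (auto simp: mset_splits_def)
    finally show ?thesis .
  qed
  have "sym_coeff (partial_deriv M (f * g)) \<mu> =
      (\<Sum>(\<alpha>, \<beta>)\<in>mset_splits (add_mset M \<mu>). scaleQ (of_nat (count \<alpha> M)) (sym_coeff f \<alpha> * sym_coeff g \<beta>)) +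
      (\<Sum>(\<alpha>, \<beta>)\<in>mset_splits (add_mset M \<mu>). scaleQ (of_nat (count \<beta> M)) (sym_coeff f \<alpha> * sym_coeff g \<beta>))"
    unfolding sym_coeff_partial_deriv sym_coeff_mult scaleQ_sum_right sum.distrib[symmetric]
  proof (rule sum.cong[OF refl], clarify)
    fix \<alpha> \<beta> assume "(\<alpha>, \<beta>) \<in> mset_splits (add_mset M \<mu>)"
    then have "\<alpha> + \<beta> = add_mset M \<mu>" by (simp add: mset_splits_def)
    then have "count (\<alpha> + \<beta>) M = Suc (count \<mu> M)" by simp
    then have "of_nat (Suc (count \<mu> M)) = (of_nat (count \<alpha> M) + of_nat (count \<beta> M) :: rat)"
      by (metis count_union of_nat_add)
    then show "scaleQ (of_nat (Suc (count \<mu> M))) (sym_coeff f \<alpha> * sym_coeff g \<beta>) =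
        scaleQ (of_nat (count \<alpha> M)) (sym_coeff f \<alpha> * sym_coeff g \<beta>) +
        scaleQ (of_nat (count \<beta> M)) (sym_coeff f \<alpha> * sym_coeff g \<beta>)"
      by (simp only: scaleQ_add_left)
  qed
  also have "(\<Sum>(\<alpha>, \<beta>)\<in>mset_splits (add_mset M \<mu>). scaleQ (of_nat (count \<beta> M)) (sym_coeff f \<alpha> * sym_coeff g \<beta>))
    = (\<Sum>(\<alpha>, \<beta>)\<in>mset_splits (add_mset M \<mu>). scaleQ (of_nat (count \<alpha> M)) (sym_coeff g \<alpha> * sym_coeff f \<beta>))"
    by (rule sum.reindex_bij_witness[of _ prod.swap prod.swap])
      (auto simp: mset_splits_def mult.commute add.commute)
  finally show "sym_coeff (partial_deriv M (f * g)) \<mu> = sym_coeff (partial_deriv M f * g + f * partial_deriv M g) \<mu>"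
    unfolding half by (simp add: mult.commute)
qed

text \<open>\<open>p_g\<close> substitutes the variable p_(gm) for p_m. Only these variables occur
  in p_g[f], and multiplicities are unchanged, so that no factor g appears.\<close>

lemma partial_deriv_psum:
  assumes g: "g \<ge> 1" and M: "M \<ge> 1"
  shows "partial_deriv M (psum g f) = (if g dvd M then psum g (partial_deriv (M div g) f) else 0)"
proof (rule sym_series_eqI)
  fix \<mu>
  show "sym_coeff (partial_deriv M (psum g f)) \<mu> =
      sym_coeff (if g dvd M then psum g (partial_deriv (M div g) f) else 0) \<mu>"
  proof (cases "g dvd M \<and> mset_divisible g \<mu>")
    case True
    define \<nu> m where "\<nu> = mset_div g \<mu>" and "m = M div g"
    have eq: "\<mu> = mset_dilate g \<nu>" "M = g * m"
      using True by (simp_all add: \<nu>_def m_def mset_dilate_div)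
    have "count \<mu> M = count \<nu> m"
      unfolding eq using g by (induction \<nu>) auto
    moreover have "mset_divisible g (add_mset M \<mu>)" using True by (simp add: mset_divisible_def)
    ultimately show ?thesis
      using True g by (simp add: sym_coeff_partial_deriv sym_coeff_psum psum_scaleQ \<nu>_def m_def del: of_nat_Suc)
  next
    case False
    then show ?thesis
      using g by (auto simp: sym_coeff_partial_deriv sym_coeff_psum mset_divisible_def scaleQ_zero_right)
  qed
qed

text \<open>\<open>d M\<close> plays the role of the derivative with respect to \<open>p\<^sub>M\<close> of some alphabet.\<close>

locale power_sum_derivations =
  fixes K :: "nat \<Rightarrow> 'a::complete_lambda_ring set" and d :: "nat \<Rightarrow> 'a \<Rightarrow> 'a"
  assumes derivation: "M \<ge> 1 \<Longrightarrow> graded_derivation K (d M)"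
    and d_psum: "g \<ge> 1 \<Longrightarrow> M \<ge> 1 \<Longrightarrow> d M (psum g x) = (if g dvd M then psum g (d (M div g) x) else 0)"

lemma (in power_sum_derivations) power_sum_derivations_map_coeffs:
  "power_sum_derivations (lift_filtration K) (\<lambda>M. map_coeffs (d M))"
proof (rule power_sum_derivations.intro)
  fix M g :: nat and x :: "'a sym_series"
  assume M: "M \<ge> 1"
  then show "graded_derivation (lift_filtration K) (map_coeffs (d M))"
    by (intro graded_derivation.graded_derivation_map_coeffs derivation)
  assume g: "g \<ge> 1"
  have d0: "d m 0 = 0" if "m \<ge> 1" for m
  proof -
    from that interpret graded_derivation K "d m" by (rule derivation)
    show ?thesis by (rule zero)
  qed
  have c: "sym_coeff (map_coeffs (d m) f) \<mu> = d m (sym_coeff f \<mu>)" if "m \<ge> 1" for m f \<mu>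
    using d0[OF that] by (rule sym_coeff_map_coeffs')
  have Mg: "g dvd M \<Longrightarrow> M div g \<ge> 1" using M g by (auto elim!: dvdE)
  show "map_coeffs (d M) (psum g x) = (if g dvd M then psum g (map_coeffs (d (M div g)) x) else 0)"
    by (rule sym_series_eqI)
      (auto simp: c[OF M] c[OF Mg] sym_coeff_psum[OF g] d_psum[OF g M] d0[OF M])
qed

lemma (in graded_filtration) power_sum_derivations_partial_deriv:
  "power_sum_derivations (lift_filtration K) partial_deriv"
proof (rule power_sum_derivations.intro)
  interpret L: graded_filtration "lift_filtration K" by (rule graded_filtration_lift) unfold_locales
  show "graded_derivation (lift_filtration K) (partial_deriv M)" for M
  proof
    fix x :: "'a sym_series" and n
    show "partial_deriv M x \<in> lift_filtration K n" if "x \<in> lift_filtration K n"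
      by (rule L.antimono[OF lift_filtration_partial_deriv]) (use that in \<open>auto intro: rat_filtration_axioms\<close>)
  qed (auto intro!: sym_series_eqI simp: sym_coeff_partial_deriv scaleQ_add_right scaleQ_scaleQ mult.commute
      partial_deriv_mult simp del: of_nat_Suc)
qed (rule partial_deriv_psum)

section \<open>The degree operator\<close>

text \<open>Applied in the third alphabet, it is t d/dt for the rescaling of p_M[T] to t^M p_M[T],
  the time of the flow.\<close>

definition euler :: "'a::rat_algebra sym_series \<Rightarrow> 'a sym_series" where
  "euler f = Abs_sym_series (\<lambda>\<mu>. scaleQ (of_nat (sum_mset \<mu>)) (sym_coeff f \<mu>))"

lemma sym_coeff_euler: "sym_coeff (euler f) \<mu> = scaleQ (of_nat (sum_mset \<mu>)) (sym_coeff f \<mu>)"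
  unfolding euler_def by (subst Abs_sym_series_inverse) (auto simp: sym_coeff_outside scaleQ_zero_right)

lemma euler_mult: "euler (f * g) = euler f * g + f * euler g"
proof (rule sym_series_eqI)
  fix \<mu>
  show "sym_coeff (euler (f * g)) \<mu> = sym_coeff (euler f * g + f * euler g) \<mu>"
    unfolding sym_coeff_euler sym_coeff_add sym_coeff_mult scaleQ_sum_right sum.distrib[symmetric]
    by (rule sum.cong[OF refl])
      (auto simp: mset_splits_def scaleQ_mult_left scaleQ_mult_right scaleQ_add_left)
qed

text \<open>Dilation by n multiplies degrees by n. This factor cancels the 1/n in
  \<open>Exp_arg\<close>.\<close>

lemma euler_psum:
  assumes n: "n \<ge> 1"
  shows "euler (psum n f) = scaleQ (of_nat n) (psum n (euler f))"
proof (rule sym_series_eqI)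
  fix \<mu>
  have "sum_mset \<mu> = n * sum_mset (mset_div n \<mu>)" if "mset_divisible n \<mu>"
    using that by (metis mset_dilate_div sum_mset_dilate)
  then show "sym_coeff (euler (psum n f)) \<mu> = sym_coeff (scaleQ (of_nat n) (psum n (euler f))) \<mu>"
    by (auto simp: sym_coeff_euler sym_coeff_psum[OF n] psum_scaleQ[OF n] scaleQ_scaleQ scaleQ_zero_right
        simp del: of_nat_sum_mset)
qed

lemma (in graded_filtration) graded_derivation_euler: "graded_derivation (lift_filtration K) euler"
proof -
  interpret L: graded_filtration "lift_filtration K" by (rule graded_filtration_lift) unfold_locales
  show ?thesis
    by unfold_locales
      (auto intro!: sym_series_eqI lift_filtrationI scaleQ_mem dest: lift_filtrationD
        simp: sym_coeff_euler scaleQ_add_right scaleQ_scaleQ mult.commute euler_mult)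
qed

text \<open>\<open>\<Sum>\<^sub>M p\<^sub>M[X] G\<^sub>M\<close>\<close>

definition psum_combination :: "(nat \<Rightarrow> 'a::comm_ring sym_series) \<Rightarrow> 'a sym_series" where
  "psum_combination G = Abs_sym_series (\<lambda>\<mu>. if \<mu> \<in> partitions
     then \<Sum>M\<in>set_mset \<mu>. sym_coeff (G M) (\<mu> - {#M#}) else 0)"

lemma sym_coeff_psum_combination:
  "\<mu> \<in> partitions \<Longrightarrow> sym_coeff (psum_combination G) \<mu> = (\<Sum>M\<in>set_mset \<mu>. sym_coeff (G M) (\<mu> - {#M#}))"
  unfolding psum_combination_def by (subst Abs_sym_series_inverse) auto

lemma partitions_pos: "\<mu> \<in> partitions \<Longrightarrow> M \<in># \<mu> \<Longrightarrow> M \<ge> 1"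
  by (metis partitions_def One_nat_def Suc_leI gr0I mem_Collect_eq)

lemma psum_combination_cong:
  "(\<And>M. M \<ge> 1 \<Longrightarrow> G M = H M) \<Longrightarrow> psum_combination G = psum_combination H"
  by (rule sym_series_eqI') (metis (no_types, lifting) sym_coeff_psum_combination partitions_pos sum.cong)

lemma psum_combination_diff:
  "psum_combination G - psum_combination H = psum_combination (\<lambda>M. G M - H M)"
  by (rule sym_series_eqI') (simp add: sym_coeff_psum_combination sum_subtractf)

lemma psum_combination_sum:
  "(\<Sum>i\<in>I. psum_combination (G i)) = psum_combination (\<lambda>M. \<Sum>i\<in>I. G i M)"
proof (induction I rule: infinite_finite_induct)
  case (insert i I)
  then show ?case
    by (auto intro!: sym_series_eqI' simp: sym_coeff_psum_combination sum.distrib)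
qed (auto intro!: sym_series_eqI' simp: sym_coeff_psum_combination)

lemma lift_filtration_psum_combination:
  assumes A: "rat_filtration A" and G: "\<And>M. M \<ge> 1 \<Longrightarrow> G M \<in> lift_filtration A (n + M)"
  shows "psum_combination G \<in> lift_filtration A n"
proof (rule lift_filtrationI)
  interpret rat_filtration A by fact
  fix \<mu>
  show "sym_coeff (psum_combination G) \<mu> \<in> A (n + sum_mset \<mu>)"
  proof (cases "\<mu> \<in> partitions")
    case True
    have "sym_coeff (G M) (\<mu> - {#M#}) \<in> A (n + sum_mset \<mu>)" if "M \<in># \<mu>" for M
      using lift_filtrationD[OF G[OF partitions_pos[OF True that]], of "\<mu> - {#M#}"]
        sum_mset.remove[OF that] by (simp add: ac_simps)
    then show ?thesis by (simp add: sym_coeff_psum_combination True sum_mem)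
  qed (simp add: sym_coeff_outside zero_mem)
qed

text \<open>Choosing a part M of \<open>\<alpha>\<close> after splitting \<open>\<mu>\<close> into
  \<open>\<alpha>\<close> and \<open>\<beta>\<close> is the same as removing M from
  \<open>\<mu>\<close> first and splitting the rest.\<close>

lemma psum_combination_mult: "psum_combination G * f = psum_combination (\<lambda>M. G M * f)"
proof (rule sym_series_eqI')
  fix \<mu> assume \<mu>: "\<mu> \<in> partitions"
  have "sym_coeff (psum_combination G * f) \<mu> =
      (\<Sum>(\<alpha>, \<beta>)\<in>mset_splits \<mu>. \<Sum>M\<in>set_mset \<alpha>. sym_coeff (G M) (\<alpha> - {#M#}) * sym_coeff f \<beta>)"
    unfolding sym_coeff_mult
    by (rule sum.cong[OF refl])
      (use \<mu> in \<open>auto simp: mset_splits_def sym_coeff_psum_combination plus_in_partitions_iff sum_distrib_right\<close>)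
  also have "\<dots> = (\<Sum>((\<alpha>, \<beta>), M)\<in>Sigma (mset_splits \<mu>) (\<lambda>(\<alpha>, \<beta>). set_mset \<alpha>). sym_coeff (G M) (\<alpha> - {#M#}) * sym_coeff f \<beta>)"
    by (subst sum.Sigma[symmetric]) (auto simp: finite_mset_splits case_prod_unfold)
  also have "\<dots> = (\<Sum>(M, (\<alpha>, \<beta>))\<in>Sigma (set_mset \<mu>) (\<lambda>M. mset_splits (\<mu> - {#M#})). sym_coeff (G M) \<alpha> * sym_coeff f \<beta>)"
    by (rule sum.reindex_bij_witness[of _
          "\<lambda>(M, (\<alpha>, \<beta>)). ((add_mset M \<alpha>, \<beta>), M)" "\<lambda>((\<alpha>, \<beta>), M). (M, (\<alpha> - {#M#}, \<beta>))"])
      (auto simp: mset_splits_def dest!: multi_member_split)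
  also have "\<dots> = sym_coeff (psum_combination (\<lambda>M. G M * f)) \<mu>"
    unfolding sym_coeff_psum_combination[OF \<mu>] sym_coeff_mult
    by (subst sum.Sigma[symmetric]) (auto simp: finite_mset_splits case_prod_unfold)
  finally show "sym_coeff (psum_combination G * f) \<mu> = sym_coeff (psum_combination (\<lambda>M. G M * f)) \<mu>" .
qed

text \<open>\<open>p_g\<close> sends p_m[X] G_m to p_(gm)[X] p_g[G_m], so the new coefficients sit
  at the multiples of g.\<close>

lemma psum_psum_combination:
  assumes g: "g \<ge> 1"
  shows "psum g (psum_combination G) = psum_combination (\<lambda>M. if g dvd M then psum g (G (M div g)) else 0)"
proof (rule sym_series_eqI')
  fix \<mu> assume \<mu>: "\<mu> \<in> partitions"
  show "sym_coeff (psum g (psum_combination G)) \<mu> =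
      sym_coeff (psum_combination (\<lambda>M. if g dvd M then psum g (G (M div g)) else 0)) \<mu>"
  proof (cases "mset_divisible g \<mu>")
    case True
    define \<nu> where "\<nu> = mset_div g \<mu>"
    have eq: "\<mu> = mset_dilate g \<nu>" using True by (simp add: \<nu>_def mset_dilate_div)
    have \<nu>: "\<nu> \<in> partitions" using \<mu> g unfolding eq by (simp add: mset_dilate_in_partitions)
    have inj: "inj_on ((*) g) (set_mset \<nu>)" using g by (auto simp: inj_on_def)
    have div: "mset_divisible g \<mu>" "mset_div g \<mu> = \<nu>" by (simp_all add: True \<nu>_def)
    have "sym_coeff (psum g (psum_combination G)) \<mu> = (\<Sum>M\<in>set_mset \<nu>. psum g (sym_coeff (G M) (\<nu> - {#M#})))"
      by (simp add: sym_coeff_psum[OF g] div sym_coeff_psum_combination[OF \<nu>] psum_sum[OF g])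
    also have "\<dots> = (\<Sum>M\<in>set_mset \<mu>. sym_coeff (if g dvd M then psum g (G (M div g)) else 0) (\<mu> - {#M#}))"
    proof (subst (2) eq, subst set_image_mset, subst sum.reindex[OF inj], rule sum.cong[OF refl])
      fix M assume "M \<in># \<nu>"
      then have "\<mu> - {#g * M#} = mset_dilate g (\<nu> - {#M#})"
        unfolding eq by (simp add: image_mset_Diff)
      then show "psum g (sym_coeff (G M) (\<nu> - {#M#})) =
          ((\<lambda>M. sym_coeff (if g dvd M then psum g (G (M div g)) else 0) (\<mu> - {#M#})) \<circ> (*) g) M"
        using g by (simp add: sym_coeff_psum mset_divisible_dilate mset_div_dilate)
    qed
    finally show ?thesis by (simp add: sym_coeff_psum_combination[OF \<mu>])
  next
    case False
    have "sym_coeff (if g dvd M then psum g (G (M div g)) else 0) (\<mu> - {#M#}) = 0" if "M \<in># \<mu>" for M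
    proof (cases "g dvd M")
      case True
      from False obtain m where "m \<in># \<mu>" "\<not> g dvd m" by (auto simp: mset_divisible_def)
      with True have "m \<in># \<mu> - {#M#}" by (auto simp: in_diff_count)
      with \<open>\<not> g dvd m\<close> have "\<not> mset_divisible g (\<mu> - {#M#})"
        by (auto simp: mset_divisible_def)
      then show ?thesis by (simp add: sym_coeff_psum[OF g])
    qed simp
    with False show ?thesis by (simp add: sym_coeff_psum_combination[OF \<mu>] sym_coeff_psum[OF g])
  qed
qed

section \<open>Specialization at the alphabet 1\<close>

text \<open>For the alphabet consisting of the single variable 1 every power sum is 1, which leaves
  the sum of the coefficients.\<close>

definition specialize_one :: "'a::complete_lambda_ring sym_series \<Rightarrow> 'a" where
  "specialize_one f = (\<Sum>\<^sub>\<infinity>\<mu>\<in>partitions. sym_coeff f \<mu>)"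

lemma finite_partitions_less: "finite {\<mu> \<in> partitions. sum_mset \<mu> < N}"
  by (rule finite_subset[OF _ finite_partitions_le[of N]]) auto

context graded_filtration
begin

lemma lift_coeff_mem: "f \<in> lift_filtration K n \<Longrightarrow> \<mu> \<in> partitions \<Longrightarrow> sym_coeff f \<mu> \<in> K (sum_mset \<mu>)"
  by (rule antimono[OF lift_filtrationD]) auto

lemma graded_map_psum: "n \<ge> 1 \<Longrightarrow> graded_map K K (psum n)"
  by unfold_locales (auto simp: psum_add psum_scaleQ intro: antimono[OF psum_mem])

text \<open>For products, pairs of partitions are grouped by their union. For \<open>p_n\<close>,
  the dilated partitions carry all coefficients of \<open>psum n x\<close>, and dilating an index
  does not affect the value 1 of its power sum.\<close>

lemma graded_hom_specialize_one: "graded_hom (lift_filtration K) K specialize_one"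
proof -
  interpret L: graded_filtration "lift_filtration K" by (rule graded_filtration_lift) unfold_locales
  note fin = finite_partitions_less
  note summable = summable[OF lift_coeff_mem fin]
  show ?thesis
  proof
    fix x y :: "'a sym_series" and n :: nat and q :: rat
    show "specialize_one x \<in> K n" if "x \<in> lift_filtration K n"
      unfolding specialize_one_def
      by (rule infsum_mem[OF lift_coeff_mem fin])
        (use that in \<open>auto intro: antimono[OF lift_filtrationD]\<close>)
    show "specialize_one (1 :: 'a sym_series) = 1"
    proof -
      have "specialize_one (1 :: 'a sym_series) = (\<Sum>\<^sub>\<infinity>\<mu>\<in>{{#}}. sym_coeff (1 :: 'a sym_series) \<mu>)"
        unfolding specialize_one_def
        by (rule infsum_cong_neutral) (auto simp: sym_coeff_one empty_in_partitions)
      then show ?thesis by (simp add: sym_coeff_one)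
    qed
    assume x: "x \<in> lift_filtration K 0"
    show "specialize_one (scaleQ q x) = scaleQ q (specialize_one x)"
    proof -
      interpret s: graded_map K K "scaleQ q"
        by unfold_locales (auto simp: scaleQ_add_right scaleQ_scaleQ mult.commute scaleQ_mem)
      show ?thesis
        unfolding specialize_one_def using x by (subst s.infsum[OF lift_coeff_mem fin]) (auto intro!: infsum_cong)
    qed
    show "specialize_one (psum n x) = psum n (specialize_one x)" if n: "n \<ge> 1"
    proof -
      interpret p: graded_map K K "psum n" by (rule graded_map_psum[OF n])
      have inj: "inj_on (mset_dilate n) partitions"
        using mset_div_dilate[OF n] by (rule inj_on_inverseI)
      have "specialize_one (psum n x) = (\<Sum>\<^sub>\<infinity>\<mu>\<in>mset_dilate n ` partitions. sym_coeff (psum n x) \<mu>)"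
        unfolding specialize_one_def
      proof (rule infsum_cong_neutral)
        fix \<mu> assume \<mu>: "\<mu> \<in> partitions - mset_dilate n ` partitions"
        then have "\<not> mset_divisible n \<mu>"
          by (metis DiffE imageI mset_dilate_div mset_div_in_partitions n)
        then show "sym_coeff (psum n x) \<mu> = 0" by (simp add: sym_coeff_psum[OF n])
      qed (use n in \<open>auto simp: mset_dilate_in_partitions\<close>)
      also have "\<dots> = (\<Sum>\<^sub>\<infinity>\<mu>\<in>partitions. psum n (sym_coeff x \<mu>))"
        by (simp add: infsum_reindex[OF inj] o_def sym_coeff_psum[OF n] mset_divisible_dilate mset_div_dilate[OF n])
      also have "\<dots> = psum n (specialize_one x)"
        unfolding specialize_one_def using x by (subst p.infsum[OF lift_coeff_mem fin]) auto
      finally show ?thesis .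
    qed
    assume y: "y \<in> lift_filtration K 0"
    show "specialize_one (x + y) = specialize_one x + specialize_one y"
      unfolding specialize_one_def sym_coeff_add
      by (rule infsum_add[OF summable[OF x] summable[OF y]])
    show "specialize_one (x * y) = specialize_one x * specialize_one y"
    proof -
      have "specialize_one x * specialize_one y
        = (\<Sum>\<^sub>\<infinity>(\<alpha>, \<beta>)\<in>partitions \<times> partitions. sym_coeff x \<alpha> * sym_coeff y \<beta>)"
        unfolding specialize_one_def
        by (rule infsum_product[symmetric, OF lift_coeff_mem[OF x] fin lift_coeff_mem[OF y] fin])
      also have "\<dots> = (\<Sum>\<^sub>\<infinity>\<mu>\<in>partitions. \<Sum>p | p \<in> partitions \<times> partitions \<and> fst p + snd p = \<mu>.
          case p of (\<alpha>, \<beta>) \<Rightarrow> sym_coeff x \<alpha> * sym_coeff y \<beta>)"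
      proof (rule infsum_fibers[where w = sum_mset, OF _ _ _ fin])
        show "finite {p \<in> partitions \<times> partitions. fst p + snd p = \<mu>}" for \<mu>
          by (rule finite_subset[OF _ finite_mset_splits[of \<mu>]]) (auto simp: mset_splits_def)
      qed (auto simp: plus_in_partitions_iff intro!: mult_mem lift_coeff_mem[OF x] lift_coeff_mem[OF y])
      also have "\<dots> = specialize_one (x * y)"
        unfolding specialize_one_def
      proof (rule infsum_cong)
        fix \<mu> assume "\<mu> \<in> partitions"
        then have "{p \<in> partitions \<times> partitions. fst p + snd p = \<mu>} = mset_splits \<mu>"
          by (auto simp: mset_splits_def plus_in_partitions_iff)
        then show "(\<Sum>p | p \<in> partitions \<times> partitions \<and> fst p + snd p = \<mu>.
            case p of (\<alpha>, \<beta>) \<Rightarrow> sym_coeff x \<alpha> * sym_coeff y \<beta>) = sym_coeff (x * y) \<mu>"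
          by (simp add: sym_coeff_mult)
      qed
      finally show ?thesis ..
    qed
  qed
qed

end

section \<open>Fixed points of degree-raising operators\<close>

definition agree_below :: "nat \<Rightarrow> 'a::zero sym_series \<Rightarrow> 'a sym_series \<Rightarrow> bool" where
  "agree_below n f g \<longleftrightarrow> (\<forall>\<mu>. sum_mset \<mu> < n \<longrightarrow> sym_coeff f \<mu> = sym_coeff g \<mu>)"

lemma agree_below_refl [simp]: "agree_below n f f"
  by (simp add: agree_below_def)

lemma agree_below_add:
  "agree_below n f f' \<Longrightarrow> agree_below n g g' \<Longrightarrow> agree_below n (f + g) (f' + g')"
  by (simp add: agree_below_def)

lemma agree_below_scaleQ: "agree_below n f f' \<Longrightarrow> agree_below n (scaleQ q f) (scaleQ q f')"
  by (simp add: agree_below_def)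

lemma agree_below_sum:
  "(\<And>i. i \<in> I \<Longrightarrow> agree_below n (f i) (g i)) \<Longrightarrow> agree_below n (sum f I) (sum g I)"
  by (induction I rule: infinite_finite_induct) (auto intro: agree_below_add)

lemma agree_below_mult:
  assumes "agree_below n f f'" "agree_below n g g'"
  shows "agree_below n (f * g) (f' * g')"
  unfolding agree_below_def sym_coeff_mult
proof (intro allI impI sum.cong refl, clarify)
  fix \<mu> \<alpha> \<beta> :: "nat multiset" assume "sum_mset \<mu> < n" "(\<alpha>, \<beta>) \<in> mset_splits \<mu>"
  then have "sum_mset \<alpha> < n" "sum_mset \<beta> < n" by (auto simp: mset_splits_def)
  with assms show "sym_coeff f \<alpha> * sym_coeff g \<beta> = sym_coeff f' \<alpha> * sym_coeff g' \<beta>"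
    by (simp add: agree_below_def)
qed

lemma agree_below_psum:
  assumes "agree_below n f f'" "g \<ge> 1"
  shows "agree_below n (psum g f) (psum g f')"
  unfolding agree_below_def sym_coeff_psum[OF assms(2)]
proof (intro allI impI)
  fix \<mu> :: "nat multiset" assume \<mu>: "sum_mset \<mu> < n"
  have "sum_mset (mset_div g \<mu>) \<le> sum_mset \<mu>" by (induction \<mu>) (auto intro!: add_mono)
  with \<mu> have "sym_coeff f (mset_div g \<mu>) = sym_coeff f' (mset_div g \<mu>)"
    using assms(1) unfolding agree_below_def by (meson le_less_trans)
  then show "(if mset_divisible g \<mu> then psum g (sym_coeff f (mset_div g \<mu>)) else 0) =
      (if mset_divisible g \<mu> then psum g (sym_coeff f' (mset_div g \<mu>)) else 0)"
    by simp
qed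

lemma agree_below_map_coeffs:
  "agree_below n f g \<Longrightarrow> h 0 = 0 \<Longrightarrow> agree_below n (map_coeffs h f) (map_coeffs h g)"
  by (simp add: agree_below_def sym_coeff_map_coeffs')

lemma agree_below_psum_combination:
  assumes "\<And>M. M \<ge> 1 \<Longrightarrow> agree_below n (G M) (H M)"
  shows "agree_below (Suc n) (psum_combination G) (psum_combination H)"
  unfolding agree_below_def
proof (intro allI impI)
  fix \<mu> assume \<mu>: "sum_mset \<mu> < Suc n"
  show "sym_coeff (psum_combination G) \<mu> = sym_coeff (psum_combination H) \<mu>"
  proof (cases "\<mu> \<in> partitions")
    case True
    have "sym_coeff (G M) (\<mu> - {#M#}) = sym_coeff (H M) (\<mu> - {#M#})" if M: "M \<in># \<mu>" for M
    proof -
      have "M \<ge> 1" by (rule partitions_pos[OF True M])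
      moreover from this have "sum_mset (\<mu> - {#M#}) < n"
        using \<mu> sum_mset.remove[OF M] by simp
      ultimately show ?thesis using assms by (simp add: agree_below_def)
    qed
    then show ?thesis by (simp add: sym_coeff_psum_combination True)
  qed (simp add: sym_coeff_outside)
qed

text \<open>A contraction argument: the n-th iterate starting at 0 is already correct in all degrees
  below n.\<close>

lemma fixed_point_exists:
  assumes \<Phi>: "\<And>n f g. agree_below n f g \<Longrightarrow> agree_below (Suc n) (\<Phi> f) (\<Phi> g)"
  shows "\<exists>f :: 'a::comm_ring sym_series. \<Phi> f = f"
proof -
  define F where "F = (\<lambda>n. (\<Phi> ^^ n) 0)"
  have F: "F (Suc n) = \<Phi> (F n)" for n by (simp add: F_def)
  have stable: "agree_below n (F n) (F (n + k))" for n k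
  proof (induction n)
    case (Suc n)
    from \<Phi>[OF this] show ?case by (simp add: F)
  qed (simp add: agree_below_def)
  \<comment> \<open>Iterate number |\<mu>| + 1 is the first one at which stability is guaranteed in
    degree |\<mu>|.\<close>
  define f where "f = Abs_sym_series (\<lambda>\<mu>. sym_coeff (F (Suc (sum_mset \<mu>))) \<mu>)"
  have f: "sym_coeff f \<mu> = sym_coeff (F (Suc (sum_mset \<mu>))) \<mu>" for \<mu>
    unfolding f_def by (subst Abs_sym_series_inverse) (simp_all add: sym_coeff_outside)
  have agree: "agree_below n f (F n)" for n
    unfolding agree_below_def
  proof (intro allI impI)
    fix \<mu> assume "sum_mset \<mu> < n"
    then obtain k where "n = Suc (sum_mset \<mu>) + k" using less_iff_Suc_add by auto
    with stable[of "Suc (sum_mset \<mu>)" k] show "sym_coeff f \<mu> = sym_coeff (F n) \<mu>"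
      by (simp add: f agree_below_def)
  qed
  have "sym_coeff (\<Phi> f) \<mu> = sym_coeff f \<mu>" for \<mu>
    using \<Phi>[OF agree, of "sum_mset \<mu>"] agree[of "Suc (sum_mset \<mu>)"] by (simp add: agree_below_def F)
  then have "\<Phi> f = f" by (rule sym_series_eqI)
  then show ?thesis ..
qed

text \<open>Each coefficient of \<open>f\<close> already occurs in a finite iterate, so membership
  is inherited exactly, without a passage to the closure. This keeps the coefficients in (1/S)
  \<Lambda>.\<close>

lemma fixed_point_mem_lift:
  assumes \<Phi>: "\<And>n f g. agree_below n f g \<Longrightarrow> agree_below (Suc n) (\<Phi> f) (\<Phi> g)"
    and A: "rat_filtration A" and inv: "\<And>f. f \<in> lift_filtration A m \<Longrightarrow> \<Phi> f \<in> lift_filtration A m"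
    and f: "\<Phi> f = f"
  shows "f \<in> lift_filtration A m"
proof (rule lift_filtrationI)
  interpret L: rat_filtration "lift_filtration A" by (rule rat_filtration_lift[OF A])
  fix \<mu>
  have mem: "(\<Phi> ^^ n) 0 \<in> lift_filtration A m" for n
    by (induction n) (auto simp: L.zero_mem inv)
  have "agree_below n ((\<Phi> ^^ n) 0) f" for n
  proof (induction n)
    case (Suc n)
    from \<Phi>[OF this] show ?case by (simp add: f)
  qed (simp add: agree_below_def)
  then have "sym_coeff ((\<Phi> ^^ Suc (sum_mset \<mu>)) 0) \<mu> = sym_coeff f \<mu>"
    unfolding agree_below_def by blast
  with lift_filtrationD[OF mem, of "Suc (sum_mset \<mu>)" \<mu>]
  show "sym_coeff f \<mu> \<in> A (m + sum_mset \<mu>)" by (simp del: funpow.simps)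
qed

section \<open>The flow equation\<close>

text \<open>By \<open>d_psum\<close> the derivative with respect to \<open>p_M\<close> kills p_g[x]
  unless g divides M; the infinite sum becomes finite.\<close>

lemma (in power_sum_derivations) d_Exp_arg:
  assumes x: "x \<in> K 1" and M: "M \<ge> 1"
  shows "d M (Exp_arg x) = (\<Sum>g | g dvd M. scaleQ (1 / of_nat g) (d M (psum g x)))"
proof -
  interpret graded_derivation K "d M" by (rule derivation[OF M])
  have "d M (Exp_arg x) = (\<Sum>\<^sub>\<infinity>g\<in>{1..}. d M (scaleQ (1 / of_nat g) (psum g x)))"
    unfolding Exp_arg_def by (rule infsum[OF K.Exp_arg_term_mem[OF x] K.finite_sublevel_ge_1])
  also have "\<dots> = (\<Sum>\<^sub>\<infinity>g\<in>{g. g dvd M}. scaleQ (1 / of_nat g) (d M (psum g x)))"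
    by (rule infsum_cong_neutral)
      (use M in \<open>auto simp: d_scaleQ d_psum scaleQ_zero_right intro: Suc_leI dvd_pos_nat\<close>)
  also have "\<dots> = (\<Sum>g | g dvd M. scaleQ (1 / of_nat g) (d M (psum g x)))"
    using M by (intro infsum_finite) (simp add: finite_divisors_nat)
  finally show ?thesis .
qed

section \<open>Two divisor sums\<close>

text \<open>A pair (a, b) of divisors of M is (k g, k h) with g and h coprime for exactly one k,
  namely gcd a b.\<close>

lemma sum_divisors_coprime_pairs:
  fixes P :: "nat \<Rightarrow> nat \<Rightarrow> 'c::comm_monoid_add"
  assumes M: "M \<ge> 1"
  shows "(\<Sum>k | k dvd M. \<Sum>(g, h) | g dvd M div k \<and> h dvd M div k \<and> coprime g h. P (k * g) (k * h)) =
    (\<Sum>a | a dvd M. \<Sum>b | b dvd M. P a b)"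
proof -
  have fin: "finite {k. k dvd M}" using M by (simp add: finite_divisors_nat)
  have pos: "M div k > 0" if "k dvd M" for k using that M by (auto elim!: dvdE)
  have fin': "finite {(g, h). g dvd M div k \<and> h dvd M div k \<and> coprime g h}" if "k dvd M" for k
    by (rule finite_subset[of _ "{g. g dvd M div k} \<times> {h. h dvd M div k}"])
      (use pos[OF that] in \<open>auto simp: finite_divisors_nat\<close>)
  have "(\<Sum>k | k dvd M. \<Sum>(g, h) | g dvd M div k \<and> h dvd M div k \<and> coprime g h. P (k * g) (k * h)) =
     (\<Sum>(k, g, h)\<in>Sigma {k. k dvd M} (\<lambda>k. {(g, h). g dvd M div k \<and> h dvd M div k \<and> coprime g h}). P (k * g) (k * h))"
    using fin fin' by (subst sum.Sigma) (auto simp: case_prod_unfold)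
  also have "\<dots> = (\<Sum>(a, b)\<in>{a. a dvd M} \<times> {b. b dvd M}. P a b)"
  proof (rule sum.reindex_bij_witness[of _
        "\<lambda>(a, b). (gcd a b, a div gcd a b, b div gcd a b)" "\<lambda>(k, g, h). (k * g, k * h)"])
    fix p assume p: "p \<in> Sigma {k. k dvd M} (\<lambda>k. {(g, h). g dvd M div k \<and> h dvd M div k \<and> coprime g h})"
    obtain k g h where kgh: "p = (k, g, h)" by (cases p) auto
    from p have *: "k dvd M" "g dvd M div k" "h dvd M div k" "coprime g h" by (auto simp: kgh)
    from *(1) M have "k > 0" by (auto intro: Nat.gr0I)
    moreover from *(4) have "gcd (k * g) (k * h) = k"
      by (simp add: gcd_mult_distrib_nat[symmetric] coprime_imp_gcd_eq_1)
    ultimately show "(case case p of (k, g, h) \<Rightarrow> (k * g, k * h) of (a, b) \<Rightarrow> (gcd a b, a div gcd a b, b div gcd a b)) = p"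
      by (simp add: kgh)
    show "(case p of (k, g, h) \<Rightarrow> (k * g, k * h)) \<in> {a. a dvd M} \<times> {b. b dvd M}"
      using * \<open>k > 0\<close> by (auto simp: kgh dvd_div_iff_mult mult.commute)
    show "(case case p of (k, g, h) \<Rightarrow> (k * g, k * h) of (a, b) \<Rightarrow> P a b) = (case p of (k, g, h) \<Rightarrow> P (k * g) (k * h))"
      by (simp add: kgh)
  next
    fix p assume "p \<in> {a. a dvd M} \<times> {b. b dvd M}"
    then obtain a b where ab: "p = (a, b)" "a dvd M" "b dvd M" by auto
    with M have "a > 0" "b > 0" by (auto intro: Nat.gr0I)
    moreover have "gcd a b dvd M" using ab(2) dvd_trans gcd_dvd1 by blast
    ultimately show "(case p of (a, b) \<Rightarrow> (gcd a b, a div gcd a b, b div gcd a b))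
        \<in> Sigma {k. k dvd M} (\<lambda>k. {(g, h). g dvd M div k \<and> h dvd M div k \<and> coprime g h})"
      using ab by (auto simp: div_dvd_div intro!: div_gcd_coprime)
    show "(case case p of (a, b) \<Rightarrow> (gcd a b, a div gcd a b, b div gcd a b) of (k, g, h) \<Rightarrow> (k * g, k * h)) = p"
      by (simp add: ab)
  qed
  also have "\<dots> = (\<Sum>a | a dvd M. \<Sum>b | b dvd M. P a b)"
    by (simp add: sum.cartesian_product)
  finally show ?thesis .
qed

text \<open>Collect the terms with k n = a. Since the totients of the divisors of a sum to a, their
  total coefficient is a/a^2.\<close>

lemma sum_divisors_totient:
  fixes w :: "nat \<Rightarrow> 'a::rat_algebra"
  assumes M: "M \<ge> 1"
  shows "(\<Sum>k | k dvd M. \<Sum>n | n dvd M div k. scaleQ (of_nat (totient n) / of_nat (k * n) ^ 2) (w (k * n))) =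
    (\<Sum>a | a dvd M. scaleQ (1 / of_nat a) (w a))"
proof -
  have fin: "finite {k. k dvd m}" if "m > 0" for m :: nat using that by (simp add: finite_divisors_nat)
  have pos: "M div k > 0" if "k dvd M" for k using that M by (auto elim!: dvdE)
  have "(\<Sum>k | k dvd M. \<Sum>n | n dvd M div k. scaleQ (of_nat (totient n) / of_nat (k * n) ^ 2) (w (k * n))) =
     (\<Sum>(k, n)\<in>Sigma {k. k dvd M} (\<lambda>k. {n. n dvd M div k}). scaleQ (of_nat (totient n) / of_nat (k * n) ^ 2) (w (k * n)))"
    using M fin pos by (subst sum.Sigma) auto
  also have "\<dots> = (\<Sum>(a, n)\<in>Sigma {a. a dvd M} (\<lambda>a. {n. n dvd a}). scaleQ (of_nat (totient n) / of_nat a ^ 2) (w a))"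
  proof (rule sum.reindex_bij_witness[of _ "\<lambda>(a, n). (a div n, n)" "\<lambda>(k, n). (k * n, n)"])
    fix p assume p: "p \<in> Sigma {k. k dvd M} (\<lambda>k. {n. n dvd M div k})"
    obtain k n where kn: "p = (k, n)" by (cases p)
    from p have *: "k dvd M" "n dvd M div k" by (auto simp: kn)
    have "k > 0" "n > 0" using * M pos[OF *(1)] by (auto intro: Nat.gr0I)
    then show "(case case p of (k, n) \<Rightarrow> (k * n, n) of (a, n) \<Rightarrow> (a div n, n)) = p" by (simp add: kn)
    show "(case p of (k, n) \<Rightarrow> (k * n, n)) \<in> Sigma {a. a dvd M} (\<lambda>a. {n. n dvd a})"
      using * \<open>k > 0\<close> by (auto simp: kn dvd_div_iff_mult mult.commute)
    show "(case case p of (k, n) \<Rightarrow> (k * n, n) of (a, n) \<Rightarrow> scaleQ (of_nat (totient n) / of_nat a ^ 2) (w a)) =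
      (case p of (k, n) \<Rightarrow> scaleQ (of_nat (totient n) / of_nat (k * n) ^ 2) (w (k * n)))" by (simp add: kn)
  next
    fix p assume p: "p \<in> Sigma {a. a dvd M} (\<lambda>a. {n. n dvd a})"
    obtain a n where an: "p = (a, n)" by (cases p)
    from p have *: "a dvd M" "n dvd a" by (auto simp: an)
    then obtain k where k: "a = n * k" by (auto elim: dvdE)
    have "k > 0" "n > 0" using * M k by (auto intro: Nat.gr0I)
    with * k show "(case p of (a, n) \<Rightarrow> (a div n, n)) \<in> Sigma {k. k dvd M} (\<lambda>k. {n. n dvd M div k})"
      by (auto simp: an dvd_div_iff_mult intro: dvd_mult_right)
    show "(case case p of (a, n) \<Rightarrow> (a div n, n) of (k, n) \<Rightarrow> (k * n, n)) = p"
      using * by (simp add: an)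
  qed
  also have "\<dots> = (\<Sum>a | a dvd M. \<Sum>n | n dvd a. scaleQ (of_nat (totient n) / of_nat a ^ 2) (w a))"
    using M by (subst sum.Sigma) (auto intro!: fin dest: dvd_pos_nat[rotated])
  also have "\<dots> = (\<Sum>a | a dvd M. scaleQ (1 / of_nat a) (w a))"
  proof (rule sum.cong[OF refl])
    fix a assume "a \<in> {a. a dvd M}"
    with M have "a > 0" by (auto intro: Nat.gr0I)
    have "(\<Sum>n | n dvd a. scaleQ (of_nat (totient n) / of_nat a ^ 2) (w a)) =
        scaleQ (of_nat (\<Sum>n | n dvd a. totient n) / of_nat a ^ 2) (w a)"
      by (simp add: scaleQ_sum_left[symmetric] sum_divide_distrib)
    also have "of_nat (\<Sum>n | n dvd a. totient n) / of_nat a ^ 2 = (1 / of_nat a :: rat)"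
      using \<open>a > 0\<close> by (simp add: totient_divisor_sum power2_eq_square)
    finally show "(\<Sum>n | n dvd a. scaleQ (of_nat (totient n) / of_nat a ^ 2) (w a)) = scaleQ (1 / of_nat a) (w a)" .
  qed
  finally show ?thesis .
qed

text \<open>\<open>dx\<close>, \<open>dy\<close> are the derivations for two alphabets \<open>X\<close>, \<open>Y\<close>; the flow takes place in series in a
  third alphabet, on which \<open>dx\<close>, \<open>dy\<close> act coefficientwise.\<close>

locale flow = K: graded_filtration K + X: power_sum_derivations K dx + Y: power_sum_derivations K dy
  for K :: "nat \<Rightarrow> 'a::complete_lambda_ring set" and dx dy +
  fixes s :: "nat \<Rightarrow> 'a sym_series"
  assumes psum_s: "k \<ge> 1 \<Longrightarrow> M \<ge> 1 \<Longrightarrow> psum k (s M) = s (k * M)"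
begin

abbreviation DX :: "nat \<Rightarrow> 'a sym_series \<Rightarrow> 'a sym_series" where "DX M \<equiv> map_coeffs (dx M)"
abbreviation DY :: "nat \<Rightarrow> 'a sym_series \<Rightarrow> 'a sym_series" where "DY M \<equiv> map_coeffs (dy M)"

sublocale L: graded_filtration "lift_filtration K"
  by (rule graded_filtration_lift) (rule K.graded_filtration_axioms)

sublocale DX: power_sum_derivations "lift_filtration K" DX by (rule X.power_sum_derivations_map_coeffs)
sublocale DY: power_sum_derivations "lift_filtration K" DY by (rule Y.power_sum_derivations_map_coeffs)

text \<open>The coefficients are those for which \<open>\<Sum>\<^sub>k p\<^sub>k[E f]\<close>, with \<open>E\<close> the Euler operator and
  \<open>E f = \<Sum>\<^sub>M p\<^sub>M[T] flow_term f M\<close>, is the right-hand side of the heat equation for the logarithm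
  \<open>\<Sum>\<^sub>k p\<^sub>k[f]/k\<close> of \<open>Exp f\<close>: a pair of divisors \<open>(a, b)\<close> arises once, from \<open>k = gcd a b\<close>, and the
  totients add up to \<open>1/n\<close>.\<close>

definition flow_term :: "'a sym_series \<Rightarrow> nat \<Rightarrow> 'a sym_series" where
  "flow_term f M = scaleQ (of_nat M ^ 2) (s M *
     ((\<Sum>(g, h) | g dvd M \<and> h dvd M \<and> coprime g h.
         scaleQ (1 / of_nat (g * h)) (DX M (psum g f) * DY M (psum h f))) +
      (\<Sum>n | n dvd M. scaleQ (of_nat (totient n) / of_nat n ^ 2) (DX M (DY M (psum n f))))))"

text \<open>With m = M/k, applying \<open>p_k\<close> turns \<open>s m\<close> into
  \<open>s M\<close>, derivatives at m into derivatives at M, and p_g[f] into p_(kg)[f]. Rewriting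
  1/(g h) with the denominator (k g)(k h) costs k^2, which completes m^2 to M^2; then the two
  divisor sums apply.\<close>

lemma sum_psum_flow_term:
  assumes M: "M \<ge> 1" and f: "f \<in> lift_filtration K 1"
  shows "(\<Sum>k | k dvd M. psum k (flow_term f (M div k))) =
    scaleQ (of_nat M ^ 2) (s M * (DX M (Exp_arg f) * DY M (Exp_arg f) + DX M (DY M (Exp_arg f))))"
proof -
  interpret DXM: graded_derivation "lift_filtration K" "DX M" by (rule DX.derivation[OF M])
  let ?P = "\<lambda>a b. scaleQ (1 / of_nat (a * b)) (DX M (psum a f) * DY M (psum b f))"
  let ?w = "\<lambda>a. DX M (DY M (psum a f))"
  have step: "psum k (flow_term f (M div k)) = scaleQ (of_nat M ^ 2) (s M *
     ((\<Sum>(g, h) | g dvd M div k \<and> h dvd M div k \<and> coprime g h. ?P (k * g) (k * h)) +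
      (\<Sum>n | n dvd M div k. scaleQ (of_nat (totient n) / of_nat (k * n) ^ 2) (?w (k * n)))))"
    if k: "k dvd M" for k
  proof -
    obtain m where m: "M = k * m" using k by (elim dvdE)
    with M have k1: "k \<ge> 1" and m1: "m \<ge> 1" by (auto intro: Suc_leI Nat.gr0I)
    have x: "psum k (DX m z) = DX M (psum k z)" and y: "psum k (DY m z) = DY M (psum k z)" for z
      using k1 M by (simp_all add: DX.d_psum DY.d_psum m)
    have pos: "n \<ge> 1" if "n dvd m" for n using that m1 by (auto intro: Suc_leI Nat.gr0I)
    have pp: "psum k (psum n f) = psum (k * n) f" if "n dvd m" for n
      by (rule psum_psum[OF k1 pos[OF that]])
    have sM: "psum k (s m) = s M" using psum_s[OF k1 m1] by (simp add: m)
    have "psum k (flow_term f m) = scaleQ (of_nat m ^ 2) (s M *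
        ((\<Sum>(g, h) | g dvd m \<and> h dvd m \<and> coprime g h. scaleQ (of_nat k ^ 2) (?P (k * g) (k * h))) +
         (\<Sum>n | n dvd m. scaleQ (of_nat k ^ 2) (scaleQ (of_nat (totient n) / of_nat (k * n) ^ 2) (?w (k * n))))))"
      unfolding flow_term_def psum_scaleQ[OF k1] psum_mult[OF k1] psum_add[OF k1] psum_sum[OF k1] sM
        case_prod_unfold x y
      by (rule arg_cong[where f = "\<lambda>z. scaleQ _ (s M * z)"], rule arg_cong2[where f = "(+)"];
          rule sum.cong[OF refl])
        (use k1 in \<open>simp_all add: pp scaleQ_scaleQ power2_eq_square\<close>)
    also have "\<dots> = scaleQ (of_nat M ^ 2) (s M *
        ((\<Sum>(g, h) | g dvd m \<and> h dvd m \<and> coprime g h. ?P (k * g) (k * h)) +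
         (\<Sum>n | n dvd m. scaleQ (of_nat (totient n) / of_nat (k * n) ^ 2) (?w (k * n)))))"
      unfolding case_prod_unfold scaleQ_sum_right[symmetric] scaleQ_add_right[symmetric]
      by (simp add: scaleQ_mult_right scaleQ_scaleQ m power_mult_distrib mult.commute)
    finally show ?thesis using k1 by (simp add: m)
  qed
  have "(\<Sum>k | k dvd M. psum k (flow_term f (M div k))) = scaleQ (of_nat M ^ 2) (s M *
     ((\<Sum>k | k dvd M. \<Sum>(g, h) | g dvd M div k \<and> h dvd M div k \<and> coprime g h. ?P (k * g) (k * h)) +
      (\<Sum>k | k dvd M. \<Sum>n | n dvd M div k. scaleQ (of_nat (totient n) / of_nat (k * n) ^ 2) (?w (k * n)))))"
    unfolding sum.distrib[symmetric] sum_distrib_left scaleQ_sum_right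
    by (rule sum.cong[OF refl]) (simp add: step)
  also have "\<dots> = scaleQ (of_nat M ^ 2) (s M *
      ((\<Sum>a | a dvd M. \<Sum>b | b dvd M. ?P a b) + (\<Sum>a | a dvd M. scaleQ (1 / of_nat a) (?w a))))"
    unfolding sum_divisors_coprime_pairs[OF M, of ?P] sum_divisors_totient[OF M, of ?w] ..
  also have "(\<Sum>a | a dvd M. \<Sum>b | b dvd M. ?P a b) = DX M (Exp_arg f) * DY M (Exp_arg f)"
    unfolding DX.d_Exp_arg[OF f M] DY.d_Exp_arg[OF f M] sum_product
    by (simp add: scaleQ_mult_left scaleQ_mult_right scaleQ_scaleQ mult.commute)
  also have "(\<Sum>a | a dvd M. scaleQ (1 / of_nat a) (?w a)) = DX M (DY M (Exp_arg f))"
  proof -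
    interpret DYM: graded_derivation "lift_filtration K" "DY M" by (rule DY.derivation[OF M])
    have mem: "scaleQ (1 / of_nat a) (DY M (psum a f)) \<in> lift_filtration K 0" if "a dvd M" for a
    proof -
      have "a \<ge> 1" using that M by (auto intro: Suc_leI Nat.gr0I)
      from L.antimono[OF DYM.map_mem[OF L.psum_mem[OF this f]], of 0] show ?thesis
        by (simp add: L.scaleQ_mem)
    qed
    show ?thesis
      unfolding DY.d_Exp_arg[OF f M] using mem by (subst DXM.sum) (auto simp: DXM.d_scaleQ)
  qed
  finally show ?thesis .
qed

text \<open>The Euler operator turns the logarithm into the sum of all p_k[E f]. Collecting the
  coefficient of p_M[T] leaves the divisors k of M.\<close>

lemma euler_Exp_arg:
  assumes f: "f \<in> lift_filtration K 1"
    and flow_term: "\<And>M. M \<ge> 1 \<Longrightarrow> flow_term f M \<in> lift_filtration K (1 + M)"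
    and flow: "euler f = psum_combination (flow_term f)"
  shows "euler (Exp_arg f) = psum_combination (\<lambda>M. scaleQ (of_nat M ^ 2)
    (s M * (DX M (Exp_arg f) * DY M (Exp_arg f) + DX M (DY M (Exp_arg f)))))"
proof -
  interpret E: graded_derivation "lift_filtration K" euler by (rule K.graded_derivation_euler)
  let ?T = "\<lambda>k M. if k dvd M then psum k (flow_term f (M div k)) else 0"
  have "euler (Exp_arg f) = (\<Sum>\<^sub>\<infinity>k\<in>{1..}. euler (scaleQ (1 / of_nat k) (psum k f)))"
    unfolding Exp_arg_def by (rule E.infsum[OF L.Exp_arg_term_mem[OF f] L.finite_sublevel_ge_1])
  also have "\<dots> = (\<Sum>\<^sub>\<infinity>k\<in>{1..}. psum k (euler f))"
    by (rule infsum_cong) (simp add: E.d_scaleQ euler_psum scaleQ_scaleQ scaleQ_one)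
  also have "\<dots> = psum_combination (\<lambda>M. \<Sum>k | k dvd M. psum k (flow_term f (M div k)))"
  proof (rule L.infsum_eqI[OF _ L.finite_sublevel_ge_1])
    show "psum k (euler f) \<in> lift_filtration K k" if "k \<in> {1..}" for k
      using L.psum_mem[OF _ E.map_mem[OF f], of k] that by simp
    fix N
    have "(\<Sum>k | k \<in> {1..} \<and> k < N. psum k (euler f)) = psum_combination (\<lambda>M. \<Sum>k | k \<in> {1..} \<and> k < N. ?T k M)"
      unfolding psum_combination_sum[symmetric] flow
      by (rule sum.cong[OF refl]) (simp add: psum_psum_combination)
    moreover have "psum_combination (\<lambda>M. \<Sum>k | k dvd M. psum k (flow_term f (M div k)))
        - psum_combination (\<lambda>M. \<Sum>k | k \<in> {1..} \<and> k < N. ?T k M) \<in> lift_filtration K N"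
      unfolding psum_combination_diff
    proof (rule lift_filtration_psum_combination[OF K.rat_filtration_axioms])
      fix M :: nat assume M: "M \<ge> 1"
      let ?D = "{k. k dvd M}"
      have fin: "finite ?D" using M by (simp add: finite_divisors_nat)
      have "(\<Sum>k | k \<in> {1..} \<and> k < N. ?T k M) = (\<Sum>k\<in>{k\<in>?D. k < N}. psum k (flow_term f (M div k)))"
        by (rule sum.mono_neutral_cong_right) (use M in \<open>auto intro: Suc_leI Nat.gr0I\<close>)
      then have "(\<Sum>k\<in>?D. psum k (flow_term f (M div k))) - (\<Sum>k | k \<in> {1..} \<and> k < N. ?T k M)
          = (\<Sum>k\<in>?D - {k\<in>?D. k < N}. psum k (flow_term f (M div k)))"
        by (subst sum_diff[OF fin]) auto
      also have "\<dots> \<in> lift_filtration K (N + M)"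
      proof (rule L.sum_mem)
        fix k assume "k \<in> ?D - {k\<in>?D. k < N}"
        then have k: "k dvd M" "k \<ge> N" by auto
        then obtain m where m: "M = k * m" by (elim dvdE)
        with M have "k \<ge> 1" "m \<ge> 1" by (auto intro: Suc_leI Nat.gr0I)
        \<comment> \<open>The degree is k(1 + m) = k + M, which is at least N + M for the divisors
          omitted by the truncation.\<close>
        then have "psum k (flow_term f (M div k)) \<in> lift_filtration K (k * (1 + m))"
          using L.psum_mem[OF _ flow_term] by (simp add: m)
        then show "psum k (flow_term f (M div k)) \<in> lift_filtration K (N + M)"
          by (rule L.antimono) (use k in \<open>simp add: m\<close>)
      qed
      finally show "(\<Sum>k | k dvd M. psum k (flow_term f (M div k))) - (\<Sum>k | k \<in> {1..} \<and> k < N. ?T k M)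
        \<in> lift_filtration K (N + M)" .
    qed
    ultimately show "psum_combination (\<lambda>M. \<Sum>k | k dvd M. psum k (flow_term f (M div k)))
        - (\<Sum>k | k \<in> {1..} \<and> k < N. psum k (euler f)) \<in> lift_filtration K N" by simp
  qed
  also have "\<dots> = psum_combination (\<lambda>M. scaleQ (of_nat M ^ 2)
      (s M * (DX M (Exp_arg f) * DY M (Exp_arg f) + DX M (DY M (Exp_arg f)))))"
    by (rule psum_combination_cong) (rule sum_psum_flow_term[OF _ f])
  finally show ?thesis .
qed

text \<open>For Z = exp(F) one has D D' Z = (DF D'F + D D'F) Z. The nonlinear equation for the
  logarithm is therefore a linear one for Z.\<close>

lemma euler_Exp:
  assumes f: "f \<in> lift_filtration K 1"
    and flow_term: "\<And>M. M \<ge> 1 \<Longrightarrow> flow_term f M \<in> lift_filtration K (1 + M)"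
    and flow: "euler f = psum_combination (flow_term f)"
  shows "euler (Exp f) = psum_combination (\<lambda>M. scaleQ (of_nat M ^ 2) (s M * DX M (DY M (Exp f))))"
proof -
  interpret E: graded_derivation "lift_filtration K" euler by (rule K.graded_derivation_euler)
  have EA: "euler (Exp_arg f) = psum_combination (\<lambda>M. scaleQ (of_nat M ^ 2)
      (s M * (DX M (Exp_arg f) * DY M (Exp_arg f) + DX M (DY M (Exp_arg f)))))"
    by (rule euler_Exp_arg[OF f _ flow]) (rule flow_term)
  have "euler (Exp f) = euler (Exp_arg f) * Exp f" by (rule E.Exp[OF f])
  also have "\<dots> = psum_combination (\<lambda>M. scaleQ (of_nat M ^ 2) (s M * DX M (DY M (Exp f))))"
    unfolding EA psum_combination_mult
  proof (rule psum_combination_cong)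
    fix M :: nat assume M: "M \<ge> 1"
    interpret DXM: graded_derivation "lift_filtration K" "DX M" by (rule DX.derivation[OF M])
    interpret DYM: graded_derivation "lift_filtration K" "DY M" by (rule DY.derivation[OF M])
    have "DX M (DY M (Exp f)) = (DX M (Exp_arg f) * DY M (Exp_arg f) + DX M (DY M (Exp_arg f))) * Exp f"
      by (simp add: DYM.Exp[OF f] DXM.leibniz DXM.Exp[OF f] algebra_simps)
    then show "scaleQ (of_nat M ^ 2) (s M * (DX M (Exp_arg f) * DY M (Exp_arg f) + DX M (DY M (Exp_arg f)))) * Exp f
        = scaleQ (of_nat M ^ 2) (s M * DX M (DY M (Exp f)))"
      by (simp add: scaleQ_mult_left mult.assoc)
  qed
  finally show ?thesis .
qed

text \<open>The flow equation solved for f: the Euler operator is inverted by dividing by the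
  degree, and \<open>a\<close> supplies the coefficient of degree 0, where 1/0 = 0.\<close>

definition flow_step :: "'a \<Rightarrow> 'a sym_series \<Rightarrow> 'a sym_series" where
  "flow_step a f = constant_series a +
     Abs_sym_series (\<lambda>\<mu>. scaleQ (1 / of_nat (sum_mset \<mu>)) (sym_coeff (psum_combination (flow_term f)) \<mu>))"

lemma sym_coeff_flow_step:
  "sym_coeff (flow_step a f) \<mu> = (if \<mu> = {#} then a else 0) +
     scaleQ (1 / of_nat (sum_mset \<mu>)) (sym_coeff (psum_combination (flow_term f)) \<mu>)"
  unfolding flow_step_def sym_coeff_add sym_coeff_constant
  by (subst Abs_sym_series_inverse) (auto simp: sym_coeff_outside scaleQ_zero_right)

text \<open>The derivations act on coefficients and \<open>p_g\<close> does not lower degrees, so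
  \<open>flow_term\<close> respects agreement below n. The factor p_M[T] with M at least 1 gains one
  degree.\<close>

lemma agree_below_flow_step:
  assumes fg: "agree_below n f g"
  shows "agree_below (Suc n) (flow_step a f) (flow_step a g)"
proof -
  have "agree_below n (flow_term f M) (flow_term g M)" if M: "M \<ge> 1" for M
  proof -
    interpret DXM: graded_derivation K "dx M" by (rule X.derivation[OF M])
    interpret DYM: graded_derivation K "dy M" by (rule Y.derivation[OF M])
    have pos: "a \<ge> 1" if "a dvd M" for a using that M by (auto intro: Suc_leI Nat.gr0I)
    show ?thesis
      unfolding flow_term_def case_prod_unfold
      by (intro agree_below_scaleQ agree_below_mult agree_below_add agree_below_sum agree_below_map_coeffs
          DXM.zero DYM.zero agree_below_refl agree_below_psum fg) (auto dest: pos)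
  qed
  then have "agree_below (Suc n) (psum_combination (flow_term f)) (psum_combination (flow_term g))"
    by (rule agree_below_psum_combination)
  then show ?thesis by (simp add: agree_below_def sym_coeff_flow_step)
qed

lemma flow_solution:
  assumes "flow_step a f = f"
  shows "euler f = psum_combination (flow_term f)" and "sym_coeff f {#} = a"
proof -
  have f: "sym_coeff f \<mu> = (if \<mu> = {#} then a else 0) +
     scaleQ (1 / of_nat (sum_mset \<mu>)) (sym_coeff (psum_combination (flow_term f)) \<mu>)" for \<mu>
    using sym_coeff_flow_step[of a f \<mu>] assms by simp
  show "sym_coeff f {#} = a" by (simp add: f[of "{#}"] scaleQ_zero_left)
  show "euler f = psum_combination (flow_term f)"
  proof (rule sym_series_eqI')
    fix \<mu> assume \<mu>: "\<mu> \<in> partitions"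
    show "sym_coeff (euler f) \<mu> = sym_coeff (psum_combination (flow_term f)) \<mu>"
    proof (cases "\<mu> = {#}")
      case True
      then show ?thesis by (simp add: sym_coeff_euler scaleQ_zero_left sym_coeff_psum_combination[OF empty_in_partitions])
    next
      case False
      then obtain m where "m \<in># \<mu>" by blast
      with partitions_pos[OF \<mu> this] sum_mset.remove[OF this] have pos: "sum_mset \<mu> > 0" by simp
      have inv: "n > 0 \<Longrightarrow> of_nat n * (1 / of_nat n) = (1 :: rat)" for n by simp
      show ?thesis
        by (subst sym_coeff_euler, subst f)
          (simp only: scaleQ_scaleQ inv[OF pos] scaleQ_one False if_False add_0_left)
    qed
  qed
qed

end

text \<open>\<open>R g\<close> plays the role of the elements with denominator \<open>p\<^sub>g[S]\<close>.\<close>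

locale integral_flow = flow +
  fixes R :: "nat \<Rightarrow> nat \<Rightarrow> 'a set"
  assumes R: "g \<ge> 1 \<Longrightarrow> rat_filtration (R g)"
    and psum_R: "h \<ge> 1 \<Longrightarrow> g \<ge> 1 \<Longrightarrow> x \<in> R g n \<Longrightarrow> psum h x \<in> R (h * g) (h * n)"
    and dx_R: "M \<ge> 1 \<Longrightarrow> g \<ge> 1 \<Longrightarrow> x \<in> R g n \<Longrightarrow> dx M x \<in> R g (n + M)"
    and dy_R: "M \<ge> 1 \<Longrightarrow> g \<ge> 1 \<Longrightarrow> x \<in> R g n \<Longrightarrow> dy M x \<in> R g (n + M)"
    and quadratic: "M \<ge> 1 \<Longrightarrow> g dvd M \<Longrightarrow> h dvd M \<Longrightarrow> coprime g h \<Longrightarrow>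
     F \<in> lift_filtration (R g) i \<Longrightarrow> G \<in> lift_filtration (R h) j \<Longrightarrow> s M * (F * G) \<in> lift_filtration (R 1) (i + j)"
    and linear: "M \<ge> 1 \<Longrightarrow> g dvd M \<Longrightarrow> F \<in> lift_filtration (R g) i \<Longrightarrow> s M * F \<in> lift_filtration (R 1) i"
begin

text \<open>\<open>p_g\<close> moves f from denominator S to denominator p_g[S], and derivatives
  leave denominators alone. The factor \<open>s M\<close> then brings every term back to denominator
  S, by \<open>quadratic\<close> and \<open>linear\<close>.\<close>

lemma flow_step_mem:
  assumes f: "f \<in> lift_filtration (R 1) 1"
  shows flow_term_mem: "M \<ge> 1 \<Longrightarrow> flow_term f M \<in> lift_filtration (R 1) (1 + M)"
    and "a \<in> R 1 1 \<Longrightarrow> flow_step a f \<in> lift_filtration (R 1) 1"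
proof -
  interpret R1: rat_filtration "R 1" by (rule R) simp
  interpret L1: rat_filtration "lift_filtration (R 1)" by (rule rat_filtration_lift) (rule R1.rat_filtration_axioms)
  show flow_term: "flow_term f M \<in> lift_filtration (R 1) (1 + M)" if M: "M \<ge> 1" for M
  proof -
    interpret DXM: graded_derivation K "dx M" by (rule X.derivation[OF M])
    interpret DYM: graded_derivation K "dy M" by (rule Y.derivation[OF M])
    have pos: "a \<ge> 1" if "a dvd M" for a using that M by (auto intro: Suc_leI Nat.gr0I)
    have p: "psum g f \<in> lift_filtration (R g) g" if g: "g dvd M" for g
      using lift_filtration_psum[of "R g" g "R 1" f 1] psum_R[OF pos[OF g], of 1] R[OF pos[OF g]] pos[OF g] f by simp
    have x: "DX M z \<in> lift_filtration (R g) (n + M)" if "z \<in> lift_filtration (R g) n" "g dvd M" for g n z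
      using lift_filtration_map_coeffs[of "dx M" "R g" "R g" M z n, OF DXM.zero dx_R[OF M pos] that(1)] that(2) by auto
    have y: "DY M z \<in> lift_filtration (R g) (n + M)" if "z \<in> lift_filtration (R g) n" "g dvd M" for g n z
      using lift_filtration_map_coeffs[of "dy M" "R g" "R g" M z n, OF DYM.zero dy_R[OF M pos] that(1)] that(2) by auto
    \<comment> \<open>The two factors have degrees g + M and h + M, together more than the required
      1 + M.\<close>
    have qd: "s M * (DX M (psum g f) * DY M (psum h f)) \<in> lift_filtration (R 1) (1 + M)"
      if "g dvd M" "h dvd M" "coprime g h" for g h
      by (rule L1.antimono[OF quadratic[OF M that x[OF p] y[OF p]]]) (use that pos[of g] in auto)
    have ln: "s M * DX M (DY M (psum n f)) \<in> lift_filtration (R 1) (1 + M)" if "n dvd M" for n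
      by (rule L1.antimono[OF linear[OF M that x[OF y[OF p]]]]) (use that pos[of n] in auto)
    show ?thesis
      unfolding flow_term_def distrib_left sum_distrib_left
      by (intro L1.scaleQ_mem L1.add_mem L1.sum_mem;
          clarsimp simp only: mem_Collect_eq case_prod_conv scaleQ_mult_right; intro L1.scaleQ_mem qd ln; assumption)
  qed
  assume a: "a \<in> R 1 1"
  have c: "psum_combination (flow_term f) \<in> lift_filtration (R 1) 1"
    by (rule lift_filtration_psum_combination) (simp_all add: R flow_term[simplified])
  show "flow_step a f \<in> lift_filtration (R 1) 1"
    by (rule lift_filtrationI)
      (use lift_filtrationD[OF c] a in \<open>auto simp: sym_coeff_flow_step scaleQ_zero_left intro!: R1.scaleQ_mem[simplified]\<close>)
qed

lemma flow_exists:
  assumes R_K: "\<And>n. R 1 n \<subseteq> K n" and a: "a \<in> R 1 1"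
  obtains f where "f \<in> lift_filtration (R 1) 1" "f \<in> lift_filtration K 1" "sym_coeff f {#} = a"
    "euler (Exp f) = psum_combination (\<lambda>M. scaleQ (of_nat M ^ 2) (s M * DX M (DY M (Exp f))))"
proof -
  obtain f where f: "flow_step a f = f"
    using fixed_point_exists[of "flow_step a", OF agree_below_flow_step] by blast
  have fR: "f \<in> lift_filtration (R 1) 1"
    by (rule fixed_point_mem_lift[of "flow_step a", OF agree_below_flow_step _ _ f]) (use R flow_step_mem(2) a in auto)
  have sub: "lift_filtration (R 1) n \<subseteq> lift_filtration K n" for n
    using R_K by (auto simp: lift_filtration_def)
  have fK: "f \<in> lift_filtration K 1" using fR sub by blast
  have "flow_term f M \<in> lift_filtration K (1 + M)" if "M \<ge> 1" for M
    using flow_term_mem[OF fR that] sub by blast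
  from euler_Exp[OF fK this flow_solution(1)[OF f]]
  show thesis by (intro that[OF fR fK flow_solution(2)[OF f]])
qed

end

section \<open>Coefficients of the solution of the heat equation\<close>

text \<open>Differentiating the monomial of \<open>\<mu>\<close> once for each of its parts gives
  this constant; it is also the factorial part of \<open>zee\<close>.\<close>

definition mset_fact :: "nat multiset \<Rightarrow> rat" where
  "mset_fact \<mu> = (\<Prod>i\<in>set_mset \<mu>. fact (count \<mu> i))"

lemma mset_fact_add_mset: "mset_fact (add_mset M \<mu>) = of_nat (Suc (count \<mu> M)) * mset_fact \<mu>"
proof -
  have "mset_fact \<mu> = (\<Prod>i\<in>insert M (set_mset \<mu>). fact (count \<mu> i))"
    unfolding mset_fact_def by (rule prod.mono_neutral_left) (auto simp: not_in_iff)
  also have "\<dots> = fact (count \<mu> M) * (\<Prod>i\<in>set_mset \<mu> - {M}. fact (count \<mu> i))"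
    by (subst prod.insert_remove) auto
  finally have "mset_fact \<mu> = fact (count \<mu> M) * (\<Prod>i\<in>set_mset \<mu> - {M}. fact (count \<mu> i))" .
  moreover have "mset_fact (add_mset M \<mu>) = fact (Suc (count \<mu> M)) * (\<Prod>i\<in>set_mset \<mu> - {M}. fact (count \<mu> i))"
    unfolding mset_fact_def by (subst set_mset_add_mset_insert, subst prod.insert_remove) (auto intro!: prod.cong)
  ultimately show ?thesis by simp
qed

lemma mset_fact_nonzero: "mset_fact \<mu> \<noteq> 0"
  by (simp add: mset_fact_def)

lemma zee_eq: "of_nat (zee \<mu>) = of_nat (\<Prod>\<^sub># \<mu>) * mset_fact \<mu>"
  by (simp add: zee_def mset_fact_def prod_mset_multiplicity prod.distrib)

lemma sum_mset_multiplicity: "sum_mset \<mu> = (\<Sum>i\<in>set_mset \<mu>. count \<mu> i * i)" for \<mu> :: "nat multiset"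
proof (induction \<mu>)
  case (add M \<mu>)
  have "(\<Sum>i\<in>set_mset (add_mset M \<mu>). count (add_mset M \<mu>) i * i)
    = (\<Sum>i\<in>insert M (set_mset \<mu>). count \<mu> i * i + (if i = M then i else 0))"
    by (rule sum.cong) auto
  also have "\<dots> = (\<Sum>i\<in>insert M (set_mset \<mu>). count \<mu> i * i) + M"
    by (simp add: sum.distrib)
  also have "(\<Sum>i\<in>insert M (set_mset \<mu>). count \<mu> i * i) = (\<Sum>i\<in>set_mset \<mu>. count \<mu> i * i)"
    by (rule sum.mono_neutral_right) (auto simp: not_in_iff)
  finally show ?case using add by simp
qed simp

text \<open>Induction on the number of parts of \<open>\<tau>\<close>: each M in
  \<open>\<tau>\<close> contributes its multiplicity times M to a common multiple, and these numbers
  add up to |\<tau>|, which is cancelled.\<close>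

lemma heat_recursion:
  fixes z :: "nat multiset \<Rightarrow> nat multiset \<Rightarrow> nat multiset \<Rightarrow> 'a::lambda_ring"
  assumes rec: "\<And>\<tau> \<alpha> \<beta>. \<tau> \<in> partitions \<Longrightarrow> scaleQ (of_nat (sum_mset \<tau>)) (z \<tau> \<alpha> \<beta>) =
    (\<Sum>M\<in>set_mset \<tau>. scaleQ (of_nat M ^ 2 * of_nat (Suc (count \<alpha> M)) * of_nat (Suc (count \<beta> M)))
       (psum M S * z (\<tau> - {#M#}) (add_mset M \<alpha>) (add_mset M \<beta>)))"
    and \<tau>: "\<tau> \<in> partitions"
  shows "z \<tau> {#} {#} = scaleQ (of_nat (zee \<tau>)) (psum_part \<tau> S * z {#} \<tau> \<tau>)"
proof -
  text \<open>Multiplying by \<open>\<alpha>! \<beta>!\<close> turns the derivatives into shifts of the indices.\<close>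
  define w where "w = (\<lambda>\<tau> \<alpha> \<beta>. scaleQ (mset_fact \<alpha> * mset_fact \<beta>) (z \<tau> \<alpha> \<beta>))"
  \<comment> \<open>The coefficient of the monomial of \<open>\<tau>\<close> in exp(\<Sum> M p_M),
    the product of the i^(m_i)/m_i! over the distinct parts i.\<close>
  define c where "c = (\<lambda>\<tau>. of_nat (\<Prod>\<^sub># \<tau>) / mset_fact \<tau>)"
  have rec': "scaleQ (of_nat (sum_mset \<tau>)) (w \<tau> \<alpha> \<beta>) =
    (\<Sum>M\<in>set_mset \<tau>. scaleQ (of_nat M ^ 2) (psum M S * w (\<tau> - {#M#}) (add_mset M \<alpha>) (add_mset M \<beta>)))"
    if "\<tau> \<in> partitions" for \<tau> \<alpha> \<beta>
  proof -
    have "scaleQ (of_nat (sum_mset \<tau>)) (w \<tau> \<alpha> \<beta>)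
        = scaleQ (mset_fact \<alpha> * mset_fact \<beta>) (scaleQ (of_nat (sum_mset \<tau>)) (z \<tau> \<alpha> \<beta>))"
      by (simp only: w_def scaleQ_scaleQ mult.commute)
    also have "\<dots> = (\<Sum>M\<in>set_mset \<tau>. scaleQ (of_nat M ^ 2) (psum M S * w (\<tau> - {#M#}) (add_mset M \<alpha>) (add_mset M \<beta>)))"
      unfolding rec[OF that] scaleQ_sum_right w_def
      by (simp add: mset_fact_add_mset scaleQ_mult_right scaleQ_scaleQ ac_simps del: of_nat_Suc)
    finally show ?thesis .
  qed
  have w: "w \<tau> \<alpha> \<beta> = scaleQ (c \<tau>) (psum_part \<tau> S * w {#} (\<alpha> + \<tau>) (\<beta> + \<tau>))"
    if "\<tau> \<in> partitions" for \<tau> \<alpha> \<beta>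
    using that
  proof (induction "size \<tau>" arbitrary: \<tau> \<alpha> \<beta>)
    case 0
    then show ?case by (simp add: c_def mset_fact_def scaleQ_one psum_part_empty)
  next
    case (Suc n)
    let ?W = "psum_part \<tau> S * w {#} (\<alpha> + \<tau>) (\<beta> + \<tau>)"
    have summand: "scaleQ (of_nat M ^ 2) (psum M S * w (\<tau> - {#M#}) (add_mset M \<alpha>) (add_mset M \<beta>))
      = scaleQ (of_nat (count \<tau> M * M) * c \<tau>) ?W" if "M \<in># \<tau>" for M
    proof -
      from that obtain \<sigma> where \<sigma>: "\<tau> = add_mset M \<sigma>" by (blast dest: multi_member_split)
      have part: "\<sigma> \<in> partitions" "size \<sigma> = n" and M: "M \<noteq> 0"
        using Suc.prems Suc.hyps(2) by (auto simp: \<sigma> partitions_def)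
      have coeff: "of_nat M ^ 2 * c \<sigma> = of_nat (count \<tau> M * M) * c \<tau>"
        using M mset_fact_nonzero[of \<sigma>]
        by (simp add: c_def \<sigma> mset_fact_add_mset power2_eq_square field_simps del: of_nat_Suc)
          (simp add: algebra_simps)
      have "scaleQ (of_nat M ^ 2) (psum M S * w \<sigma> (add_mset M \<alpha>) (add_mset M \<beta>))
        = scaleQ (of_nat M ^ 2 * c \<sigma>) ?W"
        using Suc.hyps(1)[of \<sigma> "add_mset M \<alpha>" "add_mset M \<beta>"] part
        by (simp add: scaleQ_mult_right scaleQ_scaleQ \<sigma> psum_part_def mult.assoc)
      then show ?thesis unfolding coeff by (simp add: \<sigma>)
    qed
    have "scaleQ (of_nat (sum_mset \<tau>)) (w \<tau> \<alpha> \<beta>) = (\<Sum>M\<in>set_mset \<tau>. scaleQ (of_nat (count \<tau> M * M) * c \<tau>) ?W)"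
      unfolding rec'[OF Suc.prems] by (rule sum.cong[OF refl]) (rule summand)
    also have "\<dots> = scaleQ (of_nat (sum_mset \<tau>)) (scaleQ (c \<tau>) ?W)"
      by (simp only: scaleQ_sum_left[symmetric] sum_distrib_right[symmetric] of_nat_sum[symmetric]
          sum_mset_multiplicity[symmetric] scaleQ_scaleQ)
    finally show ?case
    proof (rule scaleQ_cancel)
      from Suc.hyps(2) obtain M where M: "M \<in># \<tau>" by (metis size_eq_Suc_imp_elem)
      with partitions_pos[OF Suc.prems M] sum_mset.remove[OF M] show "(of_nat (sum_mset \<tau>) :: rat) \<noteq> 0"
        by (simp del: of_nat_sum_mset)
    qed
  qed
  have "z \<tau> {#} {#} = w \<tau> {#} {#}" by (simp add: w_def mset_fact_def scaleQ_one)
  also have "\<dots> = scaleQ (c \<tau> * (mset_fact \<tau> * mset_fact \<tau>)) (psum_part \<tau> S * z {#} \<tau> \<tau>)"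
    by (subst w[OF \<tau>]) (simp add: w_def scaleQ_mult_right scaleQ_scaleQ)
  \<comment> \<open>Each of the two alphabets contributes one factor
    \<open>mset_fact \<tau>\<close>; one of them cancels the denominator of
    \<open>c \<tau>\<close>.\<close>
  also have "c \<tau> * (mset_fact \<tau> * mset_fact \<tau>) = of_nat (zee \<tau>)"
    using mset_fact_nonzero[of \<tau>] by (simp add: c_def zee_eq)
  finally show ?thesis .
qed

text \<open>The outermost alphabet is T, the middle one Y, the innermost X. Comparing coefficients
  turns the heat equation into \<open>heat_recursion\<close>.\<close>

lemma heat_solution:
  fixes Z :: "'a::lambda_ring sym_series sym_series sym_series"
  assumes heat: "euler Z = psum_combination (\<lambda>M. scaleQ (of_nat M ^ 2)
      (constant_series (constant_series (constant_series (psum M S))) *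
       map_coeffs (map_coeffs (partial_deriv M)) (map_coeffs (partial_deriv M) Z)))"
    and \<tau>: "\<tau> \<in> partitions"
  shows "sym_coeff (sym_coeff (sym_coeff Z \<tau>) {#}) {#} =
    scaleQ (of_nat (zee \<tau>)) (psum_part \<tau> S * sym_coeff (sym_coeff (sym_coeff Z {#}) \<tau>) \<tau>)"
proof (rule heat_recursion[where z = "\<lambda>\<tau> \<alpha> \<beta>. sym_coeff (sym_coeff (sym_coeff Z \<tau>) \<alpha>) \<beta>", OF _ \<tau>])
  have pd0: "partial_deriv M (0 :: 'c::rat_algebra sym_series) = 0" for M
    by (rule sym_series_eqI) (simp add: sym_coeff_partial_deriv scaleQ_zero_right)
  have mpd0: "map_coeffs (partial_deriv M) (0 :: 'c::rat_algebra sym_series sym_series) = 0" for M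
    by (rule sym_series_eqI) (simp add: sym_coeff_map_coeffs' pd0)
  have csum: "sym_coeff (sum f A) \<mu> = (\<Sum>i\<in>A. sym_coeff (f i) \<mu>)" for f :: "'i \<Rightarrow> 'c::comm_ring sym_series" and A \<mu>
    by (induction A rule: infinite_finite_induct) auto
  fix \<tau> \<alpha> \<beta> :: "nat multiset" assume \<tau>: "\<tau> \<in> partitions"
  have "scaleQ (of_nat (sum_mset \<tau>)) (sym_coeff (sym_coeff (sym_coeff Z \<tau>) \<alpha>) \<beta>) =
      sym_coeff (sym_coeff (sym_coeff (euler Z) \<tau>) \<alpha>) \<beta>"
    by (simp add: sym_coeff_euler del: of_nat_sum_mset)
  also have "\<dots> = (\<Sum>M\<in>set_mset \<tau>. scaleQ (of_nat M ^ 2 * of_nat (Suc (count \<alpha> M)) * of_nat (Suc (count \<beta> M)))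
       (psum M S * sym_coeff (sym_coeff (sym_coeff Z (\<tau> - {#M#})) (add_mset M \<alpha>)) (add_mset M \<beta>)))"
    unfolding heat sym_coeff_psum_combination[OF \<tau>]
    by (simp add: csum sym_coeff_constant_mult sym_coeff_map_coeffs' pd0 mpd0 sym_coeff_partial_deriv
        scaleQ_mult_right scaleQ_scaleQ mult_ac del: of_nat_Suc)
  finally show "scaleQ (of_nat (sum_mset \<tau>)) (sym_coeff (sym_coeff (sym_coeff Z \<tau>) \<alpha>) \<beta>) = \<dots>" .
qed

section \<open>Filtrations generated by a well-behaved family\<close>

definition filt_closure :: "(nat \<Rightarrow> 'a::filtered_ring set) \<Rightarrow> nat \<Rightarrow> 'a set" where
  "filt_closure P n = {x. \<forall>k. \<exists>y\<in>P n. x - y \<in> filt k}"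

lemma subset_filt_closure: "P n \<subseteq> filt_closure P n"
proof
  fix x assume "x \<in> P n"
  moreover have "x - x \<in> filt k" for k by (simp add: zero_in_filt)
  ultimately show "x \<in> filt_closure P n" unfolding filt_closure_def by blast
qed

text \<open>The ring operations and every \<open>p_g\<close> are continuous, so the algebraic axioms
  pass to the closure. For \<open>null\<close>, \<open>filt k\<close> contains the closure of each
  of its subsets.\<close>

lemma graded_filtration_closure:
  fixes P :: "nat \<Rightarrow> 'a::complete_lambda_ring set"
  assumes P: "rat_filtration P" and one: "1 \<in> P 0"
    and mult: "\<And>i j x y. x \<in> P i \<Longrightarrow> y \<in> P j \<Longrightarrow> x * y \<in> P (i + j)"
    and psum: "\<And>g n x. g \<ge> 1 \<Longrightarrow> x \<in> P n \<Longrightarrow> psum g x \<in> P (g * n)"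
    and null: "\<And>k. \<exists>n. P n \<subseteq> filt k"
  shows "graded_filtration (filt_closure P)"
proof
  interpret rat_filtration P by fact
  have approx: "\<exists>y\<in>P n. x - y \<in> filt k" if "x \<in> filt_closure P n" for x n k
    using that by (simp add: filt_closure_def)
  have I: "x \<in> filt_closure P n" if "\<And>k. \<exists>y\<in>P n. x - y \<in> filt k" for x n
    using that by (simp add: filt_closure_def)
  fix x y :: 'a and n i j :: nat
  show "0 \<in> filt_closure P n" using subset_filt_closure zero_mem by blast
  show "1 \<in> filt_closure P 0" using subset_filt_closure one by blast
  show "x \<in> filt_closure P n" if "x \<in> filt_closure P (Suc n)"
    using that Suc_mem unfolding filt_closure_def by blast
  show "scaleQ q x \<in> filt_closure P n" if "x \<in> filt_closure P n" for q
  proof (rule I)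
    fix k
    from approx[OF that, of k] obtain x' where "x' \<in> P n" "x - x' \<in> filt k" by blast
    then show "\<exists>y\<in>P n. scaleQ q x - y \<in> filt k"
      by (intro bexI[of _ "scaleQ q x'"]) (simp_all add: scaleQ_mem filt_scaleQ flip: scaleQ_diff_right)
  qed
  show "x + y \<in> filt_closure P n" if "x \<in> filt_closure P n" "y \<in> filt_closure P n"
  proof (rule I)
    fix k
    from approx[OF that(1), of k] obtain x' where x': "x' \<in> P n" "x - x' \<in> filt k" by blast
    from approx[OF that(2), of k] obtain y' where y': "y' \<in> P n" "y - y' \<in> filt k" by blast
    show "\<exists>z\<in>P n. x + y - z \<in> filt k"
      using filt_add[OF x'(2) y'(2)] add_mem[OF x'(1) y'(1)]
      by (intro bexI[of _ "x' + y'"]) (simp_all add: algebra_simps)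
  qed
  show "x * y \<in> filt_closure P (i + j)" if "x \<in> filt_closure P i" "y \<in> filt_closure P j"
  proof (rule I)
    fix k
    from approx[OF that(1), of k] obtain x' where x': "x' \<in> P i" "x - x' \<in> filt k" by blast
    from approx[OF that(2), of k] obtain y' where y': "y' \<in> P j" "y - y' \<in> filt k" by blast
    have "(x - x') * y + x' * (y - y') \<in> filt k"
      by (intro filt_add filt_mult_left filt_mult_right x' y')
    then show "\<exists>z\<in>P (i + j). x * y - z \<in> filt k"
      using mult[OF x'(1) y'(1)] by (intro bexI[of _ "x' * y'"]) (simp_all add: algebra_simps)
  qed
  show "psum g x \<in> filt_closure P (g * n)" if "g \<ge> 1" "x \<in> filt_closure P n" for g
  proof (rule I)
    fix k
    from psum_filt[OF that(1)] obtain l where l: "\<forall>x\<in>filt l. psum g (x::'a) \<in> filt k" by blast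
    from approx[OF that(2), of l] obtain x' where x': "x' \<in> P n" "x - x' \<in> filt l" by blast
    then have "psum g x - psum g x' \<in> filt k" using l by (simp flip: psum_diff[OF that(1)])
    with psum[OF that(1) x'(1)] show "\<exists>z\<in>P (g * n). psum g x - z \<in> filt k" by blast
  qed
  show "x \<in> filt_closure P n" if x: "\<And>k. \<exists>y\<in>filt_closure P n. x - y \<in> filt k"
  proof (rule I)
    fix k
    from x obtain y where y: "y \<in> filt_closure P n" "x - y \<in> filt k" by blast
    from approx[OF y(1), of k] obtain z where "z \<in> P n" "y - z \<in> filt k" by blast
    with filt_diff_trans[OF y(2)] show "\<exists>z\<in>P n. x - z \<in> filt k" by blast
  qed
  show "\<exists>n. filt_closure P n \<subseteq> filt k" for k
  proof -
    from null obtain n where n: "P n \<subseteq> filt k" by blast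
    have "x \<in> filt k" if "x \<in> filt_closure P n" for x
    proof -
      from approx[OF that, of k] obtain z where "z \<in> P n" "x - z \<in> filt k" by blast
      with n filt_add[of "x - z" k z] show ?thesis by auto
    qed
    then show ?thesis by blast
  qed
qed

section \<open>Ideals generated by monomials of large weight\<close>

text \<open>The index set is arbitrary so that the coefficients of both series can form a single
  family.\<close>

locale well_behaved_family =
  fixes I :: "'i set" and a :: "'i \<Rightarrow> 'a::modified_lambda_ring" and w :: "'i \<Rightarrow> nat"
  assumes finite_weight: "finite {i\<in>I. w i \<le> n}"
    and well_behaved: "\<exists>n0. \<forall>i\<in>I. \<forall>\<mu>\<in>partitions. \<mu> \<noteq> {#} \<and> (w i > n0 \<or> sum_mset \<mu> > n0) \<longrightarrow>
      psum_part \<mu> (a i) \<in> filt k"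
begin

definition monomials :: "(nat \<times> 'i) multiset set" where
  "monomials = {m. \<forall>(k, i)\<in>#m. k \<ge> 1 \<and> i \<in> I}"

definition mon :: "(nat \<times> 'i) multiset \<Rightarrow> 'a" where
  "mon m = (\<Prod>(k, i)\<in>#m. psum k (a i))"

definition weight :: "(nat \<times> 'i) multiset \<Rightarrow> nat" where
  "weight m = (\<Sum>(k, i)\<in>#m. k * w i)"

lemma monomials_add_mset: "add_mset (k, i) m \<in> monomials \<longleftrightarrow> k \<ge> 1 \<and> i \<in> I \<and> m \<in> monomials"
  and monomials_plus: "m + m' \<in> monomials \<longleftrightarrow> m \<in> monomials \<and> m' \<in> monomials"
  by (auto simp: monomials_def)

lemma mon_add_mset: "mon (add_mset (k, i) m) = psum k (a i) * mon m"
  and mon_plus: "mon (m + m') = mon m * mon m'"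
  and mon_empty: "mon {#} = 1"
  by (simp_all add: mon_def)

lemma weight_add_mset: "weight (add_mset (k, i) m) = k * w i + weight m"
  and weight_plus: "weight (m + m') = weight m + weight m'"
  and weight_empty: "weight {#} = 0"
  by (simp_all add: weight_def)

text \<open>All factors of a monomial that involve \<open>a i\<close> combine to
  \<open>psum_part (part_at i m) (a i)\<close>, the expression on which well-behavedness gives a
  bound.\<close>

definition part_at :: "'i \<Rightarrow> (nat \<times> 'i) multiset \<Rightarrow> nat multiset" where
  "part_at i m = image_mset fst (filter_mset (\<lambda>p. snd p = i) m)"

lemma part_at_in_partitions: "m \<in> monomials \<Longrightarrow> part_at i m \<in> partitions"
  by (force simp: monomials_def part_at_def partitions_def)

lemma mon_split: "mon m = psum_part (part_at i m) (a i) * mon (filter_mset (\<lambda>p. snd p \<noteq> i) m)"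
proof (induction m)
  case (add p m)
  then show ?case
    by (cases p) (auto simp: mon_add_mset part_at_def psum_part_def mult_ac)
qed (simp add: mon_empty part_at_def psum_part_empty)

lemma weight_eq:
  assumes "finite J" "snd ` set_mset m \<subseteq> J"
  shows "weight m = (\<Sum>i\<in>J. sum_mset (part_at i m) * w i)"
  using assms(2)
proof (induction m)
  case (add p m)
  obtain k j where p: "p = (k, j)" by (cases p)
  with add.prems have j: "j \<in> J" by simp
  have "sum_mset (part_at i (add_mset p m)) * w i = (if i = j then k * w j else 0) + sum_mset (part_at i m) * w i" for i
    by (auto simp: part_at_def p algebra_simps)
  then have "(\<Sum>i\<in>J. sum_mset (part_at i (add_mset p m)) * w i) = k * w j + (\<Sum>i\<in>J. sum_mset (part_at i m) * w i)"
    using assms(1) j by (simp add: sum.distrib)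
  with add show ?case by (simp add: p weight_add_mset)
qed (simp add: weight_empty part_at_def)

text \<open>If no generator supplied a factor in \<open>filt k\<close> through the bound
  \<open>n0\<close>, all generators occurring would have weight at most \<open>n0\<close> and their
  partitions size at most \<open>n0\<close>. Only finitely many such generators exist, so the total
  weight would be bounded.\<close>

lemma mon_in_filt: "\<exists>n. \<forall>m\<in>monomials. weight m \<ge> n \<longrightarrow> mon m \<in> filt k"
proof -
  obtain n0 where n0: "\<And>i \<mu>. i \<in> I \<Longrightarrow> \<mu> \<in> partitions \<Longrightarrow> \<mu> \<noteq> {#} \<Longrightarrow> w i > n0 \<or> sum_mset \<mu> > n0 \<Longrightarrow>
      psum_part \<mu> (a i) \<in> filt k"
    using well_behaved[of k] by metis
  define J where "J = {i\<in>I. w i \<le> n0}"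
  \<comment> \<open>One more than the largest weight possible when every index in \<open>J\<close>
    contributes at most n0 * n0.\<close>
  define n where "n = Suc (\<Sum>i\<in>J. n0 * n0)"
  have "mon m \<in> filt k" if m: "m \<in> monomials" and n: "weight m \<ge> n" for m
  proof -
    have "\<exists>i\<in>I. part_at i m \<noteq> {#} \<and> (w i > n0 \<or> sum_mset (part_at i m) > n0)"
    proof (rule ccontr)
      assume no: "\<not> ?thesis"
      have sub: "snd ` set_mset m \<subseteq> J"
      proof clarify
        fix k i assume ki: "(k, i) \<in># m"
        then have "i \<in> I" using m by (auto simp: monomials_def)
        moreover have "part_at i m \<noteq> {#}" using ki by (auto simp: part_at_def filter_mset_eq_conv intro!: bexI[of _ "(k, i)"])
        ultimately show "snd (k, i) \<in> J" using no by (auto simp: J_def)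
      qed
      have le: "sum_mset (part_at i m) * w i \<le> n0 * n0" if i: "i \<in> J" for i
      proof (cases "part_at i m = {#}")
        case False
        then show ?thesis using no i by (intro mult_mono) (auto simp: J_def not_less)
      qed simp
      have "finite J" unfolding J_def by (rule finite_weight)
      then have "weight m \<le> (\<Sum>i\<in>J. n0 * n0)"
        using weight_eq[OF _ sub] le by (simp only:) (rule sum_mono)
      with n show False by (simp add: n_def)
    qed
    then obtain i where "i \<in> I" "part_at i m \<noteq> {#}" "w i > n0 \<or> sum_mset (part_at i m) > n0" by blast
    with n0 part_at_in_partitions[OF m] have "psum_part (part_at i m) (a i) \<in> filt k" by blast
    then show ?thesis by (subst mon_split[of m i]) (rule filt_mult_right)
  qed
  then show ?thesis by blast
qed

text \<open>The ideal generated by the monomials of weight at least n, as finite sums. Arbitrary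
  coefficients \<open>c\<close> allow multiplication by the quotients u from the divisibility
  conditions on S.\<close>

inductive_set numerators :: "nat \<Rightarrow> 'a set" for n where
  zero: "0 \<in> numerators n"
| add_monomial: "x \<in> numerators n \<Longrightarrow> m \<in> monomials \<Longrightarrow> weight m \<ge> n \<Longrightarrow> x + c * mon m \<in> numerators n"

lemma numerators_monomial: "m \<in> monomials \<Longrightarrow> weight m \<ge> n \<Longrightarrow> c * mon m \<in> numerators n"
  using numerators.add_monomial[OF numerators.zero, of m n c] by simp

lemma numerators_add: "y \<in> numerators n \<Longrightarrow> x \<in> numerators n \<Longrightarrow> x + y \<in> numerators n"
  by (induction rule: numerators.induct) (auto intro: numerators.add_monomial simp flip: add.assoc)

lemma numerators_mult_left: "x \<in> numerators n \<Longrightarrow> c * x \<in> numerators n"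
proof (induction rule: numerators.induct)
  case (add_monomial x m d)
  from add_monomial.IH add_monomial.hyps(2,3) have "c * x + (c * d) * mon m \<in> numerators n"
    by (rule numerators.add_monomial)
  then show ?case by (simp add: distrib_left mult.assoc)
qed (simp add: numerators.zero)

lemma numerators_antimono: "x \<in> numerators n \<Longrightarrow> n' \<le> n \<Longrightarrow> x \<in> numerators n'"
  by (induction rule: numerators.induct) (auto intro: numerators.intros)

lemma rat_filtration_numerators: "rat_filtration numerators"
proof
  show "scaleQ q x \<in> numerators n" if "x \<in> numerators n" for q x n
    by (subst scaleQ_conv_mult) (rule numerators_mult_left[OF that])
qed (auto intro: numerators.zero numerators_add numerators_antimono)

lemma numerators_mult: "y \<in> numerators j \<Longrightarrow> x \<in> numerators i \<Longrightarrow> x * y \<in> numerators (i + j)"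
proof (induction rule: numerators.induct)
  case (add_monomial y m d)
  have "x * mon m \<in> numerators (i + j)"
    using add_monomial.prems
  proof (induction rule: numerators.induct)
    case (add_monomial z m' c)
    have "c * mon (m' + m) \<in> numerators (i + j)"
      by (rule numerators_monomial)
        (use add_monomial.hyps \<open>m \<in> monomials\<close> \<open>j \<le> weight m\<close> in \<open>auto simp: monomials_plus weight_plus\<close>)
    from numerators_add[OF this add_monomial.IH] show ?case
      by (simp add: distrib_right mon_plus mult.assoc)
  qed (simp add: numerators.zero)
  from numerators_add[OF numerators_mult_left[OF this, of d] add_monomial.IH[OF add_monomial.prems]]
  show ?case by (simp add: distrib_left mult.left_commute)
qed (simp add: numerators.zero)

lemma numerators_psum:
  assumes g: "g \<ge> 1"
  shows "x \<in> numerators n \<Longrightarrow> psum g x \<in> numerators (g * n)"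
proof (induction rule: numerators.induct)
  case zero
  then show ?case by (simp add: psum_zero[OF g] numerators.zero)
next
  case (add_monomial x m c)
  \<comment> \<open>\<open>p_g\<close> replaces p_k[a_i] by p_(gk)[a_i], which multiplies the weight
    by g.\<close>
  define m' where "m' = image_mset (\<lambda>(k, i). (g * k, i)) m"
  have *: "psum g (mon m) = mon m' \<and> weight m' = g * weight m \<and> m' \<in> monomials"
    using add_monomial.hyps(2) unfolding m'_def
  proof (induction m)
    case empty
    then show ?case by (simp add: mon_empty weight_empty psum_one[OF g])
  next
    case (add p m)
    then show ?case
      using g by (cases p)
        (auto simp: mon_add_mset weight_add_mset monomials_add_mset psum_mult psum_psum algebra_simps Suc_le_eq)
  qed
  then have "psum g x + psum g c * mon m' \<in> numerators (g * n)"
    by (intro numerators.add_monomial add_monomial.IH) (use add_monomial.hyps in auto)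
  with * show ?case by (simp add: psum_add[OF g] psum_mult[OF g])
qed

lemma one_in_numerators: "1 \<in> numerators 0"
  using numerators_monomial[of "{#}" 0 1] by (simp add: monomials_def mon_empty)

lemma generator_in_numerators: "i \<in> I \<Longrightarrow> a i \<in> numerators (w i)"
  using numerators_monomial[of "{#(1, i)#}" "w i" 1]
  by (simp add: monomials_def mon_def weight_def psum_1_left[simplified])

lemma numerators_null: "\<exists>n. numerators n \<subseteq> filt k"
proof -
  obtain n where n: "\<And>m. m \<in> monomials \<Longrightarrow> weight m \<ge> n \<Longrightarrow> mon m \<in> filt k"
    using mon_in_filt[of k] by blast
  have "x \<in> filt k" if "x \<in> numerators n" for x
    using that
    by (induction rule: numerators.induct) (auto intro!: filt_add filt_mult_left n simp: zero_in_filt)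
  then show ?thesis by blast
qed

lemma graded_filtration_numerators: "graded_filtration (filt_closure numerators)"
  by (rule graded_filtration_closure)
    (auto intro: rat_filtration_numerators one_in_numerators numerators_mult numerators_psum[simplified] numerators_null)

end

section \<open>Fractions in the completed localization\<close>

lemma to_completion_add: "to_completion (x + y) = to_completion x + to_completion y"
  by transfer (simp add: filt_Cauchy_rel_refl filt_Cauchy_const)

lemma to_completion_one: "to_completion 1 = 1"
  by transfer (simp add: filt_Cauchy_rel_refl filt_Cauchy_const)

lemma to_completion_zero: "to_completion 0 = 0"
  by transfer (simp add: filt_Cauchy_rel_refl filt_Cauchy_const)

lemma to_completion_scaleQ: "to_completion (scaleQ q x) = scaleQ q (to_completion x)"
  by transfer (simp add: filt_Cauchy_rel_refl filt_Cauchy_const)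

lemma to_completion_psum: "n \<ge> 1 \<Longrightarrow> to_completion (psum n x) = psum n (to_completion x)"
  by transfer (simp add: filt_Cauchy_rel_refl filt_Cauchy_const)

definition cfract :: "'a::modified_lambda_ring \<Rightarrow> 'a \<Rightarrow> 'a completed_localization" where
  "cfract d s = to_completion (fract d s)"

lemma over_modifier_eq_cfract: "over_modifier d = cfract d modifier"
  and of_base_eq_cfract: "of_base d = cfract d 1"
  by (simp_all add: over_modifier_def of_base_def cfract_def)

lemma cfract_eqI: "s \<in> denominators \<Longrightarrow> t \<in> denominators \<Longrightarrow> a * t = b * s \<Longrightarrow> cfract a s = cfract b t"
  by (metis cfract_def fract_eq_iff)

lemma cfract_add: "s \<in> denominators \<Longrightarrow> t \<in> denominators \<Longrightarrow> cfract a s + cfract b t = cfract (a * t + b * s) (s * t)"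
  by (simp add: cfract_def fract_add flip: to_completion_add)

lemma cfract_add_same: "s \<in> denominators \<Longrightarrow> cfract a s + cfract b s = cfract (a + b) s"
  by (simp add: cfract_add) (rule cfract_eqI, simp_all add: denominators_mult algebra_simps)

lemma cfract_mult: "s \<in> denominators \<Longrightarrow> t \<in> denominators \<Longrightarrow> cfract a s * cfract b t = cfract (a * b) (s * t)"
  by (simp add: cfract_def fract_mult flip: to_completion_mult)

lemma cfract_psum: "n \<ge> 1 \<Longrightarrow> s \<in> denominators \<Longrightarrow> psum n (cfract a s) = cfract (psum n a) (psum n s)"
  by (simp add: cfract_def fract_psum flip: to_completion_psum)

lemma cfract_scaleQ: "s \<in> denominators \<Longrightarrow> scaleQ q (cfract a s) = cfract (scaleQ q a) s"
  unfolding cfract_def to_completion_scaleQ[symmetric] fract_def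
  by (subst scaleQ_localization.abs_eq) (simp_all add: fract_rel_refl)

lemma cfract_zero: "s \<in> denominators \<Longrightarrow> cfract 0 s = 0"
  using cfract_eqI[of s 1 0 0] by (simp add: one_in_denominators cfract_def to_completion_zero flip: fract_zero)

lemma cfract_one: "cfract 1 1 = 1"
  by (simp add: cfract_def to_completion_one flip: fract_one)

lemma cfract_in_filt: "a \<in> filt k \<Longrightarrow> s \<in> denominators \<Longrightarrow> cfract a s \<in> filt k"
  unfolding cfract_def to_completion_in_filt_iff filt_localization_def by blast

section \<open>Divisibility for good modifiers and control of denominators\<close>

text \<open>Write M = g e and apply \<open>p_g\<close> to the divisibility of p_e[S] by S.\<close>

lemma psum_modifier_dvd:
  assumes M: "M \<ge> 1" and g: "g dvd M"
  shows "psum g modifier dvd (psum M modifier :: 'a::modified_lambda_ring)"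
proof -
  from g obtain e where e: "M = g * e" by (elim dvdE)
  with M have pos: "g \<ge> 1" "e \<ge> 1" by (auto intro: Suc_leI Nat.gr0I)
  have "modifier dvd (psum e modifier :: 'a)"
    using good_modifier pos(2) unfolding good_modifier_def by blast
  then obtain u :: 'a where "psum e modifier = modifier * u" by (elim dvdE)
  then have "psum M modifier = psum g modifier * psum g u"
    using pos by (simp add: e flip: psum_psum psum_mult)
  then show ?thesis by simp
qed

text \<open>The coprime condition treats p_(gh)[S], and g h divides M because g and h are
  coprime.\<close>

lemma psum_modifier_mult_dvd:
  assumes M: "M \<ge> 1" and gh: "g dvd M" "h dvd M" "coprime g h"
  shows "psum g modifier * psum h modifier dvd (modifier * psum M modifier :: 'a::modified_lambda_ring)"
proof -
  have pos: "g \<ge> 1" "h \<ge> 1" using M gh by (auto intro: Suc_leI Nat.gr0I)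
  have "psum g modifier * psum h modifier dvd (modifier * psum (g * h) modifier :: 'a)"
    using good_modifier pos gh(3) unfolding good_modifier_def by blast
  moreover have "psum (g * h) modifier dvd (psum M modifier :: 'a)"
    by (rule psum_modifier_dvd[OF M divides_mult[OF gh]])
  ultimately show ?thesis by (meson dvd_refl mult_dvd_mono dvd_trans)
qed

context well_behaved_family
begin

definition fractions :: "nat \<Rightarrow> 'a completed_localization set" where
  "fractions n = {cfract d s | d s. d \<in> numerators n \<and> s \<in> denominators}"

definition psum_fractions :: "nat \<Rightarrow> nat \<Rightarrow> 'a completed_localization set" where
  "psum_fractions g n = {cfract d (psum g modifier) | d. d \<in> numerators n}"

lemma psum_fractions_subset: "g \<ge> 1 \<Longrightarrow> psum_fractions g n \<subseteq> fractions n"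
  using psum_modifier_in_denominators unfolding psum_fractions_def fractions_def by blast

lemma over_modifier_in_psum_fractions: "d \<in> numerators n \<Longrightarrow> over_modifier d \<in> psum_fractions 1 n"
  unfolding psum_fractions_def over_modifier_eq_cfract psum_1_left by blast

lemma psum_fractions_1: "psum_fractions 1 n = over_modifier ` numerators n"
  unfolding psum_fractions_def psum_1_left by (auto simp: over_modifier_eq_cfract)

lemma rat_filtration_fractions: "rat_filtration fractions"
proof
  interpret N: rat_filtration numerators by (rule rat_filtration_numerators)
  fix x y :: "'a completed_localization" and n
  show "0 \<in> fractions n"
    unfolding fractions_def using cfract_zero[OF one_in_denominators] numerators.zero one_in_denominators by force
  show "x \<in> fractions n" if "x \<in> fractions (Suc n)"
    using that N.Suc_mem unfolding fractions_def by blast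
  show "scaleQ q x \<in> fractions n" if "x \<in> fractions n" for q
  proof -
    from that obtain d s where "x = cfract d s" "d \<in> numerators n" "s \<in> denominators"
      unfolding fractions_def by blast
    then show ?thesis unfolding fractions_def using cfract_scaleQ N.scaleQ_mem by blast
  qed
  show "x + y \<in> fractions n" if "x \<in> fractions n" "y \<in> fractions n"
  proof -
    from that obtain d s e t where *: "x = cfract d s" "y = cfract e t" "d \<in> numerators n" "e \<in> numerators n"
      "s \<in> denominators" "t \<in> denominators" unfolding fractions_def by blast
    then have "x + y = cfract (t * d + s * e) (s * t)" by (simp add: cfract_add mult.commute)
    moreover have "t * d + s * e \<in> numerators n" using * by (intro N.add_mem numerators_mult_left)
    ultimately show ?thesis using * denominators_mult unfolding fractions_def by blast
  qed
qed

lemma rat_filtration_psum_fractions: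
  assumes g: "g \<ge> 1"
  shows "rat_filtration (psum_fractions g)"
proof
  interpret N: rat_filtration numerators by (rule rat_filtration_numerators)
  note s = psum_modifier_in_denominators[OF g, where 'a = 'a]
  fix x y :: "'a completed_localization" and n
  show "0 \<in> psum_fractions g n"
    unfolding psum_fractions_def using cfract_zero[OF s] numerators.zero by force
  show "x \<in> psum_fractions g n" if "x \<in> psum_fractions g (Suc n)"
    using that N.Suc_mem unfolding psum_fractions_def by blast
  show "scaleQ q x \<in> psum_fractions g n" if "x \<in> psum_fractions g n" for q
    using that N.scaleQ_mem s unfolding psum_fractions_def by (auto simp: cfract_scaleQ)
  show "x + y \<in> psum_fractions g n" if "x \<in> psum_fractions g n" "y \<in> psum_fractions g n"
    using that N.add_mem s unfolding psum_fractions_def by (auto simp: cfract_add_same)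
qed

lemma psum_fractions_psum:
  assumes "h \<ge> 1" "g \<ge> 1" "x \<in> psum_fractions g n"
  shows "psum h x \<in> psum_fractions (h * g) (h * n)"
proof -
  from assms(3) obtain d where d: "x = cfract d (psum g modifier)" "d \<in> numerators n"
    unfolding psum_fractions_def by blast
  have "psum h x = cfract (psum h d) (psum (h * g) modifier)"
    unfolding d cfract_psum[OF assms(1) psum_modifier_in_denominators[OF assms(2)]] psum_psum[OF assms(1,2)] ..
  with numerators_psum[OF assms(1) d(2)] show ?thesis unfolding psum_fractions_def by blast
qed

text \<open>From S p_M[S] = p_g[S] p_h[S] u, the product p_M[S] (d/p_g[S]) (e/p_h[S]) equals u d
  e/S.\<close>

lemma psum_fractions_quadratic:
  assumes M: "M \<ge> 1" and gh: "g dvd M" "h dvd M" "coprime g h"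
    and x: "x \<in> psum_fractions g i" and y: "y \<in> psum_fractions h j"
  shows "of_base (psum M modifier) * (x * y) \<in> psum_fractions 1 (i + j)"
proof -
  let ?S = "\<lambda>g. psum g modifier :: 'a"
  have "g \<ge> 1" "h \<ge> 1" using M gh by (auto intro: Suc_leI Nat.gr0I)
  then have den: "?S g \<in> denominators" "?S h \<in> denominators" by (auto intro: psum_modifier_in_denominators)
  from x obtain d where d: "x = cfract d (?S g)" "d \<in> numerators i" by (auto simp: psum_fractions_def)
  from y obtain e where e: "y = cfract e (?S h)" "e \<in> numerators j" by (auto simp: psum_fractions_def)
  obtain u where u: "modifier * ?S M = (?S g * ?S h) * u"
    using psum_modifier_mult_dvd[OF M gh] by (elim dvdE)
  have "of_base (?S M) * (x * y) = cfract (?S M * (d * e)) (?S g * ?S h)"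
    using den by (simp add: of_base_eq_cfract d e cfract_mult one_in_denominators denominators_mult)
  also have "\<dots> = cfract (u * (d * e)) modifier"
  proof (rule cfract_eqI[OF denominators_mult[OF den] modifier_in_denominators])
    have "?S M * (d * e) * modifier = (modifier * ?S M) * (d * e)" by (simp add: mult_ac)
    then show "?S M * (d * e) * modifier = u * (d * e) * (?S g * ?S h)" by (simp add: u mult_ac)
  qed
  finally show ?thesis
    using numerators_mult_left[OF numerators_mult[OF e(2) d(2)], of u]
    by (simp add: psum_fractions_1 over_modifier_eq_cfract del: One_nat_def)
qed

lemma psum_fractions_linear:
  assumes M: "M \<ge> 1" and g: "g dvd M" and x: "x \<in> psum_fractions g i"
  shows "of_base (psum M modifier) * x \<in> psum_fractions 1 i"
proof -
  let ?S = "\<lambda>g. psum g modifier :: 'a"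
  have "g \<ge> 1" using M g by (auto intro: Suc_leI Nat.gr0I)
  then have den: "?S g \<in> denominators" by (rule psum_modifier_in_denominators)
  from x obtain d where d: "x = cfract d (?S g)" "d \<in> numerators i" by (auto simp: psum_fractions_def)
  obtain u where u: "?S M = ?S g * u" using psum_modifier_dvd[OF M g] by (elim dvdE)
  have "of_base (?S M) * x = cfract (?S M * d) (?S g)"
    using den by (simp add: of_base_eq_cfract d cfract_mult one_in_denominators)
  \<comment> \<open>The value u d is even free of denominators; it is expanded by S to fit the
    target set.\<close>
  also have "\<dots> = cfract ((modifier * u) * d) modifier"
    by (rule cfract_eqI[OF den modifier_in_denominators]) (simp add: u mult_ac)
  finally show ?thesis
    using numerators_mult_left[OF d(2), of "modifier * u"]
    by (simp add: psum_fractions_1 over_modifier_eq_cfract del: One_nat_def)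
qed

lemma graded_filtration_fractions: "graded_filtration (filt_closure fractions)"
proof (rule graded_filtration_closure)
  show "rat_filtration fractions" by (rule rat_filtration_fractions)
  show "1 \<in> fractions 0"
    unfolding fractions_def using cfract_one one_in_numerators one_in_denominators by force
  show "x * y \<in> fractions (i + j)" if "x \<in> fractions i" "y \<in> fractions j" for x y i j
    using that numerators_mult denominators_mult unfolding fractions_def by (fastforce simp: cfract_mult)
  show "psum g x \<in> fractions (g * n)" if "g \<ge> 1" "x \<in> fractions n" for g n x
    using that numerators_psum psum_in_denominators unfolding fractions_def by (fastforce simp: cfract_psum)
  show "\<exists>n. fractions n \<subseteq> filt k" for k
  proof -
    from numerators_null obtain n where "numerators n \<subseteq> filt k" by blast
    then show ?thesis unfolding fractions_def by (blast intro: cfract_in_filt)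
  qed
qed

text \<open>This allows division by S to be exchanged with an infinite sum, so that numerators can
  be summed in the base ring.\<close>

lemma graded_map_over_modifier: "graded_map (filt_closure numerators) (filt_closure fractions) over_modifier"
proof -
  interpret N: graded_filtration "filt_closure numerators" by (rule graded_filtration_numerators)
  interpret F: graded_filtration "filt_closure fractions" by (rule graded_filtration_fractions)
  note S = modifier_in_denominators
  have add: "over_modifier (x + y) = over_modifier x + over_modifier y" for x y :: 'a
    by (simp add: over_modifier_eq_cfract cfract_add_same[OF S])
  have scaleQ: "over_modifier (scaleQ q x) = scaleQ q (over_modifier x)" for q and x :: 'a
    by (simp add: over_modifier_eq_cfract cfract_scaleQ[OF S])
  show ?thesis
  proof
    fix x n assume x: "x \<in> filt_closure numerators n"
    show "over_modifier x \<in> filt_closure fractions n"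
      unfolding filt_closure_def mem_Collect_eq
    proof
      fix k
      from x obtain d where d: "d \<in> numerators n" "x - d \<in> filt k" unfolding filt_closure_def by blast
      have "over_modifier x - over_modifier d = over_modifier (x - d)"
        using add[of "x - d" d] by simp
      also have "\<dots> \<in> filt k" unfolding over_modifier_eq_cfract by (rule cfract_in_filt[OF d(2) S])
      finally show "\<exists>y\<in>fractions n. over_modifier x - y \<in> filt k"
        using over_modifier_in_psum_fractions[OF d(1)] psum_fractions_subset[of 1 n] by blast
    qed
  qed (simp_all add: add scaleQ)
qed

end

section \<open>The modified Hall product of plethystic exponentials\<close>

lemma lift_filtration_constant_mult:
  assumes "\<And>n x. x \<in> A n \<Longrightarrow> c * x \<in> B n" "f \<in> lift_filtration A n"
  shows "constant_series (c :: 'a::comm_ring) * f \<in> lift_filtration B n"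
  using assms(1)[OF lift_filtrationD[OF assms(2)]] by (intro lift_filtrationI) (simp add: sym_coeff_constant_mult)

text \<open>The constant has to clear the denominators of both factors at once, so the hypothesis on
  c * (x * y) is applied to each pair of coefficients.\<close>

lemma lift_filtration_constant_mult_mult:
  assumes C: "rat_filtration C"
    and mult: "\<And>i j x y. x \<in> A i \<Longrightarrow> y \<in> B j \<Longrightarrow> c * (x * y) \<in> C (i + j)"
    and f: "f \<in> lift_filtration A i" and g: "g \<in> lift_filtration B j"
  shows "constant_series c * (f * g) \<in> lift_filtration C (i + j)"
proof (rule lift_filtrationI)
  interpret C: rat_filtration C by fact
  fix \<mu>
  have "(\<Sum>(\<alpha>, \<beta>)\<in>mset_splits \<mu>. c * (sym_coeff f \<alpha> * sym_coeff g \<beta>)) \<in> C (i + j + sum_mset \<mu>)"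
  proof (rule C.sum_mem, clarify)
    fix \<alpha> \<beta> assume "(\<alpha>, \<beta>) \<in> mset_splits \<mu>"
    then have "\<mu> = \<alpha> + \<beta>" by (simp add: mset_splits_def)
    then show "c * (sym_coeff f \<alpha> * sym_coeff g \<beta>) \<in> C (i + j + sum_mset \<mu>)"
      using mult[OF lift_filtrationD[OF f, of \<alpha>] lift_filtrationD[OF g, of \<beta>]] by (simp add: ac_simps)
  qed
  then show "sym_coeff (constant_series c * (f * g)) \<mu> \<in> C (i + j + sum_mset \<mu>)"
    by (subst sym_coeff_constant_mult, subst sym_coeff_mult) (simp add: sum_distrib_left case_prod_unfold)
qed

lemma lift_filtration_constant:
  assumes "rat_filtration A" "x \<in> A n"
  shows "constant_series x \<in> lift_filtration A n"
  using assms rat_filtration.zero_mem[OF assms(1)] by (intro lift_filtrationI) (simp add: sym_coeff_constant)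

lemma constant_zero: "constant_series 0 = (0 :: 'a::comm_ring sym_series)"
  by (rule sym_series_eqI) (simp add: sym_coeff_constant)

lemma partial_deriv_zero: "partial_deriv M (0 :: 'a::rat_algebra sym_series) = 0"
  by (rule sym_series_eqI) (simp add: sym_coeff_partial_deriv scaleQ_zero_right)

lemma psum_of_base: "n \<ge> 1 \<Longrightarrow> psum n (of_base x) = of_base (psum n x)"
  by (simp add: of_base_eq_cfract cfract_psum one_in_denominators psum_one)

lemma over_modifier_zero: "over_modifier 0 = 0"
  by (simp add: over_modifier_eq_cfract cfract_zero modifier_in_denominators)

text \<open>The successor in the weight gives the coefficient at the empty partition positive weight
  too. This puts A/S and B/S in degree 1, where \<open>Exp\<close> converges.\<close>

lemma well_behaved_family_coeffs:
  assumes "well_behaved_series A" "well_behaved_series B"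
  shows "well_behaved_family (UNIV \<times> partitions) (\<lambda>(b, \<nu>). sym_coeff (if b then A else B) \<nu>) (\<lambda>(b, \<nu>). Suc (sum_mset \<nu>))"
proof
  show "finite {i \<in> UNIV \<times> partitions. (case i of (b :: bool, \<nu>) \<Rightarrow> Suc (sum_mset \<nu>)) \<le> n}" for n
    by (rule finite_subset[of _ "UNIV \<times> {\<nu> \<in> partitions. sum_mset \<nu> \<le> n}"])
      (auto intro!: finite_cartesian_product finite_partitions_le)
  fix k
  obtain nA where nA: "\<And>\<nu> \<mu>. \<nu> \<in> partitions \<Longrightarrow> \<mu> \<in> partitions \<Longrightarrow> \<mu> \<noteq> {#} \<Longrightarrow> sum_mset \<nu> > nA \<or> sum_mset \<mu> > nA \<Longrightarrow>
      psum_part \<mu> (sym_coeff A \<nu>) \<in> filt k"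
    using assms(1) unfolding well_behaved_series_iff by metis
  obtain nB where nB: "\<And>\<nu> \<mu>. \<nu> \<in> partitions \<Longrightarrow> \<mu> \<in> partitions \<Longrightarrow> \<mu> \<noteq> {#} \<Longrightarrow> sum_mset \<nu> > nB \<or> sum_mset \<mu> > nB \<Longrightarrow>
      psum_part \<mu> (sym_coeff B \<nu>) \<in> filt k"
    using assms(2) unfolding well_behaved_series_iff by metis
  have "psum_part \<mu> (sym_coeff (if b then A else B) \<nu>) \<in> filt k"
    if "\<nu> \<in> partitions" "\<mu> \<in> partitions" "\<mu> \<noteq> {#}" "Suc (sum_mset \<nu>) > Suc (nA + nB) \<or> sum_mset \<mu> > Suc (nA + nB)" for b \<mu> \<nu>
    using that nA[of \<nu> \<mu>] nB[of \<nu> \<mu>] by auto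
  then show "\<exists>n0. \<forall>i\<in>UNIV \<times> partitions. \<forall>\<mu>\<in>partitions.
      \<mu> \<noteq> {#} \<and> ((case i of (b, \<nu>) \<Rightarrow> Suc (sum_mset \<nu>)) > n0 \<or> sum_mset \<mu> > n0) \<longrightarrow>
      psum_part \<mu> (case i of (b :: bool, \<nu>) \<Rightarrow> sym_coeff (if b then A else B) \<nu>) \<in> filt k"
    by (intro exI[of _ "Suc (nA + nB)"]) auto
qed

context well_behaved_family
begin

abbreviation "base_filtration \<equiv> filt_closure fractions"
abbreviation "base_filtration2 \<equiv> lift_filtration (lift_filtration base_filtration)"
abbreviation "modifier_series M \<equiv>
  constant_series (constant_series (constant_series (psum M (of_base (modifier :: 'a)))))"

sublocale K: graded_filtration base_filtration by (rule graded_filtration_fractions)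
sublocale K1: graded_filtration "lift_filtration base_filtration" by (rule graded_filtration_lift) unfold_locales
sublocale K2: graded_filtration base_filtration2 by (rule graded_filtration_lift) unfold_locales

lemma psum_fractions_base_filtration: "g \<ge> 1 \<Longrightarrow> psum_fractions g n \<subseteq> base_filtration n"
  using psum_fractions_subset subset_filt_closure by blast

lemma integral_flow:
  "integral_flow base_filtration2 (\<lambda>M. map_coeffs (partial_deriv M)) partial_deriv modifier_series
    (\<lambda>g. lift_filtration (lift_filtration (psum_fractions g)))"
proof -
  \<comment> \<open>X is the inner alphabet, so its derivations act on coefficients; Y is the outer
    one.\<close>
  interpret X: power_sum_derivations base_filtration2 "\<lambda>M. map_coeffs (partial_deriv M)"
    by (rule power_sum_derivations.power_sum_derivations_map_coeffs[OF K.power_sum_derivations_partial_deriv])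
  interpret Y: power_sum_derivations base_filtration2 partial_deriv
    by (rule K1.power_sum_derivations_partial_deriv)
  note Q = rat_filtration_psum_fractions
  note Q1 = rat_filtration_lift[OF Q] and Q2 = rat_filtration_lift[OF rat_filtration_lift[OF Q]]
  show ?thesis
  proof (intro integral_flow.intro integral_flow_axioms.intro flow.intro flow_axioms.intro
      K2.graded_filtration_axioms X.power_sum_derivations_axioms Y.power_sum_derivations_axioms)
    show "psum k (modifier_series M) = modifier_series (k * M)" if "k \<ge> 1" "M \<ge> 1" for k M
      using that by (simp add: psum_constant psum_psum)
    fix g h M n i j :: nat
    show "rat_filtration (lift_filtration (lift_filtration (psum_fractions g)))" if "g \<ge> 1"
      by (rule Q2[OF that])
    show "psum h x \<in> lift_filtration (lift_filtration (psum_fractions (h * g))) (h * n)"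
      if "h \<ge> 1" "g \<ge> 1" "x \<in> lift_filtration (lift_filtration (psum_fractions g)) n" for x
    proof -
      have hg: "h * g \<ge> 1" using that by simp
      show ?thesis
        by (rule lift_filtration_psum[OF Q1[OF hg] that(1) _ that(3)],
            rule lift_filtration_psum[OF Q[OF hg] that(1)], rule psum_fractions_psum[OF that(1,2)])
    qed
    show "map_coeffs (partial_deriv M) x \<in> lift_filtration (lift_filtration (psum_fractions g)) (n + M)"
      if "M \<ge> 1" "g \<ge> 1" "x \<in> lift_filtration (lift_filtration (psum_fractions g)) n" for x
      by (rule lift_filtration_map_coeffs[of "partial_deriv M", OF partial_deriv_zero _ that(3)])
        (rule lift_filtration_partial_deriv[OF Q[OF that(2)]])
    show "partial_deriv M x \<in> lift_filtration (lift_filtration (psum_fractions g)) (n + M)"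
      if "M \<ge> 1" "g \<ge> 1" "x \<in> lift_filtration (lift_filtration (psum_fractions g)) n" for x
      by (rule lift_filtration_partial_deriv[OF Q1[OF that(2)] that(3)])
    assume M: "M \<ge> 1"
    note SM = psum_of_base[OF M, of modifier]
    have one: "1 \<le> (1::nat)" by simp
    show "modifier_series M * (F * G) \<in> lift_filtration (lift_filtration (lift_filtration (psum_fractions 1))) (i + j)"
      if "g dvd M" "h dvd M" "coprime g h" "F \<in> lift_filtration (lift_filtration (lift_filtration (psum_fractions g))) i"
        "G \<in> lift_filtration (lift_filtration (lift_filtration (psum_fractions h))) j" for F G
      by (rule lift_filtration_constant_mult_mult[OF Q2[OF one] _ that(4,5)],
          rule lift_filtration_constant_mult_mult[OF Q1[OF one]],
          rule lift_filtration_constant_mult_mult[OF Q[OF one]])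
        (unfold SM, rule psum_fractions_quadratic[OF M that(1-3)])
    show "modifier_series M * F \<in> lift_filtration (lift_filtration (lift_filtration (psum_fractions 1))) i"
      if "g dvd M" "F \<in> lift_filtration (lift_filtration (lift_filtration (psum_fractions g))) i" for F
      by (rule lift_filtration_constant_mult[OF _ that(2)], rule lift_filtration_constant_mult,
          rule lift_filtration_constant_mult)
        (unfold SM, rule psum_fractions_linear[OF M that(1)])
  qed
qed

lemma modified_hall_Exp:
  assumes u: "u \<in> lift_filtration (psum_fractions 1) 1" and v: "v \<in> lift_filtration (psum_fractions 1) 1"
  shows "modified_hall_converges (of_base modifier) (Exp u) (Exp v)"
    and "\<exists>L. over_modifier L \<in> base_filtration 1 \<and> modified_hall (of_base modifier) (Exp u) (Exp v) = Exp (over_modifier L)"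
proof -
  interpret F: integral_flow base_filtration2 "\<lambda>M. map_coeffs (partial_deriv M)" partial_deriv modifier_series
    "\<lambda>g. lift_filtration (lift_filtration (psum_fractions g))"
    by (rule integral_flow)
  note Q = rat_filtration_psum_fractions[of 1, OF order_refl]
  have sub: "lift_filtration A n \<subseteq> lift_filtration B n" if "\<And>n. A n \<subseteq> B n" for A B :: "nat \<Rightarrow> 'x::zero set" and n
    using that by (auto simp: lift_filtration_def)
  have QK: "psum_fractions 1 n \<subseteq> base_filtration n" for n by (rule psum_fractions_base_filtration) simp
  have uK: "u \<in> lift_filtration base_filtration 1" and vK: "v \<in> lift_filtration base_filtration 1"
    using u v sub[of "psum_fractions 1" base_filtration, OF QK] by blast+
  interpret c: graded_hom base_filtration "lift_filtration base_filtration" constant_series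
    by (rule K.graded_hom_constant)
  interpret c1: graded_hom "lift_filtration base_filtration" base_filtration2 constant_series
    by (rule K1.graded_hom_constant)
  interpret mc: graded_hom "lift_filtration base_filtration" base_filtration2 "map_coeffs constant_series"
    by (rule c.graded_hom_map_coeffs)
  \<comment> \<open>This is A[X]/S + B[Y]/S: \<open>u\<close> is constant in Y, and each coefficient
    of \<open>v\<close> is constant in X.\<close>
  let ?a = "constant_series u + map_coeffs constant_series v"
  have a: "?a \<in> lift_filtration (lift_filtration (psum_fractions 1)) 1"
  proof (rule rat_filtration.add_mem[OF rat_filtration_lift[OF rat_filtration_lift[OF Q]]])
    show "constant_series u \<in> lift_filtration (lift_filtration (psum_fractions 1)) 1"
      by (rule lift_filtration_constant[OF rat_filtration_lift[OF Q] u])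
    show "map_coeffs constant_series v \<in> lift_filtration (lift_filtration (psum_fractions 1)) 1"
      using lift_filtration_map_coeffs[of constant_series "psum_fractions 1" "lift_filtration (psum_fractions 1)" 0 v 1]
        lift_filtration_constant[OF Q] v by (simp add: constant_zero)
  qed
  obtain f where fR: "f \<in> lift_filtration (lift_filtration (lift_filtration (psum_fractions 1))) 1"
    and fK: "f \<in> lift_filtration base_filtration2 1" and f0: "sym_coeff f {#} = ?a"
    and heat: "euler (Exp f) = psum_combination (\<lambda>M. scaleQ (of_nat M ^ 2)
      (modifier_series M * map_coeffs (map_coeffs (partial_deriv M)) (map_coeffs (partial_deriv M) (Exp f))))"
    using F.flow_exists[OF sub[OF sub[OF QK]] a] by blast

  interpret c0: graded_hom "lift_filtration base_filtration2" base_filtration2 "\<lambda>f. sym_coeff f {#}"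
    by (rule K2.graded_hom_constant_term)
  have "sym_coeff (Exp f) {#} = Exp ?a" by (simp add: c0.Exp[OF fK] f0)
  also have "\<dots> = constant_series (Exp u) * map_coeffs constant_series (Exp v)"
    by (subst K2.Exp_add) (simp_all add: c1.map_mem[OF uK] mc.map_mem[OF vK] c1.Exp[OF uK] mc.Exp[OF vK] del: One_nat_def)
  finally have Z0: "sym_coeff (Exp f) {#} = constant_series (Exp u) * map_coeffs constant_series (Exp v)" .
  have inner: "sym_coeff (Exp u * constant_series x) \<tau> = x * sym_coeff (Exp u) \<tau>" for x \<tau>
    by (subst mult.commute) (rule sym_coeff_constant_mult)
  have Z0': "sym_coeff (sym_coeff (constant_series (Exp u) * map_coeffs constant_series (Exp v)) \<tau>) \<tau> =
      sym_coeff (Exp v) \<tau> * sym_coeff (Exp u) \<tau>" for \<tau>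
    by (simp add: sym_coeff_constant_mult sym_coeff_map_coeffs' constant_zero inner)
  have hall_term: "hall_term (plethysm_alphabet (of_base modifier) (Exp u)) (Exp v) \<tau> =
      sym_coeff (sym_coeff (sym_coeff (Exp f) \<tau>) {#}) {#}" if "\<tau> \<in> partitions" for \<tau>
    unfolding heat_solution[OF heat that] Z0 Z0' hall_term_def sym_coeff_plethysm_alphabet
    by (simp add: mult_ac)

  interpret h1: graded_hom base_filtration2 "lift_filtration base_filtration" "\<lambda>f. sym_coeff f {#}"
    by (rule K1.graded_hom_constant_term)
  interpret h2: graded_hom "lift_filtration base_filtration" base_filtration "\<lambda>f. sym_coeff f {#}"
    by (rule K.graded_hom_constant_term)
  interpret m1: graded_hom "lift_filtration base_filtration2" base_filtration2 "map_coeffs (\<lambda>f. sym_coeff f {#})"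
    by (rule h1.graded_hom_map_coeffs)
  interpret m2: graded_hom base_filtration2 "lift_filtration base_filtration" "map_coeffs (\<lambda>f. sym_coeff f {#})"
    by (rule h2.graded_hom_map_coeffs)
  interpret e: graded_hom "lift_filtration base_filtration" base_filtration specialize_one
    by (rule K.graded_hom_specialize_one)
  \<comment> \<open>Setting Y = 0 and then X = 0 leaves a series in T. Both steps are homomorphisms,
    hence commute with \<open>Exp\<close>.\<close>
  let ?h = "\<lambda>z. map_coeffs (\<lambda>f. sym_coeff f {#}) (map_coeffs (\<lambda>f. sym_coeff f {#}) z)"
  have coeff: "sym_coeff (?h z) \<tau> = sym_coeff (sym_coeff (sym_coeff z \<tau>) {#}) {#}"
    for z :: "'a completed_localization sym_series sym_series sym_series" and \<tau>
    by (simp add: sym_coeff_map_coeffs')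
  have mem: "?h f \<in> lift_filtration base_filtration 1" by (rule m2.map_mem[OF m1.map_mem[OF fK]])
  have hExp: "?h (Exp f) = Exp (?h f)"
    by (simp only: m1.Exp[OF fK] m2.Exp[OF m1.map_mem[OF fK]])
  have "sym_coeff (?h (Exp f)) \<tau> \<in> base_filtration (sum_mset \<tau>)" if "\<tau> \<in> partitions" for \<tau>
    unfolding hExp by (rule K.lift_coeff_mem[OF K1.Exp_mem[OF mem] that])
  from K.summable[OF this finite_partitions_less]
  show "modified_hall_converges (of_base modifier) (Exp u) (Exp v)"
    unfolding modified_hall_converges_def hall_converges_def
    by (rule summable_on_cong[THEN iffD2, rotated]) (simp_all add: hall_term coeff)
  have "modified_hall (of_base modifier) (Exp u) (Exp v) = specialize_one (?h (Exp f))"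
    unfolding modified_hall_def hall_def specialize_one_def
    by (rule infsum_cong) (simp add: hall_term coeff)
  also have "\<dots> = Exp (specialize_one (?h f))" unfolding hExp by (rule e.Exp[OF mem])
  finally have hall: "modified_hall (of_base modifier) (Exp u) (Exp v) = Exp (specialize_one (?h f))" .

  \<comment> \<open>Reading off a coefficient through the three lifts costs no denominator beyond S,
    so it has a numerator in \<Lambda> whose degree grows with |\<tau>|.\<close>
  have "\<exists>d\<in>numerators (Suc (sum_mset \<tau>)). sym_coeff (?h f) \<tau> = over_modifier d" for \<tau>
    using lift_filtrationD[OF lift_filtrationD[OF lift_filtrationD[OF fR, of \<tau>], of "{#}"], of "{#}"]
    unfolding coeff psum_fractions_1 by auto
  then obtain d where d: "\<And>\<tau>. d \<tau> \<in> numerators (Suc (sum_mset \<tau>))" "\<And>\<tau>. sym_coeff (?h f) \<tau> = over_modifier (d \<tau>)"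
    by metis
  interpret o: graded_map "filt_closure numerators" base_filtration over_modifier
    by (rule graded_map_over_modifier)
  \<comment> \<open>The growing degrees make the numerators summable in \<Lambda>, and
    \<open>o.infsum\<close> identifies L/S with the value of f at T = 1, X = Y = 0.\<close>
  define L where "L = infsum d partitions"
  have "over_modifier L = specialize_one (?h f)"
    unfolding L_def specialize_one_def d(2)
  proof (rule o.infsum)
    show "d \<tau> \<in> filt_closure numerators (sum_mset \<tau>)" for \<tau>
      using o.K.Suc_mem subset_filt_closure d(1) by blast
  qed (rule finite_partitions_less)
  with hall e.map_mem[OF mem]
  show "\<exists>L. over_modifier L \<in> base_filtration 1 \<and> modified_hall (of_base modifier) (Exp u) (Exp v) = Exp (over_modifier L)"
    by metis
qed

end

theorem lemma5p3:
  fixes A B :: "'a::modified_lambda_ring sym_series"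
  assumes "well_behaved_series A" and "well_behaved_series B"
  shows "Exp_converges (map_coeffs over_modifier A) \<and>
    Exp_converges (map_coeffs over_modifier B) \<and>
    modified_hall_converges (of_base modifier)
      (Exp (map_coeffs over_modifier A)) (Exp (map_coeffs over_modifier B)) \<and>
    (\<exists>L :: 'a. Exp_converges (over_modifier L) \<and>
      modified_hall (of_base modifier)
        (Exp (map_coeffs over_modifier A)) (Exp (map_coeffs over_modifier B))
      = Exp (over_modifier L))"
proof -
  interpret W: well_behaved_family "UNIV \<times> partitions"
    "\<lambda>(b, \<nu>). sym_coeff (if b then A else B) \<nu>" "\<lambda>(b, \<nu>). Suc (sum_mset \<nu>)"
    by (rule well_behaved_family_coeffs[OF assms])
  \<comment> \<open>The coefficient at \<open>\<nu>\<close> is a generator of weight |\<nu>| + 1,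
    exactly what degree 1 demands.\<close>
  have mem: "map_coeffs over_modifier (if b then A else B) \<in> lift_filtration (W.psum_fractions 1) 1" for b
  proof (rule lift_filtrationI)
    fix \<nu>
    show "sym_coeff (map_coeffs over_modifier (if b then A else B)) \<nu> \<in> W.psum_fractions 1 (1 + sum_mset \<nu>)"
    proof (cases "\<nu> \<in> partitions")
      case True
      then have "sym_coeff (if b then A else B) \<nu> \<in> W.numerators (Suc (sum_mset \<nu>))"
        using W.generator_in_numerators[of "(b, \<nu>)"] by simp
      from W.over_modifier_in_psum_fractions[OF this] show ?thesis
        by (simp add: sym_coeff_map_coeffs' over_modifier_zero)
    next
      case False
      then show ?thesis
        using rat_filtration.zero_mem[OF W.rat_filtration_psum_fractions[OF order_refl]] by (simp add: sym_coeff_outside)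
    qed
  qed
  note AB = mem[of True, simplified if_True] mem[of False, simplified if_False]
  have sub: "lift_filtration (W.psum_fractions 1) 1 \<subseteq> lift_filtration W.base_filtration 1"
    using W.psum_fractions_base_filtration[of 1] by (auto simp: lift_filtration_def)
  from W.modified_hall_Exp[OF AB] show ?thesis
    using W.K1.Exp_converges W.K.Exp_converges AB sub by blast
qed

end
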